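(* Let $p$ be a prime, let $K$ be a finite field extension of $\mathbb{Q}_p$ with inertia degree $f$, let $D$ be a finite dimensional central division $K$-algebra of index $n$ over $K$ (that is, $\dim_K(D)=n^2$), and let $\Delta$ be the unique maximal $\mathcal{O}_K$-order in $D$. Assume that $f\geq 2$ or $(p,n)\notin\{(2,2),(3,3)\}$, and let $m\in\mathbb{N}$. Then the $\mathbb{Z}_p$-Lie lattice $p^m sl_1(\Delta)$ is not self-similar of index $p$.
   Context: $\mathbb{N}=\{0,1,2,\dots\}$. $\mathcal{O}_K$ is the integral closure of $\mathbb{Z}_p$ in $K$. $sl_1(\Delta)$ is the set of elements of $\Delta$ of reduced trace $0$ (reduced trace $D\to K$), a $\mathbb{Z}_p$-Lie lattice under the commutator bracket. A $\mathbb{Z}_p$-Lie lattice is a finitely generated free $\mathbb{Z}_p$-module endowed with a structure of Lie algebra over $\mathbb{Z}_p$. A virtual endomorphism of a $\mathbb{Z}_p$-Lie lattice $L$ of index $p$ is a Lie algebra homomorphism $\varphi:M\to L$ where $M$ is a $\mathbb{Z}_p$-subalgebra of $L$ of index $p$ (index of additive groups). It is simple if there is no nonzero ideal $I$ of $L$ with $I\subseteq M$ and $\varphi(I)\subseteq I$. $L$ is self-similar of index $p$ if there exists a simple virtual endomorphism of $L$ of index $p$. *)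

theory Defs
  imports
    "HOL-Algebra.Algebraic_Closure_Type"
    "HOL-Computational_Algebra.Fraction_Field"
    "HOL-Library.FuncSet"
    "Berlekamp_Zassenhaus.Finite_Field"
    "Jordan_Normal_Form.Matrix"
begin

text \<open>
  The prime is carried by a type: for \<open>'p :: prime_card\<close> the number \<open>CARD('p)\<close> is prime.
  The ring \<open>'p padic_int\<close> is the inverse limit of the rings of integers modulo
  \<open>CARD('p) ^ k\<close>, each residue class being represented by its least nonnegative element.
\<close>

typedef (overloaded) 'p padic_int =
  "{x :: nat \<Rightarrow> int. \<forall>k. 0 \<le> x k \<and> x k < int CARD('p::prime_card) ^ k
      \<and> x (Suc k) mod int CARD('p) ^ k = x k}"
  by (rule exI[of _ "\<lambda>_. 0"]) (simp add: zero_less_power prime_gt_0_int prime_card_int)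

setup_lifting type_definition_padic_int

lemma padic_coherentI:
  fixes P :: int
  assumes "P > 0" and "b mod P ^ k = a mod P ^ k"
  shows "0 \<le> a mod P ^ k \<and> a mod P ^ k < P ^ k \<and> b mod P ^ Suc k mod P ^ k = a mod P ^ k"
  using assms by (auto simp: mod_mod_cancel)

lemma padic_pos: "int CARD('p::prime_card) > 0"
  by (simp add: prime_gt_0_int prime_card_int)

instantiation padic_int :: (prime_card) comm_ring_1
begin

lift_definition zero_padic_int :: "'a padic_int" is "\<lambda>_. 0"
  by (simp add: padic_pos)

lift_definition one_padic_int :: "'a padic_int" is "\<lambda>k. 1 mod int CARD('a) ^ k"
  by (rule padic_coherentI[OF padic_pos]) simp

lift_definition plus_padic_int :: "'a padic_int \<Rightarrow> 'a padic_int \<Rightarrow> 'a padic_int"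
  is "\<lambda>x y k. (x k + y k) mod int CARD('a) ^ k"
  by (rule padic_coherentI[OF padic_pos]) (metis mod_add_eq)

lift_definition minus_padic_int :: "'a padic_int \<Rightarrow> 'a padic_int \<Rightarrow> 'a padic_int"
  is "\<lambda>x y k. (x k - y k) mod int CARD('a) ^ k"
  by (rule padic_coherentI[OF padic_pos]) (metis mod_diff_eq)

lift_definition uminus_padic_int :: "'a padic_int \<Rightarrow> 'a padic_int"
  is "\<lambda>x k. (- x k) mod int CARD('a) ^ k"
  by (rule padic_coherentI[OF padic_pos]) (metis mod_minus_eq)

lift_definition times_padic_int :: "'a padic_int \<Rightarrow> 'a padic_int \<Rightarrow> 'a padic_int"
  is "\<lambda>x y k. (x k * y k) mod int CARD('a) ^ k"
  by (rule padic_coherentI[OF padic_pos]) (metis mod_mult_eq)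

instance
proof
  fix a b c :: "'a padic_int"
  show "a * b * c = a * (b * c)"
    by transfer (auto simp: mod_simps mult.assoc)
  show "a * b = b * a"
    by transfer (auto simp: mult.commute)
  show "1 * a = a"
    by transfer (auto simp: mod_simps)
  show "a + b + c = a + (b + c)"
    by transfer (auto simp: mod_simps add.assoc)
  show "a + b = b + a"
    by transfer (auto simp: add.commute)
  show "0 + a = a"
    by transfer auto
  show "- a + a = 0"
    by transfer (auto simp: mod_simps)
  show "a - b = a + - b"
    by transfer (auto simp: mod_simps)
  show "(a + b) * c = a * c + b * c"
    by transfer (auto simp: mod_simps algebra_simps)
  show "(0 :: 'a padic_int) \<noteq> 1"
  proof transfer
    have "int CARD('a) > 1"
      by (rule prime_gt_1_int[OF prime_card_int])
    then have "(1 :: int) mod int CARD('a) ^ 1 \<noteq> 0"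
      by simp
    then show "(\<lambda>_. 0) \<noteq> (\<lambda>k. 1 mod int CARD('a) ^ k)"
      by metis
  qed
qed

end

lemma padic_coherent:
  fixes x :: "nat \<Rightarrow> int" and P :: int
  assumes "\<forall>k. 0 \<le> x k \<and> x k < P ^ k \<and> x (Suc k) mod P ^ k = x k"
  shows "x (i + j) mod P ^ i = x i"
proof (induction j)
  case 0
  then show ?case using assms by simp
next
  case (Suc j)
  have "x (Suc (i + j)) mod P ^ (i + j) mod P ^ i = x (i + j) mod P ^ i"
    using assms by simp
  then show ?case using Suc by (simp add: mod_mod_cancel le_imp_power_dvd)
qed

instance padic_int :: (prime_card) idom
proof
  fix a b :: "'a padic_int"
  assume "a \<noteq> 0" "b \<noteq> 0"
  then show "a * b \<noteq> 0"
  proof transfer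
    fix x y :: "nat \<Rightarrow> int"
    let ?P = "int CARD('a)"
    assume x: "\<forall>k. 0 \<le> x k \<and> x k < ?P ^ k \<and> x (Suc k) mod ?P ^ k = x k"
      and y: "\<forall>k. 0 \<le> y k \<and> y k < ?P ^ k \<and> y (Suc k) mod ?P ^ k = y k"
      and nz: "x \<noteq> (\<lambda>_. 0)" "y \<noteq> (\<lambda>_. 0)"
    obtain i j where ij: "x i \<noteq> 0" "y j \<noteq> 0"
      using nz by blast
    have "x 0 = 0"
      using x[rule_format, of 0] by simp
    then have i0: "i > 0"
      using ij by (cases i) auto
    have nx: "\<not> ?P ^ i dvd x (i + j)"
      using padic_coherent[OF x, of i j] ij(1) by (auto simp: dvd_eq_mod_eq_0)
    have ny: "\<not> ?P ^ j dvd y (i + j)"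
      using padic_coherent[OF y, of j i] ij(2) by (auto simp: dvd_eq_mod_eq_0 add.commute)
    have "\<not> ?P ^ (i + j) dvd x (i + j) * y (i + j)"
    proof
      assume "?P ^ (i + j) dvd x (i + j) * y (i + j)"
      then have "?P ^ (i + j - 1) dvd x (i + j) * y (i + j)"
        by (meson diff_le_self dvd_trans le_imp_power_dvd)
      moreover have "prime_elem ?P"
        using prime_card_int[where ?'a = 'a] by (rule prime_imp_prime_elem)
      ultimately show False
        using prime_elem_power_dvd_cases[of ?P "i + j - 1" "x (i + j)" "y (i + j)" i j] nx ny i0
        by auto
    qed
    then show "(\<lambda>k. x k * y k mod ?P ^ k) \<noteq> (\<lambda>_. 0)"
      by (metis dvd_eq_mod_eq_0)
  qed
qed

type_synonym 'p padic = "'p padic_int fract"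

definition padic_of_int :: "'p::prime_card padic_int \<Rightarrow> 'p padic" where
  "padic_of_int z = Fract z 1"

locale unital_algebra = vector_space scale
  for scale :: "'k::field \<Rightarrow> 'a::ring_1 \<Rightarrow> 'a" +
  assumes scale_mult_left: "scale c x * y = scale c (x * y)"
    and mult_scale_right: "x * scale c y = scale c (x * y)"

text \<open>
  \<open>vector_space.dim\<close> is 0 for spaces of infinite dimension, so finite dimensionality is
  always required separately.
\<close>

definition finite_dim :: "('k::field \<Rightarrow> 'v::ab_group_add \<Rightarrow> 'v) \<Rightarrow> bool" where
  "finite_dim scale \<longleftrightarrow> (\<exists>B. finite B \<and> module.span scale B = UNIV)"

definition central :: "('k::field \<Rightarrow> 'a::ring_1 \<Rightarrow> 'a) \<Rightarrow> bool" where
  "central scale \<longleftrightarrow> {x. \<forall>y. x * y = y * x} = range (\<lambda>c. scale c 1)"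

text \<open>A field extension of the p-adic numbers is given by its algebra structure \<open>sK\<close>.\<close>

definition padic_field_extension :: "('p::prime_card padic \<Rightarrow> 'k::field \<Rightarrow> 'k) \<Rightarrow> bool" where
  "padic_field_extension sK \<longleftrightarrow> unital_algebra sK \<and> finite_dim sK"

definition zp_embed :: "('p::prime_card padic \<Rightarrow> 'k::field \<Rightarrow> 'k) \<Rightarrow> 'p padic_int \<Rightarrow> 'k" where
  "zp_embed sK z = sK (padic_of_int z) 1"

definition integer_ring :: "('p::prime_card padic \<Rightarrow> 'k::field \<Rightarrow> 'k) \<Rightarrow> 'k set" where
  "integer_ring sK =
     {x. \<exists>q :: 'p padic_int poly. lead_coeff q = 1 \<and> poly (map_poly (zp_embed sK) q) x = 0}"

text \<open>
  The ring of integers is local, so its maximal ideal consists of the nonunits. The inertia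
  degree is the degree of the residue field over the image of the p-adic integers in it.
\<close>

definition integer_ring_struct :: "('p::prime_card padic \<Rightarrow> 'k::field \<Rightarrow> 'k) \<Rightarrow> 'k ring" where
  "integer_ring_struct sK = (ring_of_type_algebra :: 'k ring)\<lparr>carrier := integer_ring sK\<rparr>"

definition integer_max_ideal :: "('p::prime_card padic \<Rightarrow> 'k::field \<Rightarrow> 'k) \<Rightarrow> 'k set" where
  "integer_max_ideal sK = integer_ring sK - Units (integer_ring_struct sK)"

definition residue_field :: "('p::prime_card padic \<Rightarrow> 'k::field \<Rightarrow> 'k) \<Rightarrow> 'k set ring" where
  "residue_field sK = integer_ring_struct sK Quot integer_max_ideal sK"

definition residue_prime_field :: "('p::prime_card padic \<Rightarrow> 'k::field \<Rightarrow> 'k) \<Rightarrow> 'k set set" where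
  "residue_prime_field sK =
     range (\<lambda>z. integer_max_ideal sK +>\<^bsub>integer_ring_struct sK\<^esub> zp_embed sK z)"

definition inertia_degree :: "('p::prime_card padic \<Rightarrow> 'k::field \<Rightarrow> 'k) \<Rightarrow> nat" where
  "inertia_degree sK =
     ring.dim (residue_field sK) (residue_prime_field sK) (carrier (residue_field sK))"

text \<open>
  A splitting of a \<open>K\<close>-algebra \<open>D\<close> over the algebraic closure \<open>L\<close> of \<open>K\<close> is an
  isomorphism of \<open>L\<close>-algebras from the scalar extension of \<open>D\<close> to \<open>L\<close> onto the
  \<open>n \<times> n\<close> matrices over \<open>L\<close>. By the universal property of the tensor product it is the
  \<open>L\<close>-linear extension of a unital \<open>K\<close>-algebra homomorphism \<open>\<rho>\<close> from \<open>D\<close> to the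
  matrices; this extension sends the family \<open>c\<close> of coordinates with respect to a
  \<open>K\<close>-basis \<open>B\<close> to the sum of the matrices \<open>c b \<cdot> \<rho> b\<close>.
\<close>

definition splitting ::
  "('k::field \<Rightarrow> 'd::ring_1 \<Rightarrow> 'd) \<Rightarrow> nat \<Rightarrow> ('d \<Rightarrow> 'k alg_closure mat) \<Rightarrow> bool" where
  "splitting sD n \<rho> \<longleftrightarrow>
     (\<forall>x. \<rho> x \<in> carrier_mat n n) \<and>
     \<rho> 1 = 1\<^sub>m n \<and>
     (\<forall>x y. \<rho> (x + y) = \<rho> x + \<rho> y) \<and>
     (\<forall>x y. \<rho> (x * y) = \<rho> x * \<rho> y) \<and>
     (\<forall>a x. \<rho> (sD a x) = to_ac a \<cdot>\<^sub>m \<rho> x) \<and>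
     (\<exists>B. finite B \<and> \<not> module.dependent sD B \<and> module.span sD B = UNIV \<and>
        bij_betw (\<lambda>c. mat n n (\<lambda>(i, j). \<Sum>b\<in>B. c b * (\<rho> b $$ (i, j))))
          (B \<rightarrow>\<^sub>E UNIV) (carrier_mat n n))"

definition reduced_trace :: "('k::field \<Rightarrow> 'd::ring_1 \<Rightarrow> 'd) \<Rightarrow> nat \<Rightarrow> 'd \<Rightarrow> 'k" where
  "reduced_trace sD n x =
     (THE t. \<exists>\<rho>. splitting sD n \<rho> \<and> to_ac t = (\<Sum>i<n. \<rho> x $$ (i, i)))"

definition is_order :: "'k::field set \<Rightarrow> ('k \<Rightarrow> 'd::ring_1 \<Rightarrow> 'd) \<Rightarrow> 'd set \<Rightarrow> bool" where
  "is_order R sD \<Lambda> \<longleftrightarrow>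
     1 \<in> \<Lambda> \<and>
     (\<forall>x\<in>\<Lambda>. \<forall>y\<in>\<Lambda>. x - y \<in> \<Lambda> \<and> x * y \<in> \<Lambda>) \<and>
     (\<exists>S. finite S \<and> \<Lambda> = {\<Sum>s\<in>S. sD (c s) s | c. \<forall>s\<in>S. c s \<in> R}) \<and>
     module.span sD \<Lambda> = UNIV"

definition is_maximal_order :: "'k::field set \<Rightarrow> ('k \<Rightarrow> 'd::ring_1 \<Rightarrow> 'd) \<Rightarrow> 'd set \<Rightarrow> bool" where
  "is_maximal_order R sD \<Lambda> \<longleftrightarrow>
     is_order R sD \<Lambda> \<and> (\<forall>\<Gamma>. is_order R sD \<Gamma> \<and> \<Lambda> \<subseteq> \<Gamma> \<longrightarrow> \<Gamma> = \<Lambda>)"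

definition sl_one :: "('k::field \<Rightarrow> 'd::ring_1 \<Rightarrow> 'd) \<Rightarrow> nat \<Rightarrow> 'd set \<Rightarrow> 'd set" where
  "sl_one sD n \<Lambda> = {x \<in> \<Lambda>. reduced_trace sD n x = 0}"

definition commutator :: "'d::ring_1 \<Rightarrow> 'd \<Rightarrow> 'd" where
  "commutator x y = x * y - y * x"

text \<open>
  Here \<open>L\<close> is a Lie lattice sitting inside an ambient module over the p-adic integers with
  scalar multiplication \<open>smul\<close>, and \<open>br\<close> is its Lie bracket. Only the values of a virtual
  endomorphism \<open>\<phi>\<close> on its domain \<open>M\<close> matter.
\<close>

definition lie_subalgebra ::
  "('z::comm_ring_1 \<Rightarrow> 'a::ab_group_add \<Rightarrow> 'a) \<Rightarrow> ('a \<Rightarrow> 'a \<Rightarrow> 'a) \<Rightarrow> 'a set \<Rightarrow> 'a set \<Rightarrow> bool" where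
  "lie_subalgebra smul br L M \<longleftrightarrow>
     M \<subseteq> L \<and> module.subspace smul M \<and> (\<forall>x\<in>M. \<forall>y\<in>M. br x y \<in> M)"

definition lie_ideal ::
  "('z::comm_ring_1 \<Rightarrow> 'a::ab_group_add \<Rightarrow> 'a) \<Rightarrow> ('a \<Rightarrow> 'a \<Rightarrow> 'a) \<Rightarrow> 'a set \<Rightarrow> 'a set \<Rightarrow> bool" where
  "lie_ideal smul br L I \<longleftrightarrow>
     I \<subseteq> L \<and> module.subspace smul I \<and> (\<forall>x\<in>L. \<forall>y\<in>I. br x y \<in> I)"

text \<open>The index is 0 if there are infinitely many cosets.\<close>

definition add_index :: "'a::ab_group_add set \<Rightarrow> 'a set \<Rightarrow> nat" where
  "add_index L M = card ((\<lambda>x. (\<lambda>y. x + y) ` M) ` L)"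

definition virtual_endomorphism ::
  "('z::comm_ring_1 \<Rightarrow> 'a::ab_group_add \<Rightarrow> 'a) \<Rightarrow> ('a \<Rightarrow> 'a \<Rightarrow> 'a) \<Rightarrow> 'a set \<Rightarrow> nat
     \<Rightarrow> 'a set \<Rightarrow> ('a \<Rightarrow> 'a) \<Rightarrow> bool" where
  "virtual_endomorphism smul br L k M \<phi> \<longleftrightarrow>
     lie_subalgebra smul br L M \<and> add_index L M = k \<and>
     (\<forall>x\<in>M. \<phi> x \<in> L) \<and>
     (\<forall>x\<in>M. \<forall>y\<in>M. \<phi> (x + y) = \<phi> x + \<phi> y) \<and>
     (\<forall>a. \<forall>x\<in>M. \<phi> (smul a x) = smul a (\<phi> x)) \<and>
     (\<forall>x\<in>M. \<forall>y\<in>M. \<phi> (br x y) = br (\<phi> x) (\<phi> y))"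

definition simple_virtual_endomorphism ::
  "('z::comm_ring_1 \<Rightarrow> 'a::ab_group_add \<Rightarrow> 'a) \<Rightarrow> ('a \<Rightarrow> 'a \<Rightarrow> 'a) \<Rightarrow> 'a set \<Rightarrow> nat
     \<Rightarrow> 'a set \<Rightarrow> ('a \<Rightarrow> 'a) \<Rightarrow> bool" where
  "simple_virtual_endomorphism smul br L k M \<phi> \<longleftrightarrow>
     virtual_endomorphism smul br L k M \<phi> \<and>
     \<not> (\<exists>I. lie_ideal smul br L I \<and> I \<noteq> {0} \<and> I \<subseteq> M \<and> \<phi> ` I \<subseteq> I)"

definition self_similar ::
  "('z::comm_ring_1 \<Rightarrow> 'a::ab_group_add \<Rightarrow> 'a) \<Rightarrow> ('a \<Rightarrow> 'a \<Rightarrow> 'a) \<Rightarrow> 'a set \<Rightarrow> nat \<Rightarrow> bool" where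
  "self_similar smul br L k \<longleftrightarrow> (\<exists>M \<phi>. simple_virtual_endomorphism smul br L k M \<phi>)"

end

theory Submission
  imports
    Defs
    "HOL-Library.Diagonal_Subsequence"
    "HOL-Number_Theory.Cong"
    "Jordan_Normal_Form.Determinant"
begin

text \<open>
  Let \<open>D'\<close> be the span of the commutators of \<open>D\<close>; then \<open>D\<close> is the direct sum of \<open>D'\<close> and the
  center. A Lie automorphism \<open>\<theta>\<close> of \<open>D\<close> over the \<open>p\<close>-adic numbers maps a maximal subfield \<open>E\<close> to a
  maximal subfield and permutes the roots, which are the differences of two embeddings of the subfield
  into an algebraic closure that agree on the center. All roots \<open>e\<^sub>0 - e\<close> with a common \<open>e\<^sub>0\<close>
  correspond to roots \<open>\<plusminus> (a - c)\<close> with a common \<open>a\<close>;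
  summing them shows that \<open>e\<^sub>0 \<circ> \<theta> = \<plusminus> a\<close> on \<open>E \<inter> D'\<close>. Hence for \<open>x \<in> D'\<close> every polynomial that
  annihilates \<open>x\<close> annihilates \<open>\<theta> x\<close> or \<open>- \<theta> x\<close>, and \<open>\<theta>\<close> preserves integrality on \<open>D'\<close>.

  Now let \<open>\<phi>\<close> be a virtual endomorphism of finite index. If \<open>\<phi>\<close> is not injective, the
  integral elements of the kernel of its linear extension to \<open>D'\<close> give, after multiplication by a power
  of \<open>p\<close>, a nonzero ideal that \<open>\<phi>\<close> kills. If \<open>\<phi>\<close> is injective, it extends to some \<open>\<theta>\<close> as
  above, and a multiple \<open>p\<^sup>N I\<close> of the set \<open>I\<close> of integral elements of \<open>D'\<close> is a nonzero ideal
  that \<open>\<phi>\<close> maps into itself. If \<open>D\<close> is commutative, the Lie lattice is zero.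
\<close>

text \<open>The tensor product of \<open>D\<close> with the algebraic closure is never formed. Its
  dual stands in for it: functionals on \<open>D\<close> with values in the closure, on which a
  subfield acts by left and by right multiplication. Roots become weights of eigenfunctionals, and
  composing a functional with \<theta> transports them. The sign is unavoidable: after scalar
  extension \<open>D\<close> becomes a product of matrix algebras, one for each embedding of the
  center, and negative transposition is a Lie automorphism of each. Roots determine the embeddings
  of a class only up to a common shift; this is why the comparison is made on commutators, where
  each class sums to zero. The other obstacle is that sums and products of integral elements of a
  noncommutative ring are not obviously integral. Integrality is therefore characterised by the
  regular norm, the determinant of left multiplication on a lattice. This rests on compactness of
  the p-adic integers and on the absence of zero divisors, and it also shows that the integral
  elements form a bounded set.\<close>

locale fd_division_algebra = unital_algebra scale
  for scale :: "'f::field \<Rightarrow> 'd::division_ring \<Rightarrow> 'd" +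
  assumes fin_dim: "finite_dim scale"
begin

lemma scale_eq_mult: "scale a x = scale a 1 * x"
  using scale_mult_left[of a 1 x] by simp

lemma scale_one_commute: "scale a 1 * x = x * scale a 1"
  using scale_mult_left[of a 1 x] mult_scale_right[of x a 1] by simp

lemma scale_one_mult: "scale a 1 * scale b 1 = scale (a * b) 1"
  by (simp add: scale_mult_left)

subsection \<open>Bases over division subrings\<close>

definition division_subring :: "'d set \<Rightarrow> bool" where
  "division_subring E \<longleftrightarrow> (\<forall>a. scale a 1 \<in> E) \<and>
     (\<forall>x\<in>E. \<forall>y\<in>E. x + y \<in> E \<and> x * y \<in> E) \<and> (\<forall>x\<in>E. inverse x \<in> E)"

lemma division_subringD:
  assumes "division_subring E"
  shows "0 \<in> E" "1 \<in> E" "scale a 1 \<in> E" "x \<in> E \<Longrightarrow> y \<in> E \<Longrightarrow> x + y \<in> E"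
    "x \<in> E \<Longrightarrow> y \<in> E \<Longrightarrow> x * y \<in> E" "x \<in> E \<Longrightarrow> inverse x \<in> E" "x \<in> E \<Longrightarrow> - x \<in> E"
    "x \<in> E \<Longrightarrow> y \<in> E \<Longrightarrow> x - y \<in> E" "x \<in> E \<Longrightarrow> scale a x \<in> E"
proof -
  note E = assms[unfolded division_subring_def]
  show s: "scale a 1 \<in> E" for a using E by blast
  show "0 \<in> E" using s[of 0] by simp
  show "1 \<in> E" using s[of 1] by simp
  show add: "x \<in> E \<Longrightarrow> y \<in> E \<Longrightarrow> x + y \<in> E" for x y using E by blast
  show mult: "x \<in> E \<Longrightarrow> y \<in> E \<Longrightarrow> x * y \<in> E" for x y using E by blast
  show "x \<in> E \<Longrightarrow> inverse x \<in> E" using E by blast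
  show sc: "x \<in> E \<Longrightarrow> scale a x \<in> E" for a x using mult[OF s[of a]] scale_eq_mult by metis
  show neg: "x \<in> E \<Longrightarrow> - x \<in> E" for x using sc[of x "-1"] by simp
  show "x \<in> E \<Longrightarrow> y \<in> E \<Longrightarrow> x - y \<in> E" using add[OF _ neg] by (metis diff_conv_add_uminus)
qed

lemma division_subring_sum:
  "division_subring E \<Longrightarrow> (\<And>i. i \<in> I \<Longrightarrow> f i \<in> E) \<Longrightarrow> sum f I \<in> E"
  by (induction I rule: infinite_finite_induct) (auto simp: division_subringD)

lemma division_subring_scalars: "division_subring (range (\<lambda>a. scale a 1))"
  unfolding division_subring_def
proof (intro conjI ballI allI)
  fix x y assume "x \<in> range (\<lambda>a. scale a 1)" "y \<in> range (\<lambda>a. scale a 1)"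
  then obtain a b where ab: "x = scale a 1" "y = scale b 1" by auto
  show "x + y \<in> range (\<lambda>a. scale a 1)" by (auto simp: ab scale_left_distrib[symmetric])
  show "x * y \<in> range (\<lambda>a. scale a 1)" by (auto simp: ab scale_one_mult)
next
  fix x assume "x \<in> range (\<lambda>a. scale a 1)"
  then obtain a where a: "x = scale a 1" by auto
  show "inverse x \<in> range (\<lambda>a. scale a 1)"
  proof (cases "a = 0")
    case True then show ?thesis using a by (auto intro: image_eqI[of _ _ 0])
  next
    case False
    then have "x * scale (inverse a) 1 = 1" by (simp add: a scale_one_mult)
    then have "inverse x = scale (inverse a) 1" by (rule inverse_unique)
    then show ?thesis by auto
  qed
qed auto

text \<open>\<open>E\<close> is a set inside the type of \<open>D\<close> and need not be
  commutative, so \<open>D\<close> is treated directly as a left vector space over it. Later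
  \<open>E\<close> is the set of scalars, the center or a commutative subfield.\<close>

definition left_independent :: "'d set \<Rightarrow> 'd set \<Rightarrow> bool" where
  "left_independent E B \<longleftrightarrow>
     (\<forall>a. (\<forall>b\<in>B. a b \<in> E) \<longrightarrow> (\<Sum>b\<in>B. a b * b) = 0 \<longrightarrow> (\<forall>b\<in>B. a b = 0))"

lemma left_independentD:
  assumes "left_independent E B" "\<And>b. b \<in> B \<Longrightarrow> a b \<in> E" "(\<Sum>b\<in>B. a b * b) = 0" "b \<in> B"
  shows "a b = 0"
  using assms unfolding left_independent_def by blast

lemma obtain_spanning: obtains S where "finite S" "span S = UNIV"
  using fin_dim unfolding finite_dim_def by auto

text \<open>The scalars lie in \<open>E\<close>, so independence over \<open>E\<close> implies
  independence over the base field. The resulting bound lets \<open>left_basis_exists\<close> choose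
  a largest independent set.\<close>

lemma left_independent_card:
  assumes E: "division_subring E" and B: "finite B" "left_independent E B"
    and S: "finite S" "span S = UNIV"
  shows "card B \<le> card S"
proof -
  have "independent B"
  proof (rule independent_if_scalars_zero[OF B(1)])
    fix f x assume "(\<Sum>x\<in>B. scale (f x) x) = 0" "x \<in> B"
    then have "(\<Sum>x\<in>B. scale (f x) 1 * x) = 0" by (simp add: scale_eq_mult[symmetric])
    then have "scale (f x) 1 = 0"
      using \<open>x \<in> B\<close> division_subringD(3)[OF E]
      by (intro left_independentD[OF B(2), of "\<lambda>x. scale (f x) 1" x])
    then show "f x = 0" by simp
  qed
  then show ?thesis using independent_span_bound[OF S(1), of B] S(2) by auto
qed

lemma sum_delta_mult:
  fixes c :: 'd
  assumes "finite B" "c \<in> B"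
  shows "(\<Sum>b\<in>B. (if b = c then 1 else 0) * b) = c"
proof -
  have "(\<Sum>b\<in>B. (if b = c then 1 else 0) * b) = (\<Sum>b\<in>B. if b = c then b else 0)"
    by (rule sum.cong) auto
  then show ?thesis using assms by (simp add: sum.delta)
qed

lemma left_independent_insert:
  assumes E: "division_subring E" and B: "finite B" "left_independent E B"
    and x: "\<nexists>a. (\<forall>b\<in>B. a b \<in> E) \<and> x = (\<Sum>b\<in>B. a b * b)"
  shows "x \<notin> B" "left_independent E (insert x B)"
proof -
  show xB: "x \<notin> B"
  proof
    assume "x \<in> B"
    then have "x = (\<Sum>b\<in>B. (if b = x then 1 else 0) * b)"
      using B(1) by (simp add: sum_delta_mult)
    moreover have "\<forall>b\<in>B. (if b = x then 1 else 0) \<in> E" using division_subringD(1,2)[OF E] by simp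
    ultimately show False using x by (elim notE, intro exI[of _ "\<lambda>b. if b = x then 1 else 0"] conjI)
  qed
  show "left_independent E (insert x B)"
    unfolding left_independent_def
  proof (intro allI impI)
    fix a assume a: "\<forall>b\<in>insert x B. a b \<in> E" and s: "(\<Sum>b\<in>insert x B. a b * b) = 0"
    have s': "a x * x + (\<Sum>b\<in>B. a b * b) = 0" using s B(1) xB by simp
    have ax: "a x = 0"
    proof (rule ccontr)
      assume nz: "a x \<noteq> 0"
      have "x = inverse (a x) * (a x * x)" using nz by (simp add: mult.assoc[symmetric])
      also have "a x * x = - (\<Sum>b\<in>B. a b * b)" using s' by (simp add: eq_neg_iff_add_eq_0)
      also have "inverse (a x) * - (\<Sum>b\<in>B. a b * b) = (\<Sum>b\<in>B. (- inverse (a x) * a b) * b)"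
        by (simp add: sum_distrib_left sum_negf[symmetric] mult.assoc)
      finally have "x = (\<Sum>b\<in>B. (- inverse (a x) * a b) * b)" .
      moreover have "\<forall>b\<in>B. - inverse (a x) * a b \<in> E"
        using a division_subringD[OF E] by simp
      ultimately show False using x
        by (elim notE, intro exI[of _ "\<lambda>b. - inverse (a x) * a b"] conjI)
    qed
    then have "\<forall>b\<in>B. a b = 0" using s' a B(2) unfolding left_independent_def by auto
    then show "\<forall>b\<in>insert x B. a b = 0" using ax by auto
  qed
qed

text \<open>\<open>V\<close> is only a set: coordinates are promised for its members, and the rules
  for sums and multiples ask for membership again. Outside \<open>V\<close> the values of \<pi>
  carry no meaning.\<close>

definition left_basis :: "'d set \<Rightarrow> 'd set \<Rightarrow> 'd set \<Rightarrow> ('d \<Rightarrow> 'd \<Rightarrow> 'd) \<Rightarrow> bool" where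
  "left_basis E V B \<pi> \<longleftrightarrow> finite B \<and> B \<subseteq> V \<and> left_independent E B \<and>
     (\<forall>x\<in>V. \<forall>b\<in>B. \<pi> b x \<in> E) \<and> (\<forall>x\<in>V. x = (\<Sum>b\<in>B. \<pi> b x * b))"

lemma left_basisD:
  assumes "left_basis E V B \<pi>"
  shows "finite B" "B \<subseteq> V" "left_independent E B" "x \<in> V \<Longrightarrow> b \<in> B \<Longrightarrow> \<pi> b x \<in> E"
    "x \<in> V \<Longrightarrow> x = (\<Sum>b\<in>B. \<pi> b x * b)"
  using assms unfolding left_basis_def by blast+

lemma left_basis_exists:
  assumes E: "division_subring E" and V: "0 \<in> V"
  shows "\<exists>B \<pi>. left_basis E V B \<pi>"
proof -
  obtain S where S: "finite S" "span S = UNIV" by (rule obtain_spanning)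
  let ?P = "\<lambda>k. \<exists>B. finite B \<and> B \<subseteq> V \<and> left_independent E B \<and> card B = k"
  have "?P 0" by (intro exI[of _ "{}"]) (auto simp: left_independent_def)
  moreover have "k \<le> card S" if "?P k" for k using that left_independent_card[OF E _ _ S] by auto
  ultimately have "\<exists>k. ?P k \<and> (\<forall>j. ?P j \<longrightarrow> j \<le> k)"
    by (intro ex_has_greatest_nat[where b = "Suc (card S)" and f = "\<lambda>k. k"]) (auto simp: less_Suc_eq_le)
  then obtain B where B: "finite B" "B \<subseteq> V" "left_independent E B"
    and max: "\<And>C. finite C \<Longrightarrow> C \<subseteq> V \<Longrightarrow> left_independent E C \<Longrightarrow> card C \<le> card B"
    by metis
  have "\<exists>a. (\<forall>b\<in>B. a b \<in> E) \<and> x = (\<Sum>b\<in>B. a b * b)" if x: "x \<in> V" for x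
  proof (rule ccontr)
    assume "\<not> ?thesis"
    from left_independent_insert[OF E B(1,3) this]
    have "x \<notin> B" "left_independent E (insert x B)" by auto
    then show False using max[of "insert x B"] B x by auto
  qed
  then obtain a where "\<And>x. x \<in> V \<Longrightarrow> (\<forall>b\<in>B. a x b \<in> E) \<and> x = (\<Sum>b\<in>B. a x b * b)"
    by metis
  then have "left_basis E V B (\<lambda>b x. a x b)"
    unfolding left_basis_def using B by auto
  then show ?thesis by blast
qed

lemma left_basis_unique:
  assumes E: "division_subring E" and B: "left_basis E V B \<pi>"
    and a: "\<And>b. b \<in> B \<Longrightarrow> a b \<in> E" and x: "(\<Sum>b\<in>B. a b * b) \<in> V" and b: "b \<in> B"
  shows "\<pi> b (\<Sum>b\<in>B. a b * b) = a b"
proof -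
  let ?x = "\<Sum>b\<in>B. a b * b"
  have "?x = (\<Sum>b\<in>B. \<pi> b ?x * b)" using left_basisD(5)[OF B x] .
  then have "(\<Sum>b\<in>B. (\<pi> b ?x - a b) * b) = 0" by (simp add: left_diff_distrib sum_subtractf)
  moreover have "\<forall>b\<in>B. \<pi> b ?x - a b \<in> E"
    using left_basisD(4)[OF B x] a division_subringD(8)[OF E] by blast
  ultimately have "\<pi> b ?x - a b = 0"
    using left_independentD[OF left_basisD(3)[OF B], of "\<lambda>b. \<pi> b ?x - a b"] b by blast
  then show ?thesis by simp
qed

lemma left_basis_add:
  assumes E: "division_subring E" and B: "left_basis E V B \<pi>"
    and x: "x \<in> V" "y \<in> V" "x + y \<in> V" and b: "b \<in> B"
  shows "\<pi> b (x + y) = \<pi> b x + \<pi> b y"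
proof -
  have "x = (\<Sum>b\<in>B. \<pi> b x * b)" "y = (\<Sum>b\<in>B. \<pi> b y * b)"
    using left_basisD(5)[OF B] x by blast+
  then have eq: "x + y = (\<Sum>b\<in>B. (\<pi> b x + \<pi> b y) * b)"
    unfolding distrib_right sum.distrib by argo
  have "\<pi> b (\<Sum>b\<in>B. (\<pi> b x + \<pi> b y) * b) = \<pi> b x + \<pi> b y"
  proof (rule left_basis_unique[OF E B _ _ b])
    show "\<pi> b x + \<pi> b y \<in> E" if "b \<in> B" for b
      using that x left_basisD(4)[OF B] division_subringD(4)[OF E] by simp
    show "(\<Sum>b\<in>B. (\<pi> b x + \<pi> b y) * b) \<in> V" unfolding eq[symmetric] by (rule x)
  qed
  then show ?thesis unfolding eq[symmetric] .
qed

lemma left_basis_mult: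
  assumes E: "division_subring E" and B: "left_basis E V B \<pi>"
    and x: "a \<in> E" "x \<in> V" "a * x \<in> V" and b: "b \<in> B"
  shows "\<pi> b (a * x) = a * \<pi> b x"
proof -
  have "x = (\<Sum>b\<in>B. \<pi> b x * b)" using left_basisD(5)[OF B] x by blast
  then have "a * x = a * (\<Sum>b\<in>B. \<pi> b x * b)" by (rule arg_cong[of _ _ "(*) a"])
  also have "\<dots> = (\<Sum>b\<in>B. (a * \<pi> b x) * b)" by (simp add: sum_distrib_left mult.assoc)
  finally have eq: "a * x = (\<Sum>b\<in>B. (a * \<pi> b x) * b)" .
  have "\<pi> b (\<Sum>b\<in>B. (a * \<pi> b x) * b) = a * \<pi> b x"
  proof (rule left_basis_unique[OF E B _ _ b])
    show "a * \<pi> b x \<in> E" if "b \<in> B" for b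
      using that x left_basisD(4)[OF B] division_subringD(5)[OF E] by simp
    show "(\<Sum>b\<in>B. (a * \<pi> b x) * b) \<in> V" unfolding eq[symmetric] by (rule x)
  qed
  then show ?thesis unfolding eq[symmetric] .
qed

lemma left_basis_self:
  assumes E: "division_subring E" and B: "left_basis E V B \<pi>" and b: "b \<in> B" "c \<in> B"
  shows "\<pi> b c = (if b = c then 1 else 0)"
proof -
  have eq: "(\<Sum>b\<in>B. (if b = c then 1 else 0) * b) = c"
    using left_basisD(1)[OF B] b by (rule_tac sum_delta_mult)
  have "\<pi> b (\<Sum>b\<in>B. (if b = c then 1 else 0) * b) = (if b = c then 1 else 0)"
    using left_basisD(2)[OF B] b division_subringD(1,2)[OF E] unfolding eq
    by (intro left_basis_unique[OF E B, of "\<lambda>b. if b = c then 1 else 0" b, unfolded eq]) auto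
  then show ?thesis unfolding eq .
qed

text \<open>Supplies a coordinate that does not vanish at 1; dividing by its value there normalises
  functionals and projections.\<close>

lemma left_basis_one:
  assumes "left_basis E UNIV B \<pi>"
  shows "\<exists>b\<in>B. \<pi> b 1 \<noteq> 0"
proof (rule ccontr)
  assume "\<not> ?thesis"
  then have "(1::'d) = 0" using left_basisD(5)[OF assms, of 1] by simp
  then show False by simp
qed

subsection \<open>The multiplication algebra\<close>

definition center :: "'d set" where "center = {x. \<forall>y. x * y = y * x}"

lemma center_commute: "k \<in> center \<Longrightarrow> k * y = y * k"
  unfolding center_def by blast

lemma division_subring_centralizer: "division_subring {x. \<forall>y\<in>S. x * y = y * x}"
proof -
  have "inverse x * y = y * inverse x" if "x * y = y * x" for x y :: 'd
  proof (cases "x = 0")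
    case False
    then have "inverse x * y = inverse x * (y * x) * inverse x" by (simp add: mult.assoc)
    also have "\<dots> = y * inverse x" using False by (simp add: that[symmetric] mult.assoc[symmetric])
    finally show ?thesis .
  qed simp
  moreover have "x * x' * y = y * (x * x')" if "x * y = y * x" "x' * y = y * x'" for x x' y :: 'd
    using that by (metis mult.assoc)
  ultimately show ?thesis
    unfolding division_subring_def by (auto simp: scale_one_commute distrib_left distrib_right)
qed

lemma division_subring_center: "division_subring center"
  using division_subring_centralizer[of UNIV] by (simp add: center_def)

text \<open>The operators induced by the tensor product of \<open>D\<close> with its opposite ring,
  given as finite sums of two-sided multiplications.\<close>

inductive_set mult_ops :: "('d \<Rightarrow> 'd) set" where
  mult: "(\<lambda>b. y * b * z) \<in> mult_ops"
| add: "S \<in> mult_ops \<Longrightarrow> T \<in> mult_ops \<Longrightarrow> (\<lambda>b. S b + T b) \<in> mult_ops"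

lemma mult_ops_mult: "T \<in> mult_ops \<Longrightarrow> (\<lambda>b. y * T b * z) \<in> mult_ops"
proof (induction rule: mult_ops.induct)
  case (mult y' z')
  then show ?case using mult_ops.mult[of "y * y'" "z' * z"] by (simp add: mult.assoc)
next
  case (add S T)
  then show ?case using mult_ops.add[OF add.IH] by (simp add: distrib_left distrib_right)
qed

lemma mult_ops_lmult: "T \<in> mult_ops \<Longrightarrow> (\<lambda>b. y * T b) \<in> mult_ops"
  using mult_ops_mult[of T y 1] by simp

lemma mult_ops_rmult: "T \<in> mult_ops \<Longrightarrow> (\<lambda>b. T b * z) \<in> mult_ops"
  using mult_ops_mult[of T 1 z] by simp

lemma mult_ops_id: "(\<lambda>b. b) \<in> mult_ops"
  using mult_ops.mult[of 1 1] by simp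

lemma mult_ops_minus: "S \<in> mult_ops \<Longrightarrow> T \<in> mult_ops \<Longrightarrow> (\<lambda>b. S b - T b) \<in> mult_ops"
  using mult_ops.add[of S "\<lambda>b. - 1 * T b"] mult_ops_lmult[of T "-1"] by simp

lemma mult_ops_sum: "(\<And>i. i \<in> I \<Longrightarrow> T i \<in> mult_ops) \<Longrightarrow> (\<lambda>b. \<Sum>i\<in>I. T i b) \<in> mult_ops"
proof (induction I rule: infinite_finite_induct)
  case empty then show ?case using mult_ops.mult[of 0 0] by simp
next
  case (infinite I) then show ?case using mult_ops.mult[of 0 0] by simp
next
  case (insert i I)
  then have "(\<lambda>b. T i b + (\<Sum>i\<in>I. T i b)) \<in> mult_ops" by (intro mult_ops.add) auto
  then show ?case using insert by simp
qed

lemma mult_ops_additive: "T \<in> mult_ops \<Longrightarrow> T (x + y) = T x + T y"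
  by (induction rule: mult_ops.induct) (auto simp: distrib_left distrib_right)

lemma mult_ops_0: "T \<in> mult_ops \<Longrightarrow> T 0 = 0"
  by (induction rule: mult_ops.induct) auto

lemma mult_ops_sum_arg: "T \<in> mult_ops \<Longrightarrow> T (sum f I) = (\<Sum>i\<in>I. T (f i))"
  by (induction I rule: infinite_finite_induct) (auto simp: mult_ops_additive mult_ops_0)

lemma mult_ops_center: "T \<in> mult_ops \<Longrightarrow> k \<in> center \<Longrightarrow> T (k * x) = k * T x"
proof (induction rule: mult_ops.induct)
  case (mult y z)
  have "y * (k * x) * z = (y * k) * x * z" by (simp only: mult.assoc)
  also have "y * k = k * y" using center_commute[OF mult] by simp
  finally show ?case by (simp only: mult.assoc)
qed (simp add: distrib_left)

text \<open>The Jacobson density theorem for a division ring as a module over its multiplication algebra.\<close>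

lemma mult_ops_separate:
  assumes "finite S" "left_independent center S" "s \<in> S"
  shows "\<exists>T\<in>mult_ops. T s = 1 \<and> (\<forall>t\<in>S - {s}. T t = 0)"
  using assms
proof (induction S arbitrary: s rule: finite_induct)
  case empty
  then show ?case by simp
next
  case (insert s S s')
  have ind: "left_independent center S"
    unfolding left_independent_def
  proof (intro allI impI)
    fix a assume a: "\<forall>b\<in>S. a b \<in> center" "(\<Sum>b\<in>S. a b * b) = 0"
    have "(\<Sum>b\<in>S. (a(s := 0)) b * b) = (\<Sum>b\<in>S. a b * b)"
      using insert.hyps by (intro sum.cong) auto
    then have "(\<Sum>b\<in>insert s S. (a(s := 0)) b * b) = 0"
      using insert.hyps a(2) by simp
    then have "(a(s := 0)) b = 0" if "b \<in> insert s S" for b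
      using a(1) division_subringD(1)[OF division_subring_center] that
      by (intro left_independentD[OF insert.prems(1), of "a(s := 0)" b]) auto
    then show "\<forall>b\<in>S. a b = 0" using insert.hyps by (metis fun_upd_other insertCI)
  qed
  have "\<forall>t\<in>S. \<exists>T. T \<in> mult_ops \<and> T t = 1 \<and> (\<forall>t'\<in>S - {t}. T t' = 0)"
    using insert.IH[OF ind] by blast
  from bchoice[OF this] obtain U where U: "\<And>t. t \<in> S \<Longrightarrow> U t \<in> mult_ops"
    "\<And>t. t \<in> S \<Longrightarrow> U t t = 1" "\<And>t t'. t \<in> S \<Longrightarrow> t' \<in> S \<Longrightarrow> t' \<noteq> t \<Longrightarrow> U t t' = 0"
    by blast
  \<comment> \<open>If every operator vanishing on \<open>S\<close> vanished at \<open>s\<close>,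
    the value at \<open>s\<close> would be a combination of the values on \<open>S\<close> with
    coefficients \<open>U t s\<close>. These are central, and the identity operator then exhibits
    \<open>s\<close> as a central combination of \<open>S\<close>, against independence.\<close>
  have "\<exists>T\<in>mult_ops. T s \<noteq> 0 \<and> (\<forall>t\<in>S. T t = 0)"
  proof (rule ccontr)
    assume "\<not> ?thesis"
    then have neg: "T s = 0" if "T \<in> mult_ops" "\<And>t. t \<in> S \<Longrightarrow> T t = 0" for T using that by blast
    have key: "T s = (\<Sum>t\<in>S. T t * U t s)" if T: "T \<in> mult_ops" for T
    proof -
      let ?T = "\<lambda>b. T b - (\<Sum>t\<in>S. T t * U t b)"
      have "?T \<in> mult_ops" using T U by (intro mult_ops_minus mult_ops_sum mult_ops_lmult) auto
      moreover have "?T t' = 0" if t': "t' \<in> S" for t'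
      proof -
        have "(\<Sum>t\<in>S. T t * U t t') = (\<Sum>t\<in>S. if t = t' then T t else 0)"
          using U t' by (intro sum.cong) auto
        then show ?thesis using t' insert.hyps by simp
      qed
      ultimately have "?T s = 0" by (rule neg)
      then show ?thesis by simp
    qed
    have "U t s \<in> center" if t: "t \<in> S" for t
    proof -
      have "U t s * y = y * U t s" for y
      proof -
        \<comment> \<open>\<open>key\<close> is applied to \<open>U t\<close> followed by right
          multiplication by \<open>y\<close>; duality leaves only the term of
          \<open>t\<close>.\<close>
        have "U t s * y = (\<Sum>t'\<in>S. U t t' * y * U t' s)"
          using key[OF mult_ops_rmult[OF U(1)[OF t], of y]] .
        also have "\<dots> = (\<Sum>t'\<in>S. if t' = t then y * U t' s else 0)"
          using U t by (intro sum.cong) auto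
        finally show ?thesis using t insert.hyps by simp
      qed
      then show ?thesis unfolding center_def by blast
    qed
    note Uc = this
    have s_eq: "s = (\<Sum>t\<in>S. U t s * t)"
    proof -
      have "s = (\<Sum>t\<in>S. t * U t s)" using key[OF mult_ops_id] .
      also have "\<dots> = (\<Sum>t\<in>S. U t s * t)" using center_commute[OF Uc] by (intro sum.cong) auto
      finally show ?thesis .
    qed
    let ?a = "\<lambda>b. if b = s then - 1 else U b s"
    have "(\<Sum>b\<in>S. ?a b * b) = (\<Sum>t\<in>S. U t s * t)"
      using insert.hyps by (intro sum.cong) auto
    then have "(\<Sum>b\<in>insert s S. ?a b * b) = - s + s"
      using insert.hyps by (simp flip: s_eq)
    then have "(\<Sum>b\<in>insert s S. ?a b * b) = 0" by simp
    moreover have "- 1 \<in> center"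
      using division_subringD(2,7)[OF division_subring_center] by blast
    ultimately have "?a s = 0"
      using Uc by (intro left_independentD[OF insert.prems(1), of ?a s]) auto
    then show False by simp
  qed
  then obtain T0 where T0: "T0 \<in> mult_ops" "T0 s \<noteq> 0" "\<forall>t\<in>S. T0 t = 0" by blast
  define T where "T = (\<lambda>b. inverse (T0 s) * T0 b)"
  have T: "T \<in> mult_ops" "T s = 1" "\<forall>t\<in>S. T t = 0"
    using T0 by (auto simp: T_def mult_ops_lmult)
  show ?case
  proof (cases "s' = s")
    case True
    then show ?thesis using T insert.hyps by auto
  next
    case False
    then have s': "s' \<in> S" using insert.prems by auto
    let ?T = "\<lambda>b. U s' b - U s' s * T b"
    have "?T \<in> mult_ops" using U s' T by (intro mult_ops_minus mult_ops_lmult) auto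
    moreover have "?T s' = 1" using U(2)[OF s'] T(3) s' by simp
    moreover have "?T t = 0" if "t \<in> insert s S - {s'}" for t
      using that U(3)[OF s', of t] T(2,3) by auto
    ultimately show ?thesis by (intro bexI[of _ ?T] conjI ballI)
  qed
qed

text \<open>When \<open>y\<close> is expanded in the basis, the operator that separates
  \<open>u\<close> from the other basis vectors keeps only the term of \<open>u\<close>, because
  operators commute with central factors.\<close>

lemma mult_ops_coordinate:
  assumes U: "left_basis center V U \<pi>" and u: "u \<in> U"
  shows "\<exists>T\<in>mult_ops. \<forall>y\<in>V. T y = \<pi> u y"
proof -
  obtain T where T: "T \<in> mult_ops" "T u = 1" "\<forall>t\<in>U - {u}. T t = 0"
    using mult_ops_separate[OF left_basisD(1)[OF U] left_basisD(3)[OF U] u] by blast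
  have "T y = \<pi> u y" if y: "y \<in> V" for y
  proof -
    have "T y = (\<Sum>t\<in>U. T (\<pi> t y * t))"
      by (subst left_basisD(5)[OF U y]) (rule mult_ops_sum_arg[OF T(1)])
    also have "\<dots> = (\<Sum>t\<in>U. if t = u then \<pi> u y else 0)"
      using T(2,3) by (intro sum.cong) (auto simp: mult_ops_center[OF T(1) left_basisD(4)[OF U y]])
    finally show ?thesis using u left_basisD(1)[OF U] by simp
  qed
  then show ?thesis using T(1) by blast
qed

end

section \<open>Polynomials over the base field: annihilators and separability\<close>

lemma map_poly_to_ac_mult: "map_poly to_ac (p * q) = map_poly to_ac p * map_poly to_ac q"
proof -
  interpret map_poly_comm_ring_hom "to_ac :: 'a \<Rightarrow> _" by unfold_locales auto
  show ?thesis by (rule hom_mult)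
qed

lemma map_poly_to_ac_pderiv:
  "map_poly to_ac (pderiv p) = pderiv (map_poly to_ac (p :: 'a::field_char_0 poly))"
  by (rule poly_eqI) (simp add: coeff_map_poly coeff_pderiv)

lemma map_poly_to_ac_eq_0_iff: "map_poly to_ac p = 0 \<longleftrightarrow> p = 0"
  by (intro map_poly_eq_0_iff) auto

lemma rsquarefree_imp_distinct_roots:
  fixes q :: "'a::{alg_closed_field, field_char_0} poly"
  assumes "rsquarefree q"
  obtains c rs where "distinct rs" "q = smult c (\<Prod>r\<leftarrow>rs. [:- r, 1:])"
proof -
  have "q \<noteq> 0" using assms by (simp add: rsquarefree_def)
  from alg_closed_imp_factorization[OF this] obtain A
    where A: "q = smult (lead_coeff q) (\<Prod>x\<in>#A. [:- x, 1:])" by auto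
  obtain rs where rs: "mset rs = A" using ex_mset by blast
  have q: "q = smult (lead_coeff q) (\<Prod>r\<leftarrow>rs. [:- r, 1:])"
    using A by (simp add: rs[symmetric] prod_mset_prod_list[symmetric] flip: mset_map)
  moreover have "distinct rs"
  proof (rule ccontr)
    assume "\<not> distinct rs"
    then obtain xs ys zs y where "rs = xs @ [y] @ ys @ [y] @ zs" using not_distinct_decomp by blast
    then have "(\<Prod>r\<leftarrow>rs. [:- r, 1:]) = [:- y, 1:] * ([:- y, 1:] * (\<Prod>r\<leftarrow>xs @ ys @ zs. [:- r, 1:]))"
      by (simp del: mult_pCons_left mult_pCons_right add: algebra_simps)
    then have "q = [:- y, 1:] * ([:- y, 1:] * smult (lead_coeff q) (\<Prod>r\<leftarrow>xs @ ys @ zs. [:- r, 1:]))"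
      by (subst q) (simp only: mult_smult_right)
    then obtain w where "q = [:- y, 1:] * ([:- y, 1:] * w)" by blast
    then have "poly q y = 0" "poly (pderiv q) y = 0"
      by (simp_all del: mult_pCons_left mult_pCons_right add: pderiv_mult)
    then show False using assms unfolding rsquarefree_roots by blast
  qed
  ultimately show ?thesis by (rule that[rotated])
qed

locale fd_division_algebra_0 = fd_division_algebra scale
  for scale :: "'f::field_char_0 \<Rightarrow> 'd::division_ring \<Rightarrow> 'd"
begin

text \<open>Horner's scheme rather than \<open>poly\<close>, since \<open>D\<close> is not
  commutative. Scalars and powers of a single element commute, which makes \<open>peval_mult\<close>
  hold.\<close>

definition peval :: "'f poly \<Rightarrow> 'd \<Rightarrow> 'd" where
  "peval q a = fold_coeffs (\<lambda>c x. scale c 1 + a * x) q 0"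

lemma peval_0 [simp]: "peval 0 a = 0"
  by (simp add: peval_def)

lemma peval_pCons [simp]: "peval (pCons c q) a = scale c 1 + a * peval q a"
  by (cases "pCons c q = 0") (auto simp: peval_def)

lemma peval_commute: "b * a = a * b \<Longrightarrow> peval q a * b = b * peval q a"
proof (induction q)
  case (pCons c q)
  have "a * (peval q a * b) = b * (a * peval q a)"
    using pCons by (metis mult.assoc)
  then show ?case by (simp add: distrib_left distrib_right scale_one_commute mult.assoc)
qed simp

lemma peval_add: "peval (p + q) a = peval p a + peval q a"
proof (induction p q rule: poly_induct2)
  case (pCons c p d q)
  then show ?case by (simp add: scale_left_distrib distrib_left algebra_simps)
qed simp

lemma peval_smult: "peval (smult c q) a = scale c (peval q a)"
  by (induction q) (auto simp: scale_right_distrib mult_scale_right)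

lemma peval_mult: "peval (p * q) a = peval p a * peval q a"
proof (induction p)
  case (pCons c p)
  have "peval (pCons 0 (p * q)) a = a * peval p a * peval q a"
    by (simp add: pCons.IH mult.assoc)
  then show ?case
    by (simp add: peval_add peval_smult distrib_right scale_eq_mult[symmetric])
qed simp

lemma peval_monom: "peval (monom c n) a = scale c (a ^ n)"
  by (induction n) (auto simp: monom_0 monom_Suc mult_scale_right)

lemma peval_sum: "peval (sum f I) a = (\<Sum>i\<in>I. peval (f i) a)"
  by (induction I rule: infinite_finite_induct) (auto simp: peval_add)

lemma algebraic: "\<exists>q. q \<noteq> 0 \<and> peval q a = 0"
proof -
  obtain S where S: "finite S" "span S = UNIV" by (rule obtain_spanning)
  define N where "N = card S"
  show ?thesis
  \<comment> \<open>Independence is a property of sets, so coinciding powers are treated separately;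
    they give the annihilator X^i - X^j directly.\<close>
  proof (cases "inj_on (\<lambda>i. a ^ i) {..N}")
    case False
    then obtain i j where ij: "i \<noteq> j" "a ^ i = a ^ j" unfolding inj_on_def by blast
    let ?q = "monom 1 i + monom (- 1) j :: 'f poly"
    have "coeff ?q i = 1" using ij(1) by simp
    then have "?q \<noteq> 0" by force
    moreover have "peval ?q a = 0" using ij(2) by (simp add: peval_add peval_monom)
    ultimately show ?thesis by blast
  next
    case True
    let ?B = "(\<lambda>i. a ^ i) ` {..N}"
    have "card ?B = Suc N" using card_image[OF True] by simp
    then have "dependent ?B"
      using independent_span_bound[OF S(1), of ?B] S(2) by (auto simp: N_def)
    then obtain u v where u: "(\<Sum>v\<in>?B. scale (u v) v) = 0" "v \<in> ?B" "u v \<noteq> 0"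
      using dependent_finite[of ?B] by auto
    let ?q = "\<Sum>i\<le>N. monom (u (a ^ i)) i"
    have "peval ?q a = (\<Sum>i\<le>N. scale (u (a ^ i)) (a ^ i))"
      by (simp add: peval_sum peval_monom)
    also have "\<dots> = 0" using u(1) by (simp add: sum.reindex[OF True])
    finally have "peval ?q a = 0" .
    moreover from u(2) obtain i where i: "i \<le> N" "v = a ^ i" by auto
    have "coeff ?q i = u v"
      using i by (simp add: coeff_sum)
    then have "?q \<noteq> 0" using u(3) by force
    ultimately show ?thesis by blast
  qed
qed

lemma minimal_annihilator:
  obtains q where "q \<noteq> 0" "peval q a = 0" "\<And>s. s \<noteq> 0 \<Longrightarrow> peval s a = 0 \<Longrightarrow> degree q \<le> degree s"
proof -
  obtain q0 where "q0 \<noteq> 0 \<and> peval q0 a = 0" using algebraic by blast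
  from arg_min_nat_lemma[of "\<lambda>q. q \<noteq> 0 \<and> peval q a = 0", OF this, of degree] show ?thesis
    using that[of "ARG_MIN degree q. q \<noteq> 0 \<and> peval q a = 0"] by blast
qed

text \<open>Let \<open>q\<close> have least degree and suppose \<open>r\<close> is a multiple root.
  The minimal polynomial \<open>d\<close> of \<open>r\<close> divides both \<open>q\<close> and its
  derivative. \<open>D\<close> has no zero divisors, so one factor of \<open>q = d * w\<close> kills
  \<open>a\<close>, and minimality makes this \<open>d\<close>, of the same degree as
  \<open>q\<close>. Then \<open>d\<close> cannot divide \<open>pderiv q\<close>, which has smaller
  degree and is nonzero in characteristic 0.\<close>

lemma separable_annihilator: "\<exists>q. rsquarefree (map_poly to_ac q) \<and> peval q a = 0"
proof -
  obtain q where q: "q \<noteq> 0" "peval q a = 0"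
    and min: "\<And>s. s \<noteq> 0 \<Longrightarrow> peval s a = 0 \<Longrightarrow> degree q \<le> degree s"
    using minimal_annihilator by blast
  have "rsquarefree (map_poly to_ac q)"
    unfolding rsquarefree_roots
  proof (intro allI notI)
    fix r assume r: "poly (map_poly to_ac q) r = 0 \<and> poly (pderiv (map_poly to_ac q)) r = 0"
    define P where "P = (\<lambda>s. s \<noteq> 0 \<and> poly (map_poly to_ac s) r = 0)"
    define d where "d = (ARG_MIN degree s. P s)"
    have "P q" using q r by (simp add: P_def)
    then have d: "P d" and dmin: "\<And>s. P s \<Longrightarrow> degree d \<le> degree s"
      using arg_min_nat_lemma[of P q degree] unfolding d_def[symmetric] by auto
    have dvd: "d dvd s" if "poly (map_poly to_ac s) r = 0" for s
    proof -
      have s: "s = s div d * d + s mod d" by simp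
      have "poly (map_poly to_ac s) r = poly (map_poly to_ac (s div d * d)) r + poly (map_poly to_ac (s mod d)) r"
      proof -
        interpret map_poly_comm_ring_hom "to_ac :: 'f \<Rightarrow> _" by unfold_locales auto
        show ?thesis by (subst s) (simp only: hom_add poly_add)
      qed
      then have "poly (map_poly to_ac (s mod d)) r = 0"
        using that d by (simp add: map_poly_to_ac_mult P_def)
      then have "s mod d = 0"
        using dmin[of "s mod d"] degree_mod_less[of d s] d unfolding P_def by force
      then show ?thesis by auto
    qed
    obtain w where w: "q = d * w" using dvd r by blast
    have nz: "d \<noteq> 0" "w \<noteq> 0" using w q by auto
    have deg: "degree q = degree d + degree w" using w nz by (simp add: degree_mult_eq)
    have "degree d \<noteq> 0"
    proof
      assume "degree d = 0"
      then obtain c where c: "d = [:c:]" by (rule degree_eq_zeroE)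
      then show False using d by (auto simp: P_def map_poly_pCons)
    qed
    have "peval d a = 0"
    proof (rule ccontr)
      assume "peval d a \<noteq> 0"
      then have "peval w a = 0" using q(2) w by (simp add: peval_mult)
      then show False using min[OF nz(2)] deg \<open>degree d \<noteq> 0\<close> by simp
    qed
    then have le: "degree q \<le> degree d" using min nz by blast
    have "poly (map_poly to_ac (pderiv q)) r = 0" using r by (simp add: map_poly_to_ac_pderiv)
    then have "d dvd pderiv q" by (rule dvd)
    moreover have "degree q \<noteq> 0" using deg \<open>degree d \<noteq> 0\<close> by simp
    then have "pderiv q \<noteq> 0" by (simp add: pderiv_eq_0_iff)
    ultimately have "degree d \<le> degree (pderiv q)" by (rule dvd_imp_degree_le)
    then show False using le \<open>degree q \<noteq> 0\<close> by (simp add: degree_pderiv)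
  qed
  then show ?thesis using q by blast
qed

subsection \<open>Linear functionals with values in the algebraic closure\<close>

definition linear_functional :: "('d \<Rightarrow> 'f alg_closure) \<Rightarrow> bool" where
  "linear_functional f \<longleftrightarrow>
     (\<forall>x y. f (x + y) = f x + f y) \<and> (\<forall>a x. f (scale a x) = to_ac a * f x)"

lemma linear_functionalD:
  assumes "linear_functional f"
  shows "f (x + y) = f x + f y" "f (scale a x) = to_ac a * f x" "f 0 = 0" "f (- x) = - f x"
    "f (x - y) = f x - f y" "f (sum g I) = (\<Sum>i\<in>I. f (g i))"
proof -
  show add: "f (x + y) = f x + f y" for x y using assms by (simp add: linear_functional_def)
  show sc: "f (scale a x) = to_ac a * f x" for a x using assms by (simp add: linear_functional_def)
  show z: "f 0 = 0" using sc[of 0 0] by simp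
  show neg: "f (- x) = - f x" for x using sc[of "-1" x] by simp
  show "f (x - y) = f x - f y" using add[of x "-y"] neg[of y] by simp
  show "f (sum g I) = (\<Sum>i\<in>I. f (g i))"
    by (induction I rule: infinite_finite_induct) (auto simp: z add)
qed

definition function_space :: "('d \<Rightarrow> 'f alg_closure) set \<Rightarrow> bool" where
  "function_space V \<longleftrightarrow> (\<lambda>_. 0) \<in> V \<and> (\<forall>f\<in>V. \<forall>g\<in>V. \<forall>c. (\<lambda>y. f y + c * g y) \<in> V)"

lemma function_spaceD:
  assumes "function_space V"
  shows "(\<lambda>_. 0) \<in> V" "f \<in> V \<Longrightarrow> g \<in> V \<Longrightarrow> (\<lambda>y. f y + c * g y) \<in> V"
    "g \<in> V \<Longrightarrow> (\<lambda>y. c * g y) \<in> V" "f \<in> V \<Longrightarrow> g \<in> V \<Longrightarrow> (\<lambda>y. f y - c * g y) \<in> V"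
    "(\<And>i. i \<in> I \<Longrightarrow> G i \<in> V) \<Longrightarrow> (\<lambda>y. \<Sum>i\<in>I. G i y) \<in> V"
proof -
  show z: "(\<lambda>_. 0) \<in> V" using assms by (simp add: function_space_def)
  show add: "f \<in> V \<Longrightarrow> g \<in> V \<Longrightarrow> (\<lambda>y. f y + c * g y) \<in> V" for f g c
    using assms by (simp add: function_space_def)
  show "g \<in> V \<Longrightarrow> (\<lambda>y. c * g y) \<in> V" using add[OF z, of g c] by simp
  show "f \<in> V \<Longrightarrow> g \<in> V \<Longrightarrow> (\<lambda>y. f y - c * g y) \<in> V" using add[of f g "-c"] by simp
  show "(\<And>i. i \<in> I \<Longrightarrow> G i \<in> V) \<Longrightarrow> (\<lambda>y. \<Sum>i\<in>I. G i y) \<in> V"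
  proof (induction I rule: infinite_finite_induct)
    case (insert i I)
    then show ?case using add[of "G i" "\<lambda>y. \<Sum>i\<in>I. G i y" 1] by simp
  qed (auto simp: z)
qed

text \<open>The polynomial with roots \<open>rs\<close> applied to the operator
  \<open>f \<mapsto> f \<circ> \<tau>\<close>, kept in factored form so that eigenfunctions can be
  split off one root at a time.\<close>

primrec root_op ::
  "('d \<Rightarrow> 'd) \<Rightarrow> 'f alg_closure list \<Rightarrow> ('d \<Rightarrow> 'f alg_closure) \<Rightarrow> 'd \<Rightarrow> 'f alg_closure" where
  "root_op \<tau> [] f = f"
| "root_op \<tau> (r # rs) f = root_op \<tau> rs (\<lambda>y. f (\<tau> y) - r * f y)"

text \<open>The first factor turns \<open>f\<close> into \<open>?g\<close>, by induction a sum of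
  eigenfunctions \<open>G s\<close> with s \<noteq> r. Dividing these by \<open>s - r\<close> gives
  a preimage of \<open>?g\<close> under the same factor, and subtracting it from \<open>f\<close>
  leaves an eigenfunction for \<open>r\<close>. Everything stays inside \<open>V\<close>, so the
  lemma can be iterated within eigenspaces.\<close>

lemma eigen_decomposition:
  assumes "distinct rs" "function_space V" "\<And>f. f \<in> V \<Longrightarrow> (\<lambda>y. f (\<tau> y)) \<in> V"
    and "f \<in> V" "root_op \<tau> rs f = (\<lambda>_. 0)"
  shows "\<exists>G. (\<forall>r\<in>set rs. G r \<in> V \<and> (\<forall>y. G r (\<tau> y) = r * G r y)) \<and>
             (\<forall>y. f y = (\<Sum>r\<in>set rs. G r y))"
  using assms(1,4,5)
proof (induction rs arbitrary: f)
  case Nil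
  then show ?case by auto
next
  case (Cons r rs)
  note V = function_spaceD[OF assms(2)]
  let ?g = "\<lambda>y. f (\<tau> y) - r * f y"
  have g: "?g \<in> V" using V(4)[OF assms(3) ] Cons.prems by blast
  from Cons.IH[OF _ g] Cons.prems obtain G
    where G: "\<And>s. s \<in> set rs \<Longrightarrow> G s \<in> V" "\<And>s y. s \<in> set rs \<Longrightarrow> G s (\<tau> y) = s * G s y"
      and gs: "\<And>y. ?g y = (\<Sum>s\<in>set rs. G s y)" by auto
  have r: "s - r \<noteq> 0" if "s \<in> set rs" for s using that Cons.prems by auto
  define H where "H = (\<lambda>s y. inverse (s - r) * G s y)"
  define f' where "f' = (\<lambda>y. f y - 1 * (\<Sum>s\<in>set rs. H s y))"
  have H: "H s \<in> V" "H s (\<tau> y) = s * H s y" if "s \<in> set rs" for s y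
    using V(3)[OF G(1)[OF that]] G(2)[OF that] by (auto simp: H_def)
  have f': "f' \<in> V" unfolding f'_def using H(1) Cons.prems by (intro V(4) V(5)) auto
  have "f' (\<tau> y) = r * f' y" for y
  proof -
    have "f' (\<tau> y) - r * f' y = ?g y - (\<Sum>s\<in>set rs. H s (\<tau> y) - r * H s y)"
      by (simp add: f'_def sum_subtractf sum_distrib_left algebra_simps)
    also have "(\<Sum>s\<in>set rs. H s (\<tau> y) - r * H s y) = (\<Sum>s\<in>set rs. G s y)"
    proof (rule sum.cong)
      fix s assume s: "s \<in> set rs"
      have "H s (\<tau> y) - r * H s y = (s - r) * H s y" using H(2)[OF s] by (simp add: algebra_simps)
      then show "H s (\<tau> y) - r * H s y = G s y" using r[OF s] by (simp add: H_def)
    qed simp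
    finally show ?thesis using gs by simp
  qed
  moreover have "f y = (\<Sum>s\<in>set (r # rs). (H(r := f')) s y)" for y
  proof -
    have "(\<Sum>s\<in>set rs. (H(r := f')) s y) = (\<Sum>s\<in>set rs. H s y)"
      using r by (intro sum.cong) auto
    then show ?thesis using Cons.prems(1) by (simp add: f'_def)
  qed
  ultimately show ?case
    using H f' by (intro exI[of _ "H(r := f')"]) auto
qed

text \<open>Expanded counterpart of \<open>root_op\<close> that follows the recursion of
  \<open>peval\<close>. Comparing the two carries an annihilating polynomial of an element of
  \<open>D\<close> over to functionals.\<close>

definition poly_op ::
  "('d \<Rightarrow> 'd) \<Rightarrow> 'f alg_closure poly \<Rightarrow> ('d \<Rightarrow> 'f alg_closure) \<Rightarrow> 'd \<Rightarrow> 'f alg_closure" where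
  "poly_op \<tau> Q = fold_coeffs (\<lambda>c F f y. c * f y + F (\<lambda>z. f (\<tau> z)) y) Q (\<lambda>f y. 0)"

lemma poly_op_0 [simp]: "poly_op \<tau> 0 f y = 0"
  by (simp add: poly_op_def)

lemma poly_op_pCons [simp]: "poly_op \<tau> (pCons c Q) f y = c * f y + poly_op \<tau> Q (\<lambda>z. f (\<tau> z)) y"
  by (cases "pCons c Q = 0") (auto simp: poly_op_def)

lemma poly_op_add: "poly_op \<tau> (P + Q) f y = poly_op \<tau> P f y + poly_op \<tau> Q f y"
proof (induction P Q arbitrary: f rule: poly_induct2)
  case (pCons c p d q)
  show ?case by (simp add: pCons.IH algebra_simps)
qed simp

lemma poly_op_smult: "poly_op \<tau> (smult c Q) f y = c * poly_op \<tau> Q f y"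
  by (induction Q arbitrary: f) (auto simp: algebra_simps)

lemma poly_op_diff: "poly_op \<tau> Q (\<lambda>y. f y - c * g y) y = poly_op \<tau> Q f y - c * poly_op \<tau> Q g y"
proof (induction Q arbitrary: f g)
  case (pCons d Q)
  show ?case by (simp add: pCons.IH algebra_simps)
qed simp

lemma root_op_eq_poly_op: "root_op \<tau> rs f y = poly_op \<tau> (\<Prod>r\<leftarrow>rs. [:- r, 1:]) f y"
proof (induction rs arbitrary: f)
  case Nil
  show ?case by (simp add: one_pCons)
next
  case (Cons r rs)
  let ?Q = "\<Prod>r\<leftarrow>rs. [:- r, 1:]"
  have "poly_op \<tau> ([:- r, 1:] * ?Q) f y = poly_op \<tau> (pCons 0 ?Q + smult (- r) ?Q) f y"
    by (simp add: algebra_simps)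
  also have "\<dots> = poly_op \<tau> ?Q (\<lambda>y. f (\<tau> y) - r * f y) y"
    by (simp only: poly_op_add poly_op_smult poly_op_diff poly_op_pCons) simp
  finally show ?case by (simp add: Cons.IH)
qed

lemma linear_functional_mult:
  assumes "linear_functional f"
  shows "linear_functional (\<lambda>y. f (a * y))" "linear_functional (\<lambda>y. f (y * a))"
  using assms by (auto simp: linear_functional_def distrib_left distrib_right
      scale_mult_left mult_scale_right)

lemma poly_op_peval:
  assumes "linear_functional f"
  shows "poly_op (\<lambda>y. a * y) (map_poly to_ac q) f y = f (peval q a * y)"
    and "poly_op (\<lambda>y. y * a) (map_poly to_ac q) f y = f (y * peval q a)"
proof -
  show "poly_op (\<lambda>y. a * y) (map_poly to_ac q) f y = f (peval q a * y)"
    using assms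
  proof (induction q arbitrary: f)
    case (pCons c q)
    show ?case
      using pCons.hyps pCons.IH[OF linear_functional_mult(1)[OF pCons.prems]] linear_functionalD[OF pCons.prems]
      by (simp add: map_poly_pCons distrib_right mult.assoc scale_eq_mult[symmetric])
  qed (simp add: linear_functionalD)
  show "poly_op (\<lambda>y. y * a) (map_poly to_ac q) f y = f (y * peval q a)"
    using assms
  proof (induction q arbitrary: f)
    case (pCons c q)
    \<comment> \<open>Right multiplication reverses the order of the factors, harmlessly, because
      \<open>peval q a\<close> commutes with \<open>a\<close>.\<close>
    have "y * (a * peval q a) = y * peval q a * a"
      using peval_commute[of a a q] by (simp add: mult.assoc)
    then show ?case
      using pCons.hyps pCons.IH[OF linear_functional_mult(2)[OF pCons.prems]] linear_functionalD[OF pCons.prems]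
      by (simp add: map_poly_pCons distrib_left mult_scale_right)
  qed (simp add: linear_functionalD)
qed

lemma annihilating_roots:
  "\<exists>rs. distinct rs \<and> (\<forall>f. linear_functional f \<longrightarrow>
     root_op (\<lambda>y. a * y) rs f = (\<lambda>_. 0) \<and> root_op (\<lambda>y. y * a) rs f = (\<lambda>_. 0))"
proof -
  obtain q where q: "rsquarefree (map_poly to_ac q)" "peval q a = 0"
    using separable_annihilator by blast
  from rsquarefree_imp_distinct_roots[OF q(1)] obtain c rs where
    rs: "distinct rs" "map_poly to_ac q = smult c (\<Prod>r\<leftarrow>rs. [:- r, 1:])" by blast
  have c: "c \<noteq> 0" using q(1) rs(2) by (auto simp: rsquarefree_def)
  have "root_op (\<lambda>y. a * y) rs f y = 0 \<and> root_op (\<lambda>y. y * a) rs f y = 0" if f: "linear_functional f" for f y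
  proof -
    have "c * root_op (\<lambda>y. a * y) rs f y = f (peval q a * y)"
      "c * root_op (\<lambda>y. y * a) rs f y = f (y * peval q a)"
      unfolding poly_op_peval[OF f, symmetric] root_op_eq_poly_op rs(2) poly_op_smult by simp_all
    then show ?thesis using c q(2) linear_functionalD(3)[OF f] by simp
  qed
  then show ?thesis using rs(1) by blast
qed

text \<open>No coefficients occur: sets of eigenfunctions are only used to extract one summand or to
  add up expansions of the summands.\<close>

inductive_set sums_of :: "('d \<Rightarrow> 'f alg_closure) set \<Rightarrow> ('d \<Rightarrow> 'f alg_closure) set" for B where
  zero: "(\<lambda>_. 0) \<in> sums_of B"
| add: "g \<in> B \<Longrightarrow> f \<in> sums_of B \<Longrightarrow> (\<lambda>y. g y + f y) \<in> sums_of B"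

lemma sums_of_add: "f \<in> sums_of B \<Longrightarrow> g \<in> sums_of B \<Longrightarrow> (\<lambda>y. f y + g y) \<in> sums_of B"
proof (induction rule: sums_of.induct)
  case (add h f)
  then show ?case using sums_of.add[of h B "\<lambda>y. f y + g y"] by (simp add: add.assoc)
qed simp

lemma sums_of_base: "g \<in> B \<Longrightarrow> g \<in> sums_of B"
  using sums_of.add[OF _ sums_of.zero] by simp

lemma sums_of_sum:
  "(\<And>i. i \<in> I \<Longrightarrow> F i \<in> sums_of B) \<Longrightarrow> (\<lambda>y. \<Sum>i\<in>I. F i y) \<in> sums_of B"
proof (induction I rule: infinite_finite_induct)
  case (insert i I)
  then show ?case using sums_of_add[of "F i" B "\<lambda>y. \<Sum>i\<in>I. F i y"] by simp
qed (simp_all add: sums_of.zero)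

lemma sums_of_mono: "f \<in> sums_of B \<Longrightarrow> B \<subseteq> C \<Longrightarrow> f \<in> sums_of C"
  by (induction rule: sums_of.induct) (auto intro: sums_of.intros)

lemma sums_of_nonzero: "f \<in> sums_of B \<Longrightarrow> f \<in> sums_of (B - {\<lambda>_. 0})"
proof (induction rule: sums_of.induct)
  case (add g f)
  then show ?case by (cases "g = (\<lambda>_. 0)") (auto intro: sums_of.intros)
qed (rule sums_of.zero)

definition commutative_subfield :: "'d set \<Rightarrow> bool" where
  "commutative_subfield E \<longleftrightarrow> division_subring E \<and> (\<forall>x\<in>E. \<forall>y\<in>E. x * y = y * x)"

lemma commutative_subfieldD:
  assumes "commutative_subfield E"
  shows "division_subring E" "x \<in> E \<Longrightarrow> y \<in> E \<Longrightarrow> x * y = y * x"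
  using assms by (auto simp: commutative_subfield_def)

text \<open>Left and right multiplication by a commutative subfield are both actions, so the
  eigenfunction lemmas are proved once for either side.\<close>

definition one_sided_mult :: "('d \<Rightarrow> 'd \<Rightarrow> 'd) \<Rightarrow> bool" where
  "one_sided_mult \<tau> \<longleftrightarrow> \<tau> = (\<lambda>a y. a * y) \<or> \<tau> = (\<lambda>a y. y * a)"

lemma one_sided_multD:
  assumes "one_sided_mult \<tau>"
  shows "a * b = b * a \<Longrightarrow> \<tau> a (\<tau> b y) = \<tau> (a * b) y" "\<tau> (a + b) y = \<tau> a y + \<tau> b y"
    "\<tau> (scale c 1) y = scale c y" "\<tau> (sum g I) y = (\<Sum>i\<in>I. \<tau> (g i) y)"
    "\<tau> (scale c 1 * a) y = scale c (\<tau> a y)" "\<tau> a 1 = a"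
proof -
  show "\<tau> a (\<tau> b y) = \<tau> (a * b) y" if "a * b = b * a"
    using assms that unfolding one_sided_mult_def by (metis mult.assoc)
qed (use assms in \<open>auto simp: one_sided_mult_def distrib_left distrib_right sum_distrib_left
    sum_distrib_right scale_mult_left mult_scale_right\<close>)

text \<open>Simultaneous diagonalisation: each \<open>a\<close> acts with distinct annihilating
  roots, and its eigenspace \<open>?W\<close> is stable under the other operators because
  \<open>E\<close> is commutative, so the induction continues inside \<open>?W\<close>.\<close>

lemma joint_eigenfunctions:
  assumes \<tau>: "one_sided_mult \<tau>" and E: "commutative_subfield E"
    and V: "function_space V" "\<And>f. f \<in> V \<Longrightarrow> linear_functional f"
      "\<And>a f. a \<in> E \<Longrightarrow> f \<in> V \<Longrightarrow> (\<lambda>y. f (\<tau> a y)) \<in> V"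
    and as: "set as \<subseteq> E" and f: "f \<in> V"
  shows "f \<in> sums_of {g \<in> V. \<forall>a\<in>set as. \<exists>r. \<forall>y. g (\<tau> a y) = r * g y}"
  using V as f
proof (induction as arbitrary: V f)
  case Nil
  then show ?case using sums_of_base by simp
next
  case (Cons a as)
  have aE: "a \<in> E" using Cons.prems by simp
  obtain rs where "distinct rs" "root_op (\<tau> a) rs f = (\<lambda>_. 0)"
    using annihilating_roots[of a] \<tau> Cons.prems(2)[OF Cons.prems(5)] unfolding one_sided_mult_def by auto
  from eigen_decomposition[OF this(1) Cons.prems(1) _ Cons.prems(5) this(2)] Cons.prems(3)[OF aE]
  obtain G where G: "\<And>r. r \<in> set rs \<Longrightarrow> G r \<in> V" "\<And>r y. r \<in> set rs \<Longrightarrow> G r (\<tau> a y) = r * G r y"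
    and f: "f = (\<lambda>y. \<Sum>r\<in>set rs. G r y)" by blast
  have "G r \<in> sums_of {g \<in> V. \<forall>a\<in>set (a # as). \<exists>r. \<forall>y. g (\<tau> a y) = r * g y}" if r: "r \<in> set rs" for r
  proof -
    let ?W = "{g \<in> V. \<forall>y. g (\<tau> a y) = r * g y}"
    have "G r \<in> sums_of {g \<in> ?W. \<forall>a\<in>set as. \<exists>r. \<forall>y. g (\<tau> a y) = r * g y}"
    proof (rule Cons.IH)
      show "function_space ?W"
        using function_spaceD(1,2)[OF Cons.prems(1)] unfolding function_space_def
        by (auto simp: algebra_simps)
      show "(\<lambda>y. f (\<tau> b y)) \<in> ?W" if "b \<in> E" "f \<in> ?W" for b f
      proof -
        have "\<tau> b (\<tau> a y) = \<tau> a (\<tau> b y)" for y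
          using one_sided_multD(1)[OF \<tau>] commutative_subfieldD(2)[OF E aE that(1)] by metis
        then show ?thesis using that Cons.prems(3) by simp
      qed
    qed (use G r Cons.prems in auto)
    then show ?thesis by (rule sums_of_mono) auto
  qed
  then show ?case unfolding f by (rule sums_of_sum)
qed

subsection \<open>Characters of commutative subfields\<close>

text \<open>The embeddings of \<open>E\<close> over the base field into the algebraic closure. The
  value 0 outside \<open>E\<close> makes them determined by their restriction to \<open>E\<close>,
  so that this set is finite and can be summed over.\<close>

definition characters :: "'d set \<Rightarrow> ('d \<Rightarrow> 'f alg_closure) set" where
  "characters E = {c. (\<forall>x\<in>E. \<forall>y\<in>E. c (x + y) = c x + c y \<and> c (x * y) = c x * c y) \<and>
     (\<forall>a. c (scale a 1) = to_ac a) \<and> (\<forall>x. x \<notin> E \<longrightarrow> c x = 0)}"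

lemma charactersD:
  assumes "c \<in> characters E"
  shows "x \<in> E \<Longrightarrow> y \<in> E \<Longrightarrow> c (x + y) = c x + c y" "x \<in> E \<Longrightarrow> y \<in> E \<Longrightarrow> c (x * y) = c x * c y"
    "c (scale a 1) = to_ac a" "x \<notin> E \<Longrightarrow> c x = 0" "c 1 = 1" "c 0 = 0"
proof -
  show s: "c (scale a 1) = to_ac a" for a using assms unfolding characters_def by blast
  show "c 1 = 1" using s[of 1] by simp
  show "c 0 = 0" using s[of 0] by simp
qed (use assms in \<open>unfold characters_def, blast+\<close>)

lemma characters_eqI:
  "c \<in> characters E \<Longrightarrow> d \<in> characters E \<Longrightarrow> (\<And>x. x \<in> E \<Longrightarrow> c x = d x) \<Longrightarrow> c = d"
  by (rule ext) (metis charactersD(4))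

text \<open>Joint eigenfunctions for a finite basis \<open>U\<close> of \<open>E\<close> are
  eigenfunctions for all of \<open>E\<close> by linearity. Zero summands are discarded first: the
  eigenvalue of a nonzero function is unique, hence additive and multiplicative in
  \<open>a\<close>.\<close>

lemma character_eigenfunctions:
  assumes \<tau>: "one_sided_mult \<tau>" and E: "commutative_subfield E"
    and V: "function_space V" "\<And>f. f \<in> V \<Longrightarrow> linear_functional f"
      "\<And>a f. a \<in> E \<Longrightarrow> f \<in> V \<Longrightarrow> (\<lambda>y. f (\<tau> a y)) \<in> V"
    and f: "f \<in> V"
  shows "f \<in> sums_of {g \<in> V. g \<noteq> (\<lambda>_. 0) \<and> (\<exists>c\<in>characters E. \<forall>a\<in>E. \<forall>y. g (\<tau> a y) = c a * g y)}"
proof -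
  note Ed = division_subringD[OF commutative_subfieldD(1)[OF E]]
  obtain U \<pi> where U: "left_basis (range (\<lambda>a. scale a 1)) E U \<pi>"
    using left_basis_exists[OF division_subring_scalars Ed(1)] by blast
  obtain as where as: "set as = U" using left_basisD(1)[OF U] finite_list by blast
  have "f \<in> sums_of {g \<in> V. \<forall>a\<in>set as. \<exists>r. \<forall>y. g (\<tau> a y) = r * g y}"
    using left_basisD(2)[OF U] as by (intro joint_eigenfunctions[OF \<tau> E V _ f]) auto
  from sums_of_nonzero[OF this] show ?thesis
  proof (rule sums_of_mono, safe)
    fix g assume g: "g \<in> V" "\<forall>a\<in>set as. \<exists>r. \<forall>y. g (\<tau> a y) = r * g y" "g \<noteq> (\<lambda>_. 0)"
    note lin = linear_functionalD[OF V(2)[OF g(1)]]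
    obtain r where r: "\<And>u y. u \<in> U \<Longrightarrow> g (\<tau> u y) = r u * g y" using g(2) as by metis
    have ex: "\<exists>s. \<forall>y. g (\<tau> a y) = s * g y" if a: "a \<in> E" for a
    proof -
      have "\<forall>u\<in>U. \<exists>c. \<pi> u a = scale c 1" using left_basisD(4)[OF U a] by blast
      then obtain c where c: "\<And>u. u \<in> U \<Longrightarrow> \<pi> u a = scale (c u) 1" by metis
      have "a = (\<Sum>u\<in>U. \<pi> u a * u)" by (rule left_basisD(5)[OF U a])
      also have "\<dots> = (\<Sum>u\<in>U. scale (c u) 1 * u)" using c by simp
      finally have a_eq: "a = (\<Sum>u\<in>U. scale (c u) 1 * u)" .
      have "g (\<tau> a y) = (\<Sum>u\<in>U. to_ac (c u) * r u) * g y" for y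
      proof -
        have "g (\<tau> a y) = (\<Sum>u\<in>U. g (\<tau> (scale (c u) 1 * u) y))"
          by (subst a_eq) (simp only: one_sided_multD(4)[OF \<tau>] lin(6))
        also have "\<dots> = (\<Sum>u\<in>U. to_ac (c u) * (r u * g y))"
          by (intro sum.cong) (simp_all only: one_sided_multD(5)[OF \<tau>] lin(2) r)
        finally show ?thesis by (simp add: sum_distrib_right mult.assoc)
      qed
      then show ?thesis by blast
    qed
    obtain y0 where y0: "g y0 \<noteq> 0" using g(3) by blast
    define c where "c = (\<lambda>a. if a \<in> E then g (\<tau> a y0) / g y0 else 0)"
    have c: "g (\<tau> a y) = c a * g y" if "a \<in> E" for a y
    proof -
      obtain s where s: "\<And>y. g (\<tau> a y) = s * g y" using ex[OF \<open>a \<in> E\<close>] by blast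
      then show ?thesis using that y0 by (simp add: c_def)
    qed
    have "c \<in> characters E"
      unfolding characters_def
    proof (intro CollectI conjI ballI allI impI)
      fix x y assume xy: "x \<in> E" "y \<in> E"
      have "c (x + y) * g y0 = (c x + c y) * g y0"
        using c[OF Ed(4)[OF xy], of y0] c[OF xy(1)] c[OF xy(2)]
        by (simp add: one_sided_multD(2)[OF \<tau>] lin(1) distrib_right)
      then show "c (x + y) = c x + c y" using y0 by simp
      have "g (\<tau> (x * y) y0) = c x * (c y * g y0)"
        using one_sided_multD(1)[OF \<tau> commutative_subfieldD(2)[OF E xy], of y0] c[OF xy(1)] c[OF xy(2)]
        by metis
      then show "c (x * y) = c x * c y" using y0 c[OF Ed(5)[OF xy], of y0] by simp
    next
      fix a
      have "c (scale a 1) * g y0 = to_ac a * g y0"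
        using c[OF Ed(3)[of a], of y0] unfolding one_sided_multD(3)[OF \<tau>] lin(2) by (rule sym)
      then show "c (scale a 1) = to_ac a" using y0 by (metis mult_right_cancel)
    qed (simp add: c_def)
    then show "\<exists>c\<in>characters E. \<forall>a\<in>E. \<forall>y. g (\<tau> a y) = c a * g y" using c by blast
  qed
qed

lemma function_space_linear: "function_space {f. linear_functional f}"
  unfolding function_space_def by (auto simp: linear_functional_def algebra_simps)

lemma peval_in: "division_subring E \<Longrightarrow> a \<in> E \<Longrightarrow> peval q a \<in> E"
  by (induction q) (auto simp: division_subringD)

lemma character_peval:
  assumes "division_subring E" "c \<in> characters E" "a \<in> E"
  shows "c (peval q a) = poly (map_poly to_ac q) (c a)"
proof (induction q)
  case (pCons d q)
  then show ?case
    using assms by (simp add: map_poly_pCons charactersD peval_in division_subringD)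
qed (use assms in \<open>simp add: charactersD\<close>)

lemma character_sum:
  assumes "division_subring E" "c \<in> characters E" "\<And>i. i \<in> I \<Longrightarrow> f i \<in> E"
  shows "c (sum f I) = (\<Sum>i\<in>I. c (f i))"
  using assms(3)
  by (induction I rule: infinite_finite_induct)
     (auto simp: charactersD[OF assms(2)] division_subring_sum[OF assms(1)])

lemma character_eq_0_iff:
  assumes "division_subring E" "c \<in> characters E" "x \<in> E"
  shows "c x = 0 \<longleftrightarrow> x = 0"
proof
  assume "c x = 0"
  show "x = 0"
  proof (rule ccontr)
    assume "x \<noteq> 0"
    then have "c x * c (inverse x) = 1"
      using charactersD(2)[OF assms(2,3) division_subringD(6)[OF assms(1,3)]] charactersD(5)[OF assms(2)]
      by simp
    then show False using \<open>c x = 0\<close> by simp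
  qed
qed (use charactersD[OF assms(2)] in auto)

text \<open>A character is determined by its values on a finite basis of \<open>E\<close>, and each
  of these is a root of an annihilating polynomial.\<close>

lemma finite_characters:
  assumes E: "commutative_subfield E"
  shows "finite (characters E)"
proof -
  note Es = commutative_subfieldD(1)[OF E]
  note Ed = division_subringD[OF Es]
  obtain U \<pi> where U: "left_basis (range (\<lambda>a. scale a 1)) E U \<pi>"
    using left_basis_exists[OF division_subring_scalars Ed(1)] by blast
  obtain q where q: "\<And>u. q u \<noteq> 0" "\<And>u. peval (q u) u = 0" using algebraic by metis
  let ?R = "\<lambda>u. {z. poly (map_poly to_ac (q u)) z = 0}"
  have "inj_on (\<lambda>c. restrict c U) (characters E)"
  proof (rule inj_onI)
    fix c d assume c: "c \<in> characters E" and d: "d \<in> characters E" and eq: "restrict c U = restrict d U"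
    show "c = d"
    proof (rule characters_eqI[OF c d])
      fix x assume x: "x \<in> E"
      have UE: "u \<in> E" if "u \<in> U" for u using left_basisD(2)[OF U] that by blast
      have cd: "c u = d u" if "u \<in> U" for u using fun_cong[OF eq, of u] that by simp
      have pi: "\<exists>a. \<pi> u x = scale a 1" if "u \<in> U" for u using left_basisD(4)[OF U x that] by blast
      have in_E: "\<pi> u x * u \<in> E" if "u \<in> U" for u
        using pi[OF that] UE[OF that] Ed(3,5) by metis
      have "c x = (\<Sum>u\<in>U. c (\<pi> u x * u))"
        by (subst left_basisD(5)[OF U x]) (rule character_sum[OF Es c in_E])
      also have "\<dots> = (\<Sum>u\<in>U. d (\<pi> u x * u))"
      proof (rule sum.cong)
        fix u assume u: "u \<in> U"
        obtain a where "\<pi> u x = scale a 1" using pi[OF u] by blast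
        then show "c (\<pi> u x * u) = d (\<pi> u x * u)"
          using charactersD(2,3)[OF c] charactersD(2,3)[OF d] Ed(3) UE[OF u] cd[OF u] by simp
      qed simp
      also have "\<dots> = d x"
        by (subst (2) left_basisD(5)[OF U x]) (rule character_sum[OF Es d in_E, symmetric])
      finally show "c x = d x" .
    qed
  qed
  moreover have "(\<lambda>c. restrict c U) ` characters E \<subseteq> PiE U ?R"
  proof (rule image_subsetI)
    fix c assume c: "c \<in> characters E"
    have "poly (map_poly to_ac (q u)) (c u) = 0" if "u \<in> U" for u
      using character_peval[OF Es c, of u "q u"] left_basisD(2)[OF U] q(2)[of u] charactersD(6)[OF c] that
      by auto
    then show "restrict c U \<in> PiE U ?R" by (auto simp: restrict_PiE_iff)
  qed
  moreover have "finite (PiE U ?R)"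
  proof (rule finite_PiE)
    show "finite {z. poly (map_poly to_ac (q u)) z = 0}" for u
      by (rule poly_roots_finite) (simp add: q(1) map_poly_to_ac_eq_0_iff)
  qed (rule left_basisD(1)[OF U])
  ultimately show ?thesis by (meson finite_imageD finite_subset)
qed

text \<open>Dedekind's elimination: for \<open>c\<close> other than \<open>e\<close> choose
  \<open>b\<close> with \<open>c b \<noteq> e b\<close>; the relation at \<open>b * a\<close> minus
  \<open>e b\<close> times the relation at \<open>a\<close> no longer contains
  \<open>e\<close>.\<close>

lemma characters_independent:
  assumes E: "division_subring E" and "finite C" "C \<subseteq> characters E"
    and "\<And>a. a \<in> E \<Longrightarrow> (\<Sum>c\<in>C. \<gamma> c * c a) = 0" and "c \<in> C"
  shows "\<gamma> c = 0"
  using assms(2-)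
proof (induction C arbitrary: \<gamma> c rule: finite_induct)
  case (insert e C)
  have eC: "e \<in> characters E" "C \<subseteq> characters E" using insert.prems by auto
  have g: "\<gamma> c = 0" if c: "c \<in> C" for c
  proof -
    have "c \<noteq> e" using c insert.hyps by auto
    then obtain b where b: "b \<in> E" "c b \<noteq> e b"
      using characters_eqI[of c E e] c eC by blast
    have "(\<Sum>c\<in>C. (\<gamma> c * (c b - e b)) * c a) = 0" if a: "a \<in> E" for a
    proof -
      have "(\<Sum>c\<in>insert e C. \<gamma> c * c (b * a)) - e b * (\<Sum>c\<in>insert e C. \<gamma> c * c a) = 0"
        using insert.prems(2)[OF a] insert.prems(2)[OF division_subringD(5)[OF E b(1) a]] by simp
      moreover have "(\<Sum>c\<in>insert e C. \<gamma> c * c (b * a)) = (\<Sum>c\<in>insert e C. \<gamma> c * (c b * c a))"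
        using insert.prems(1) charactersD(2)[OF _ b(1) a] by (intro sum.cong) auto
      ultimately have "(\<Sum>c\<in>insert e C. \<gamma> c * (c b * c a) - e b * (\<gamma> c * c a)) = 0"
        by (simp only: sum_subtractf sum_distrib_left)
      then have "(\<Sum>c\<in>C. \<gamma> c * (c b * c a) - e b * (\<gamma> c * c a)) = 0"
        using insert.hyps by simp
      then show ?thesis by (simp add: algebra_simps)
    qed
    from insert.IH[OF eC(2) this c] show ?thesis using b by simp
  qed
  have "\<gamma> e * e 1 = 0"
    using insert.prems(2)[OF division_subringD(2)[OF E]] insert.hyps g by simp
  then have "\<gamma> e = 0" using charactersD(5)[OF eC(1)] by simp
  then show ?case using g insert.prems(3) by auto
qed simp

text \<open>Collects the eigenvalues of the summands into one combination of characters;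
  \<open>h\<close> is later the identity or left multiplication by a fixed element.\<close>

lemma sums_of_expansion:
  assumes "finite C" and "f \<in> sums_of B"
    and B: "\<And>g. g \<in> B \<Longrightarrow> \<exists>c\<in>C. \<exists>\<gamma>. \<forall>a\<in>E. g (h a) = \<gamma> * c a"
  shows "\<exists>\<gamma>. \<forall>a\<in>E. f (h a) = (\<Sum>c\<in>C. \<gamma> c * c a)"
  using assms(2)
proof (induction rule: sums_of.induct)
  case zero
  then show ?case by (intro exI[of _ "\<lambda>_. 0"]) auto
next
  case (add g f)
  obtain c \<delta> where c: "c \<in> C" "\<And>a. a \<in> E \<Longrightarrow> g (h a) = \<delta> * c a" using B[OF add.hyps(1)] by blast
  obtain \<gamma> where \<gamma>: "\<And>a. a \<in> E \<Longrightarrow> f (h a) = (\<Sum>c\<in>C. \<gamma> c * c a)" using add.IH by blast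
  have "g (h a) + f (h a) = (\<Sum>d\<in>C. (\<gamma> d + (if d = c then \<delta> else 0)) * d a)" if "a \<in> E" for a
  proof -
    have "(\<Sum>d\<in>C. (if d = c then \<delta> else 0) * d a) = (\<Sum>d\<in>C. if d = c then \<delta> * d a else 0)"
      by (intro sum.cong) auto
    also have "\<dots> = g (h a)" using c(1) c(2)[OF that] assms(1) by simp
    finally show ?thesis using \<gamma>[OF that] by (simp add: distrib_right sum.distrib)
  qed
  then show ?case by (intro exI[of _ "\<lambda>d. \<gamma> d + (if d = c then \<delta> else 0)"] ballI)
qed

lemma functional_on_subfield:
  assumes E: "commutative_subfield E" and f: "linear_functional f"
  shows "\<exists>\<gamma>. \<forall>a\<in>E. f a = (\<Sum>c\<in>characters E. \<gamma> c * c a)"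
proof -
  have "f \<in> sums_of {g \<in> {f. linear_functional f}. g \<noteq> (\<lambda>_. 0) \<and>
     (\<exists>c\<in>characters E. \<forall>a\<in>E. \<forall>y. g (a * y) = c a * g y)}"
    using linear_functional_mult(1) f
    by (intro character_eigenfunctions[of "\<lambda>a y. a * y"] E function_space_linear)
       (auto simp: one_sided_mult_def)
  then show ?thesis
  proof (rule sums_of_expansion[OF finite_characters[OF E], where h = "\<lambda>a. a"])
    fix g assume "g \<in> {g \<in> {f. linear_functional f}. g \<noteq> (\<lambda>_. 0) \<and>
      (\<exists>c\<in>characters E. \<forall>a\<in>E. \<forall>y. g (a * y) = c a * g y)}"
    then obtain c where c: "c \<in> characters E" "\<And>a y. a \<in> E \<Longrightarrow> g (a * y) = c a * g y" by blast
    have "g a = g 1 * c a" if "a \<in> E" for a using c(2)[OF that, of 1] by (simp add: mult.commute)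
    then show "\<exists>c\<in>characters E. \<exists>\<gamma>. \<forall>a\<in>E. g a = \<gamma> * c a" using c(1) by blast
  qed
qed

subsection \<open>Weights of a commutative subfield\<close>

text \<open>The functionals of weight \<alpha> are stable under left and right multiplication by
  \<open>E\<close>. A left eigenfunction among them, and then a right eigenfunction among the left
  ones, turns the commutator action into a difference of two characters. These agree on the center
  because the two multiplications do.\<close>

lemma weight_is_difference:
  assumes E: "commutative_subfield E" and f: "linear_functional f" "f \<noteq> (\<lambda>_. 0)"
    and \<alpha>: "\<And>a y. a \<in> E \<Longrightarrow> f (a * y - y * a) = \<alpha> a * f y"
  shows "\<exists>e\<in>characters E. \<exists>e'\<in>characters E.
    (\<forall>k\<in>center \<inter> E. e k = e' k) \<and> (\<forall>a\<in>E. \<alpha> a = e a - e' a)"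
proof -
  note Ec = commutative_subfieldD(2)[OF E]
  let ?V = "{f. linear_functional f \<and> (\<forall>a\<in>E. \<forall>y. f (a * y - y * a) = \<alpha> a * f y)}"
  have V: "function_space ?V"
    using function_space_linear unfolding function_space_def by (auto simp: algebra_simps)
  have left: "(\<lambda>y. f (a * y)) \<in> ?V" if "a \<in> E" "f \<in> ?V" for a f
  proof -
    have "a * (b * y - y * b) = b * (a * y) - a * y * b" if "b \<in> E" for b y
      using Ec[OF \<open>a \<in> E\<close> that] by (simp add: right_diff_distrib flip: mult.assoc)
    then show ?thesis using that linear_functional_mult(1)[of f a] by simp
  qed
  have right: "(\<lambda>y. f (y * a)) \<in> ?V" if "a \<in> E" "f \<in> ?V" for a f
  proof -
    have "(b * y - y * b) * a = b * (y * a) - y * a * b" if "b \<in> E" for b y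
      using Ec[OF \<open>a \<in> E\<close> that] by (simp add: left_diff_distrib mult.assoc)
    then show ?thesis using that linear_functional_mult(2)[of f a] by simp
  qed
  have "f \<in> sums_of {g \<in> ?V. g \<noteq> (\<lambda>_. 0) \<and> (\<exists>c\<in>characters E. \<forall>a\<in>E. \<forall>y. g (a * y) = c a * g y)}"
    by (rule character_eigenfunctions[of "\<lambda>a y. a * y", OF _ E V])
       (use left f \<alpha> in \<open>auto simp: one_sided_mult_def\<close>)
  then have "\<exists>g e. g \<in> ?V \<and> g \<noteq> (\<lambda>_. 0) \<and> e \<in> characters E \<and> (\<forall>a\<in>E. \<forall>y. g (a * y) = e a * g y)"
    using f(2) by (cases rule: sums_of.cases) blast+
  then obtain g e where g: "g \<in> ?V" "g \<noteq> (\<lambda>_. 0)" and e: "e \<in> characters E"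
    and ge: "\<And>a y. a \<in> E \<Longrightarrow> g (a * y) = e a * g y" by blast
  let ?W = "{f \<in> ?V. \<forall>a\<in>E. \<forall>y. f (a * y) = e a * f y}"
  have W: "function_space ?W"
    using V unfolding function_space_def by (auto simp: algebra_simps)
  have "g \<in> sums_of {h \<in> ?W. h \<noteq> (\<lambda>_. 0) \<and> (\<exists>c\<in>characters E. \<forall>a\<in>E. \<forall>y. h (y * a) = c a * h y)}"
  proof (rule character_eigenfunctions[of "\<lambda>a y. y * a", OF _ E W])
    fix a f assume "a \<in> E" "f \<in> ?W"
    then show "(\<lambda>y. f (y * a)) \<in> ?W" using right[of a f] by (simp add: mult.assoc)
  qed (use g ge in \<open>auto simp: one_sided_mult_def\<close>)
  then have "\<exists>h e'. h \<in> ?W \<and> h \<noteq> (\<lambda>_. 0) \<and> e' \<in> characters E \<and> (\<forall>a\<in>E. \<forall>y. h (y * a) = e' a * h y)"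
    using g(2) by (cases rule: sums_of.cases) blast+
  then obtain h e' where h: "h \<in> ?W" "h \<noteq> (\<lambda>_. 0)" and e': "e' \<in> characters E"
    and he': "\<And>a y. a \<in> E \<Longrightarrow> h (y * a) = e' a * h y" by blast
  obtain y where y: "h y \<noteq> 0" using h(2) by blast
  have he: "h (a * y) = e a * h y" if "a \<in> E" for a using h(1) that by blast
  have "e k = e' k" if "k \<in> center \<inter> E" for k
    using he[of k] he'[of k y] that center_commute[of k y] y by simp
  moreover have "\<alpha> a = e a - e' a" if "a \<in> E" for a
  proof -
    have "h (a * y - y * a) = \<alpha> a * h y" "linear_functional h" using h(1) that by blast+
    then have "(e a - e' a) * h y = \<alpha> a * h y"
      using he[OF that] he'[OF that, of y] linear_functionalD(5)[of h "a * y" "y * a"]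
      by (simp add: left_diff_distrib)
    then show ?thesis using y by simp
  qed
  ultimately show ?thesis using e e' by blast
qed

text \<open>By density of the multiplication algebra, the \<open>E\<close>-\<open>E\<close>-bimodule \<open>D\<close> is faithful over
  the tensor square of \<open>E\<close> over the center, so every pair of characters that agree on the center occurs in it.\<close>

lemma bimodule_weight_exists:
  assumes E: "commutative_subfield E" and cE: "center \<subseteq> E"
    and e: "e \<in> characters E" "e' \<in> characters E" and k: "\<And>k. k \<in> center \<Longrightarrow> e k = e' k"
  shows "\<exists>f. linear_functional f \<and> f \<noteq> (\<lambda>_. 0) \<and>
    (\<forall>a\<in>E. \<forall>y. f (a * y) = e a * f y) \<and> (\<forall>a\<in>E. \<forall>y. f (y * a) = e' a * f y)"
proof (rule ccontr)
  assume neg: "\<not> ?thesis"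
  note Es = commutative_subfieldD(1)[OF E]
  note Ed = division_subringD[OF Es]
  let ?V = "{f. linear_functional f \<and> (\<forall>a\<in>E. \<forall>y. f (a * y) = e a * f y)}"
  have V: "function_space ?V"
    using function_space_linear unfolding function_space_def by (auto simp: algebra_simps)
  let ?X = "characters E - {e'}"
  have finX: "finite ?X" using finite_characters[OF E] by simp
  \<comment> \<open>Under the negated claim no right eigenfunction in \<open>?V\<close> belongs to
    \<open>e'\<close>, so only the other characters occur.\<close>
  have span: "\<exists>\<gamma>. \<forall>b\<in>E. f (y * b) = (\<Sum>c\<in>?X. \<gamma> c * c b)" if "f \<in> ?V" for f y
  proof -
    have "f \<in> sums_of {g \<in> ?V. g \<noteq> (\<lambda>_. 0) \<and> (\<exists>c\<in>characters E. \<forall>a\<in>E. \<forall>y. g (y * a) = c a * g y)}"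
    proof (rule character_eigenfunctions[of "\<lambda>a y. y * a", OF _ E V])
      fix a f assume "a \<in> E" "f \<in> ?V"
      then show "(\<lambda>y. f (y * a)) \<in> ?V" using linear_functional_mult(2) by (simp add: mult.assoc)
    qed (use that in \<open>auto simp: one_sided_mult_def\<close>)
    then show ?thesis
    proof (rule sums_of_expansion[OF finX, where h = "\<lambda>b. y * b"])
      fix g assume "g \<in> {g \<in> ?V. g \<noteq> (\<lambda>_. 0) \<and> (\<exists>c\<in>characters E. \<forall>a\<in>E. \<forall>y. g (y * a) = c a * g y)}"
      then obtain c where g: "g \<in> ?V" "g \<noteq> (\<lambda>_. 0)"
        and c: "c \<in> characters E" "\<And>a y. a \<in> E \<Longrightarrow> g (y * a) = c a * g y" by blast
      have "c \<noteq> e'" using neg g c by blast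
      moreover have "g (y * a) = g y * c a" if "a \<in> E" for a using c(2)[OF that, of y] by (simp add: mult.commute)
      ultimately show "\<exists>c\<in>?X. \<exists>\<gamma>. \<forall>b\<in>E. g (y * b) = \<gamma> * c b" using c(1) by blast
    qed
  qed
  obtain B \<rho> where B: "left_basis E UNIV B \<rho>" using left_basis_exists[OF Es] by blast
  obtain b0 where b0: "b0 \<in> B" "\<rho> b0 1 \<noteq> 0" using left_basis_one[OF B] by blast
  have \<rho>E: "\<rho> b0 y \<in> E" for y using left_basisD(4)[OF B _ b0(1)] by simp
  have \<rho>m: "\<rho> b0 (a * y) = a * \<rho> b0 y" if "a \<in> E" for a y
    using left_basis_mult[OF Es B that _ _ b0(1)] by simp
  have \<rho>a: "\<rho> b0 (x + y) = \<rho> b0 x + \<rho> b0 y" for x y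
    using left_basis_add[OF Es B _ _ _ b0(1)] by simp
  \<comment> \<open>The coordinate at \<open>b0\<close> followed by \<open>e\<close>, normalised at
    1: an extension of \<open>e\<close> to \<open>D\<close> that is compatible with left
    multiplication by \<open>E\<close>.\<close>
  define f0 where "f0 = (\<lambda>y. e (\<rho> b0 y) / e (\<rho> b0 1))"
  have nz: "e (\<rho> b0 1) \<noteq> 0" using character_eq_0_iff[OF Es e(1) \<rho>E] b0(2) by simp
  have f0m: "f0 (a * y) = e a * f0 y" if "a \<in> E" for a y
    using \<rho>m[OF that] charactersD(2)[OF e(1) that \<rho>E] by (simp add: f0_def)
  have f0a: "f0 (x + y) = f0 x + f0 y" for x y
    using \<rho>a charactersD(1)[OF e(1) \<rho>E \<rho>E] by (simp add: f0_def add_divide_distrib)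
  have f01: "f0 1 = 1" using nz by (simp add: f0_def)
  have f0E: "f0 a = e a" if "a \<in> E" for a using f0m[OF that, of 1] f01 by simp
  have f0lin: "linear_functional f0"
    unfolding linear_functional_def using f0a f0m[OF Ed(3)] charactersD(3)[OF e(1)]
    by (metis scale_eq_mult)
  have f0V: "(\<lambda>y. f0 (y * z)) \<in> ?V" for z
    using linear_functional_mult(2)[OF f0lin] f0m by (simp add: mult.assoc)
  have ops: "\<exists>\<gamma>. \<forall>b\<in>E. f0 (T b) = (\<Sum>c\<in>?X. \<gamma> c * c b)" if "T \<in> mult_ops" for T
    using that
  proof (induction rule: mult_ops.induct)
    case (mult y z)
    show ?case using span[OF f0V[of z], of y] .
  next
    case (add S T)
    then obtain \<gamma> \<delta> where "\<And>b. b \<in> E \<Longrightarrow> f0 (S b) = (\<Sum>c\<in>?X. \<gamma> c * c b)"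
      "\<And>b. b \<in> E \<Longrightarrow> f0 (T b) = (\<Sum>c\<in>?X. \<delta> c * c b)" by blast
    then show ?case
      by (intro exI[of _ "\<lambda>c. \<gamma> c + \<delta> c"]) (simp add: f0a distrib_right sum.distrib)
  qed
  obtain U \<pi> where U: "left_basis center E U \<pi>"
    using left_basis_exists[OF division_subring_center Ed(1)] by blast
  have "\<forall>u\<in>U. \<exists>T. T \<in> mult_ops \<and> (\<forall>b\<in>E. T b = \<pi> u b)"
    using mult_ops_coordinate[OF U] by blast
  from bchoice[OF this] obtain T where T: "\<And>u. u \<in> U \<Longrightarrow> T u \<in> mult_ops"
    and Tb: "\<And>u b. u \<in> U \<Longrightarrow> b \<in> E \<Longrightarrow> T u b = \<pi> u b" by blast
  have "\<forall>u\<in>U. \<exists>\<gamma>. \<forall>b\<in>E. f0 (T u b) = (\<Sum>c\<in>?X. \<gamma> c * c b)"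
    using ops T by blast
  from bchoice[OF this] obtain \<gamma>
    where \<gamma>: "\<And>u b. u \<in> U \<Longrightarrow> b \<in> E \<Longrightarrow> f0 (T u b) = (\<Sum>c\<in>?X. \<gamma> u c * c b)"
    by blast
  define \<delta> where "\<delta> = (\<lambda>c. \<Sum>u\<in>U. e' u * \<gamma> u c)"
  \<comment> \<open>The coordinates over the center are multiplication operators and
    \<open>e'\<close> agrees with \<open>e\<close> on the center. Hence \<open>e'\<close> becomes a
    combination of the values \<open>f0 (T u b)\<close>, which involve only the other characters,
    against independence.\<close>
  have key: "e' b = (\<Sum>c\<in>?X. \<delta> c * c b)" if b: "b \<in> E" for b
  proof -
    have pE: "\<pi> u b \<in> E" "\<pi> u b \<in> center" "u \<in> E" if "u \<in> U" for u
      using left_basisD(2,4)[OF U] b that cE by blast+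
    have "e' b = (\<Sum>u\<in>U. e' (\<pi> u b * u))"
      by (subst left_basisD(5)[OF U b]) (rule character_sum[OF Es e(2)], use pE Ed(5) in blast)
    also have "\<dots> = (\<Sum>u\<in>U. e' u * f0 (T u b))"
    proof (rule sum.cong)
      fix u assume u: "u \<in> U"
      show "e' (\<pi> u b * u) = e' u * f0 (T u b)"
        using charactersD(2)[OF e(2) pE(1)[OF u] pE(3)[OF u]] k[OF pE(2)[OF u]] f0E[OF pE(1)[OF u]]
          Tb[OF u b] by simp
    qed simp
    also have "\<dots> = (\<Sum>u\<in>U. \<Sum>c\<in>?X. e' u * \<gamma> u c * c b)"
      using \<gamma>[OF _ b] by (intro sum.cong) (simp_all add: sum_distrib_left mult.assoc)
    also have "\<dots> = (\<Sum>c\<in>?X. \<delta> c * c b)"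
      by (subst sum.swap) (simp add: \<delta>_def sum_distrib_right)
    finally show ?thesis .
  qed
  let ?\<epsilon> = "\<lambda>c. if c = e' then - 1 else \<delta> c"
  have "(\<Sum>c\<in>characters E. ?\<epsilon> c * c a) = 0" if "a \<in> E" for a
  proof -
    have "(\<Sum>c\<in>characters E. ?\<epsilon> c * c a) = ?\<epsilon> e' * e' a + (\<Sum>c\<in>?X. ?\<epsilon> c * c a)"
      using finite_characters[OF E] e(2) by (rule sum.remove)
    also have "(\<Sum>c\<in>?X. ?\<epsilon> c * c a) = (\<Sum>c\<in>?X. \<delta> c * c a)" by (intro sum.cong) auto
    finally show ?thesis using key[OF that] by simp
  qed
  from characters_independent[OF Es finite_characters[OF E] subset_refl this e(2)]
  show False by simp
qed

subsection \<open>Traces and commutators\<close>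

text \<open>The trace of the regular representation, computed on functionals. The
  \<open>F (b, c)\<close>, a character \<open>c\<close> applied to the coordinate at
  \<open>b\<close>, form a basis of the functionals, and \<open>M x\<close> is the matrix of
  \<open>f \<mapsto> (\<lambda>y. f (x * y))\<close> in it. An element \<open>a\<close> of
  \<open>E\<close> acts diagonally, with eigenvalue \<open>c a\<close> for each of the
  \<open>card B\<close> choices of \<open>b\<close>.\<close>

lemma trace_exists:
  assumes E: "commutative_subfield E"
  shows "\<exists>T n. n \<noteq> 0 \<and> (\<forall>x y. T (x + y) = T x + T y) \<and> (\<forall>x y. T (x * y) = T (y * x)) \<and>
    (\<forall>a\<in>E. T a = of_nat n * (\<Sum>c\<in>characters E. c a))"
proof -
  note Es = commutative_subfieldD(1)[OF E]
  note Ed = division_subringD[OF Es]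
  obtain B \<rho> where B: "left_basis E UNIV B \<rho>" using left_basis_exists[OF Es] by blast
  note finB = left_basisD(1)[OF B]
  note finX = finite_characters[OF E]
  let ?I = "B \<times> characters E"
  define F :: "'d \<times> ('d \<Rightarrow> 'f alg_closure) \<Rightarrow> 'd \<Rightarrow> 'f alg_closure"
    where "F = (\<lambda>(b, c) y. c (\<rho> b y))"
  have \<rho>E: "\<rho> b y \<in> E" if "b \<in> B" for b y using left_basisD(4)[OF B _ that] by simp
  have Flin: "linear_functional (F i)" if iI: "i \<in> ?I" for i
  proof -
    obtain b c where i: "i = (b, c)" "b \<in> B" "c \<in> characters E" using iI by auto
    have "\<rho> b (scale a y) = scale a 1 * \<rho> b y" for a y
      using left_basis_mult[OF Es B Ed(3)[of a] _ _ i(2), of y] by (simp add: scale_eq_mult[symmetric])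
    then show ?thesis
      using charactersD(1,2,3)[OF i(3)] \<rho>E[OF i(2)] Ed(3) left_basis_add[OF Es B _ _ _ i(2)]
      by (simp add: F_def i linear_functional_def)
  qed
  have ex: "\<exists>\<gamma>. \<forall>y. f y = (\<Sum>i\<in>?I. \<gamma> i * F i y)" if f: "linear_functional f" for f
  proof -
    have "\<forall>b. \<exists>\<gamma>. \<forall>a\<in>E. f (a * b) = (\<Sum>c\<in>characters E. \<gamma> c * c a)"
      using functional_on_subfield[OF E linear_functional_mult(2)[OF f]] by blast
    from choice[OF this] obtain \<gamma>
      where \<gamma>: "\<And>b a. a \<in> E \<Longrightarrow> f (a * b) = (\<Sum>c\<in>characters E. \<gamma> b c * c a)" by blast
    have "f y = (\<Sum>i\<in>?I. (case i of (b, c) \<Rightarrow> \<gamma> b c) * F i y)" for y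
    proof -
      have "f y = (\<Sum>b\<in>B. f (\<rho> b y * b))"
        by (subst left_basisD(5)[OF B, of y]) (simp_all add: linear_functionalD(6)[OF f])
      also have "\<dots> = (\<Sum>b\<in>B. \<Sum>c\<in>characters E. \<gamma> b c * c (\<rho> b y))"
        using \<gamma>[OF \<rho>E] by simp
      finally show ?thesis by (simp add: sum.cartesian_product F_def split_def)
    qed
    then show ?thesis by blast
  qed
  have uniq: "\<gamma> i = \<delta> i" if eq: "\<And>y. (\<Sum>i\<in>?I. \<gamma> i * F i y) = (\<Sum>i\<in>?I. \<delta> i * F i y)" and i: "i \<in> ?I" for \<gamma> \<delta> i
  proof -
    obtain b c where bc: "i = (b, c)" "b \<in> B" "c \<in> characters E" using i by auto
    have Fab: "F (b', d) (a * b) = (if b' = b then d a else 0)"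
      if "a \<in> E" "b' \<in> B" "d \<in> characters E" for a b' d
      using left_basis_mult[OF Es B that(1) _ _ that(2), of b] left_basis_self[OF Es B that(2) bc(2)]
        charactersD(6)[OF that(3)] by (simp add: F_def)
    have s: "(\<Sum>i\<in>?I. \<eta> i * F i (a * b)) = (\<Sum>d\<in>characters E. \<eta> (b, d) * d a)" if "a \<in> E" for \<eta> a
    proof -
      have "(\<Sum>i\<in>?I. \<eta> i * F i (a * b)) = (\<Sum>b'\<in>B. \<Sum>d\<in>characters E. \<eta> (b', d) * F (b', d) (a * b))"
        by (simp add: sum.cartesian_product split_def)
      also have "\<dots> = (\<Sum>b'\<in>B. if b' = b then (\<Sum>d\<in>characters E. \<eta> (b, d) * d a) else 0)"
        using Fab[OF that] by (intro sum.cong) auto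
      finally show ?thesis using finB bc(2) by simp
    qed
    have "(\<Sum>d\<in>characters E. (\<gamma> (b, d) - \<delta> (b, d)) * d a) = 0" if "a \<in> E" for a
      using eq[of "a * b"] s[OF that, of \<gamma>] s[OF that, of \<delta>] by (simp add: left_diff_distrib sum_subtractf)
    from characters_independent[OF Es finX subset_refl this bc(3)]
    show ?thesis by (simp add: bc(1))
  qed
  have "\<forall>x. \<exists>m. \<forall>i\<in>?I. \<forall>y. F i (x * y) = (\<Sum>j\<in>?I. m i j * F j y)"
  proof
    fix x
    have "\<forall>i\<in>?I. \<exists>\<gamma>. \<forall>y. F i (x * y) = (\<Sum>j\<in>?I. \<gamma> j * F j y)"
      using ex[OF linear_functional_mult(1)[OF Flin]] by blast
    from bchoice[OF this] show "\<exists>m. \<forall>i\<in>?I. \<forall>y. F i (x * y) = (\<Sum>j\<in>?I. m i j * F j y)" .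
  qed
  from choice[OF this] obtain M
    where M: "\<And>x i y. i \<in> ?I \<Longrightarrow> F i (x * y) = (\<Sum>j\<in>?I. M x i j * F j y)" by blast
  define T where "T = (\<lambda>x. \<Sum>i\<in>?I. M x i i)"
  have Madd: "M (x + y) i j = M x i j + M y i j" if "i \<in> ?I" "j \<in> ?I" for x y i j
  proof (rule uniq[OF _ that(2)])
    fix z
    have "F i ((x + y) * z) = F i (x * z) + F i (y * z)"
      using linear_functionalD(1)[OF Flin[OF that(1)]] by (simp add: distrib_right)
    then show "(\<Sum>j\<in>?I. M (x + y) i j * F j z) = (\<Sum>j\<in>?I. (M x i j + M y i j) * F j z)"
      unfolding M[OF that(1)] by (simp add: distrib_right sum.distrib)
  qed
  have Mmult: "M (x * y) i j = (\<Sum>k\<in>?I. M x i k * M y k j)" if "i \<in> ?I" "j \<in> ?I" for x y i j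
  proof (rule uniq[OF _ that(2)])
    fix z
    have "(\<Sum>j\<in>?I. M (x * y) i j * F j z) = F i (x * (y * z))"
      using M[OF that(1), of "x * y" z] by (simp add: mult.assoc)
    also have "\<dots> = (\<Sum>k\<in>?I. M x i k * (\<Sum>j\<in>?I. M y k j * F j z))"
      unfolding M[OF that(1), of x] using M by (intro sum.cong) auto
    also have "\<dots> = (\<Sum>j\<in>?I. (\<Sum>k\<in>?I. M x i k * M y k j) * F j z)"
      by (simp add: sum_distrib_left sum_distrib_right mult.assoc) (rule sum.swap)
    finally show "(\<Sum>j\<in>?I. M (x * y) i j * F j z) = (\<Sum>j\<in>?I. (\<Sum>k\<in>?I. M x i k * M y k j) * F j z)" .
  qed
  have "T (x + y) = T x + T y" for x y
    using Madd by (simp add: T_def sum.distrib[symmetric])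
  moreover have "T (x * y) = T (y * x)" for x y
  proof -
    have "T (x * y) = (\<Sum>i\<in>?I. \<Sum>k\<in>?I. M x i k * M y k i)" unfolding T_def using Mmult by simp
    also have "\<dots> = (\<Sum>k\<in>?I. \<Sum>i\<in>?I. M y k i * M x i k)" by (subst sum.swap) (simp add: mult.commute)
    also have "\<dots> = T (y * x)" unfolding T_def using Mmult by simp
    finally show ?thesis .
  qed
  moreover have "T a = of_nat (card B) * (\<Sum>c\<in>characters E. c a)" if a: "a \<in> E" for a
  proof -
    have Mii: "M a i i = snd i a" if i: "i \<in> ?I" for i
    proof -
      \<comment> \<open>\<open>uniq\<close> compares the coefficients at every \<open>j\<close>; at
        \<open>j = i\<close> the Kronecker delta takes this shape.\<close>
      have "M a i i = (if i = i then snd i a else 0)"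
      proof (rule uniq[of "\<lambda>j. M a i j" "\<lambda>j. if j = i then snd i a else 0", OF _ i])
        fix z
        obtain b c where bc: "i = (b, c)" "b \<in> B" "c \<in> characters E" using i by auto
        have "(\<Sum>j\<in>?I. M a i j * F j z) = F i (a * z)" using M[OF i] by simp
        also have "\<dots> = c a * F i z"
          using left_basis_mult[OF Es B a _ _ bc(2), of z] charactersD(2)[OF bc(3) a \<rho>E[OF bc(2)]]
          by (simp add: F_def bc(1))
        also have "\<dots> = (\<Sum>j\<in>?I. if j = i then snd i a * F i z else 0)"
          using finB finX i bc by (subst sum.delta) auto
        also have "\<dots> = (\<Sum>j\<in>?I. (if j = i then snd i a else 0) * F j z)"
          by (intro sum.cong) auto
        finally show "(\<Sum>j\<in>?I. M a i j * F j z) = (\<Sum>j\<in>?I. (if j = i then snd i a else 0) * F j z)" .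
      qed
      then show ?thesis by simp
    qed
    have "T a = (\<Sum>i\<in>?I. snd i a)" unfolding T_def using Mii by (intro sum.cong) auto
    also have "\<dots> = (\<Sum>b\<in>B. \<Sum>c\<in>characters E. c a)"
      unfolding sum.cartesian_product by (simp add: split_def)
    finally show ?thesis by simp
  qed
  moreover have "card B \<noteq> 0" using left_basis_one[OF B] finB by auto
  ultimately show ?thesis by blast
qed

text \<open>Adding one commutator at a time suffices for a subspace, because a scalar, and even a
  central factor, can be moved into a commutator.\<close>

inductive_set derived :: "'d set" where
  zero: "0 \<in> derived"
| add: "x \<in> derived \<Longrightarrow> x + (y * z - z * y) \<in> derived"

lemma derived_commutator: "y * z - z * y \<in> derived"
  using derived.add[OF derived.zero, of y z] by simp

lemma derived_add: "x \<in> derived \<Longrightarrow> y \<in> derived \<Longrightarrow> x + y \<in> derived"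
proof (induction rule: derived.induct)
  case (add x u v)
  then have "(x + y) + (u * v - v * u) \<in> derived" by (intro derived.add)
  then show ?case by (simp add: algebra_simps)
qed simp

lemma derived_center_mult: "x \<in> derived \<Longrightarrow> k \<in> center \<Longrightarrow> k * x \<in> derived"
proof (induction rule: derived.induct)
  case (add x y z)
  have "k * (z * y) = z * (k * y)" using center_commute[OF add.prems, of z] by (metis mult.assoc)
  then have "k * (x + (y * z - z * y)) = k * x + ((k * y) * z - z * (k * y))"
    by (simp add: right_diff_distrib distrib_left mult.assoc)
  then show ?case using derived.add[OF add.IH[OF add.prems], of "k * y" z] by (simp only:)
qed (simp add: derived.zero)

lemma derived_scale: "x \<in> derived \<Longrightarrow> scale a x \<in> derived"
  using derived_center_mult[OF _ division_subringD(3)[OF division_subring_center]]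
  by (metis scale_eq_mult)

lemma derived_minus: "x \<in> derived \<Longrightarrow> - x \<in> derived"
  using derived_scale[of x "-1"] by simp

lemma derived_diff: "x \<in> derived \<Longrightarrow> y \<in> derived \<Longrightarrow> x - y \<in> derived"
  using derived_add[OF _ derived_minus] by (metis diff_conv_add_uminus)

text \<open>The codomain is arbitrary so that both the regular trace and, later, the matrix traces
  of splittings are covered.\<close>

lemma trace_derived:
  fixes T :: "'d \<Rightarrow> 'b::ab_group_add"
  assumes "\<And>x y. T (x + y) = T x + T y" "\<And>x y. T (x * y) = T (y * x)" "x \<in> derived"
  shows "T x = 0"
proof -
  have T0: "T 0 = 0" using assms(1)[of 0 0] by simp
  have Td: "T (x - y) = T x - T y" for x y using assms(1)[of "x - y" y] by (simp add: algebra_simps)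
  show ?thesis using assms(3)
    by (induction rule: derived.induct) (simp_all add: T0 Td assms(1,2) assms(2)[of _ _])
qed

lemma commutative_subfield_center: "commutative_subfield center"
  unfolding commutative_subfield_def using division_subring_center center_commute by blast

lemma functional_exists: "\<exists>f. linear_functional f \<and> f 1 \<noteq> 0"
proof -
  let ?E = "range (\<lambda>a. scale a 1)"
  note Es = division_subring_scalars
  obtain B \<rho> where B: "left_basis ?E UNIV B \<rho>" using left_basis_exists[OF Es] by blast
  obtain b where b: "b \<in> B" "\<rho> b 1 \<noteq> 0" using left_basis_one[OF B] by blast
  have "\<forall>y. \<exists>a. \<rho> b y = scale a 1" using left_basisD(4)[OF B _ b(1)] by blast
  from choice[OF this] obtain g where g: "\<And>y. \<rho> b y = scale (g y) 1" by blast
  have inj: "a = a'" if "scale a (1::'d) = scale a' 1" for a a'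
    using that scale_right_imp_eq[of 1 a a'] by simp
  have "g (x + y) = g x + g y" for x y
    using left_basis_add[OF Es B _ _ _ b(1), of x y] by (intro inj) (simp add: g scale_left_distrib)
  moreover have "g (scale a y) = a * g y" for a y
  proof (rule inj)
    have "\<rho> b (scale a 1 * y) = scale a 1 * \<rho> b y"
      using left_basis_mult[OF Es B _ _ _ b(1)] by simp
    then show "scale (g (scale a y)) 1 = scale (a * g y) 1"
      by (simp add: g scale_eq_mult[symmetric])
  qed
  ultimately have "linear_functional (\<lambda>y. to_ac (g y))" by (simp add: linear_functional_def)
  moreover have "to_ac (g 1) \<noteq> 0" using b(2) g[of 1] by auto
  ultimately show ?thesis by blast
qed

text \<open>A functional with nonzero value at 1 expands in the characters, and an empty sum would
  make this value zero.\<close>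

lemma characters_nonempty:
  assumes "commutative_subfield E"
  shows "characters E \<noteq> {}"
proof
  assume "characters E = {}"
  obtain f where f: "linear_functional f" "f 1 \<noteq> 0" using functional_exists by blast
  obtain \<gamma> where "\<forall>a\<in>E. f a = (\<Sum>c\<in>characters E. \<gamma> c * c a)"
    using functional_on_subfield[OF assms f(1)] by blast
  then show False
    using f(2) \<open>characters E = {}\<close> division_subringD(2)[OF commutative_subfieldD(1)[OF assms]] by simp
qed

text \<open>The regular trace vanishes on commutators, but its value at 1 is \<open>n\<close> times
  the number of characters of the center, nonzero in characteristic 0.\<close>

lemma one_notin_derived: "1 \<notin> derived"
proof
  assume 1: "1 \<in> derived"
  obtain T :: "'d \<Rightarrow> 'f alg_closure" and n where T: "n \<noteq> 0" "\<And>x y. T (x + y) = T x + T y" "\<And>x y. T (x * y) = T (y * x)"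
    "\<And>a. a \<in> center \<Longrightarrow> T a = of_nat n * (\<Sum>c\<in>characters center. c a)"
    using trace_exists[OF commutative_subfield_center] by blast
  have "(\<Sum>c\<in>characters center. c 1) = (\<Sum>c\<in>characters center. 1)"
    by (intro sum.cong) (auto simp: charactersD(5))
  moreover have "card (characters center) \<noteq> 0"
    using finite_characters characters_nonempty commutative_subfield_center by simp
  ultimately have "T 1 \<noteq> 0"
    using T(4)[OF division_subringD(2)[OF division_subring_center]] T(1) by simp
  then show False using trace_derived[OF T(2,3) 1] by simp
qed

lemma center_inter_derived: "k \<in> center \<Longrightarrow> k \<in> derived \<Longrightarrow> k = 0"
  using derived_center_mult[of k "inverse k"] division_subringD(6)[OF division_subring_center]
    one_notin_derived by (cases "k = 0") auto

text \<open>A projection \<open>P\<close> of \<open>D\<close> onto its center is a sum of maps \<open>y \<mapsto> u y v\<close>; modulo commutators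
  it agrees with right multiplication by \<open>w = \<Sum> v u\<close>, and \<open>w \<noteq> 0\<close> since \<open>P 1 = 1\<close>.\<close>

lemma center_plus_derived: "\<exists>k\<in>center. \<exists>x\<in>derived. y = k + x"
proof -
  have mod: "\<exists>w. \<forall>y. T y - y * w \<in> derived" if "T \<in> mult_ops" for T
    using that
  proof (induction rule: mult_ops.induct)
    case (mult u v)
    have "u * y * v - y * (v * u) \<in> derived" for y
      using derived_commutator[of u "y * v"] by (simp add: mult.assoc)
    then show ?case by blast
  next
    case (add S T)
    then obtain w w' where "\<And>y. S y - y * w \<in> derived" "\<And>y. T y - y * w' \<in> derived" by blast
    then have "(S y - y * w) + (T y - y * w') \<in> derived" for y by (intro derived_add)
    then have "S y + T y - y * (w + w') \<in> derived" for y by (simp add: algebra_simps)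
    then show ?case by blast
  qed
  obtain U \<pi> where U: "left_basis center UNIV U \<pi>"
    using left_basis_exists[OF division_subring_center] by blast
  obtain u where u: "u \<in> U" "\<pi> u 1 \<noteq> 0" using left_basis_one[OF U] by blast
  obtain T where T: "T \<in> mult_ops" and Ty: "\<And>y. T y = \<pi> u y"
    using mult_ops_coordinate[OF U u(1)] by blast
  define P where "P = (\<lambda>y. inverse (\<pi> u 1) * T y)"
  have P: "P \<in> mult_ops" unfolding P_def by (rule mult_ops_lmult[OF T])
  have P1: "P 1 = 1" using u(2) by (simp add: P_def Ty)
  have Pc: "P y \<in> center" for y
    using left_basisD(4)[OF U _ u(1)] division_subringD(5,6)[OF division_subring_center]
    by (simp add: P_def Ty)
  obtain w where w: "\<And>y. P y - y * w \<in> derived" using mod[OF P] by blast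
  have "w \<noteq> 0" using w[of 1] P1 one_notin_derived by auto
  then have "y = P (y * inverse w) + - (P (y * inverse w) - (y * inverse w) * w)"
    by (simp add: mult.assoc)
  then show ?thesis using Pc derived_minus[OF w] by blast
qed

text \<open>Embeddings with a common restriction to the center belong to the same simple factor of
  \<open>D\<close> after extension of scalars to the algebraic closure.\<close>

definition same_class :: "('d \<Rightarrow> 'f alg_closure) \<Rightarrow> ('d \<Rightarrow> 'f alg_closure) \<Rightarrow> bool" where
  "same_class c d \<longleftrightarrow> (\<forall>k\<in>center. c k = d k)"

text \<open>The regular trace kills \<open>k * h\<close> for every central \<open>k\<close>. Sorting
  the characters of \<open>E\<close> by their restriction to the center turns this into a relation
  among characters of the center whose coefficients are the class sums.\<close>

lemma class_sum_derived:
  assumes E: "commutative_subfield E" "center \<subseteq> E" and e: "e \<in> characters E"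
    and h: "h \<in> E" "h \<in> derived"
  shows "(\<Sum>c | c \<in> characters E \<and> same_class e c. c h) = 0"
proof -
  obtain T :: "'d \<Rightarrow> 'f alg_closure" and n where T: "n \<noteq> 0" "\<And>x y. T (x + y) = T x + T y" "\<And>x y. T (x * y) = T (y * x)"
    "\<And>a. a \<in> E \<Longrightarrow> T a = of_nat n * (\<Sum>c\<in>characters E. c a)"
    using trace_exists[OF E(1)] by blast
  define r where "r = (\<lambda>c k. if k \<in> center then c k else (0 :: 'f alg_closure))"
  note Zd = division_subringD[OF division_subring_center]
  have rX: "r c \<in> characters center" if c: "c \<in> characters E" for c
    unfolding characters_def
  proof (intro CollectI conjI ballI allI impI)
    fix x y assume xy: "x \<in> center" "y \<in> center"
    then have "x \<in> E" "y \<in> E" using E(2) by auto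
    then show "r c (x + y) = r c x + r c y" "r c (x * y) = r c x * r c y"
      using xy Zd(4,5) charactersD(1,2)[OF c] by (auto simp: r_def)
  qed (use Zd(3) charactersD(3)[OF c] in \<open>auto simp: r_def\<close>)
  have r_eq: "r c = r d \<longleftrightarrow> same_class c d" for c d
    unfolding same_class_def r_def fun_eq_iff by auto
  let ?X = "characters E"
  let ?S = "\<lambda>i. \<Sum>c | c \<in> ?X \<and> r c = i. c h"
  have fin: "finite ?X" by (rule finite_characters[OF E(1)])
  have "(\<Sum>i\<in>r ` ?X. ?S i * i k) = 0" if k: "k \<in> center" for k
  proof -
    have kE: "k \<in> E" using k E(2) by auto
    have kh: "k * h \<in> E" using division_subringD(5)[OF commutative_subfieldD(1)[OF E(1)] kE h(1)] .
    have "T (k * h) = 0" using trace_derived[OF T(2,3) derived_center_mult[OF h(2) k]] by simp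
    then have "(\<Sum>c\<in>?X. c (k * h)) = 0" using T(4)[OF kh] T(1) by simp
    also have "(\<Sum>c\<in>?X. c (k * h)) = (\<Sum>c\<in>?X. c h * r c k)"
      using charactersD(2)[OF _ kE h(1)] k by (intro sum.cong) (auto simp: r_def mult.commute)
    also have "\<dots> = (\<Sum>i\<in>r ` ?X. \<Sum>c | c \<in> ?X \<and> r c = i. c h * r c k)"
      by (rule sum.image_gen[OF fin])
    also have "\<dots> = (\<Sum>i\<in>r ` ?X. ?S i * i k)"
      by (intro sum.cong refl) (simp add: sum_distrib_right)
    finally show ?thesis .
  qed
  from characters_independent[OF division_subring_center _ _ this, of "r e"] rX fin e
  have "?S (r e) = 0" by blast
  moreover have "{c. c \<in> ?X \<and> r c = r e} = {c. c \<in> ?X \<and> same_class e c}"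
    using r_eq by (metis (no_types))
  ultimately show ?thesis by (simp only:)
qed

subsection \<open>Lie automorphisms\<close>

text \<open>Independence of characters makes \<open>a - b - c + d = r - s\<close> a formal identity.
  If a \<noteq> c and b \<noteq> d, the coefficients of \<open>a\<close> and \<open>b\<close> force
  \<open>a = r\<close> and \<open>b = s\<close>, which leaves \<open>c = d\<close>.\<close>

lemma four_characters:
  assumes E: "commutative_subfield E"
    and X: "a \<in> characters E" "b \<in> characters E" "c \<in> characters E" "d \<in> characters E"
      "r \<in> characters E" "s \<in> characters E"
    and eq: "\<And>y. y \<in> E \<Longrightarrow> (a y - b y) - (c y - d y) = r y - s y"
    and ne: "a \<noteq> b" "c \<noteq> d"
  shows "a = c \<or> b = d"
proof (rule ccontr)
  assume neg: "\<not> ?thesis"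
  let ?\<delta> = "\<lambda>u x. if x = u then (1 :: 'f alg_closure) else 0"
  let ?\<gamma> = "\<lambda>x. ?\<delta> a x - ?\<delta> b x - (?\<delta> c x - ?\<delta> d x) - (?\<delta> r x - ?\<delta> s x)"
  note fin = finite_characters[OF E]
  have \<delta>: "(\<Sum>x\<in>characters E. ?\<delta> u x * x y) = u y" if "u \<in> characters E" for u y
  proof -
    have "(\<Sum>x\<in>characters E. ?\<delta> u x * x y) = (\<Sum>x\<in>characters E. if x = u then u y else 0)"
      by (intro sum.cong) auto
    then show ?thesis using fin that by simp
  qed
  have "(\<Sum>x\<in>characters E. ?\<gamma> x * x y) = 0" if "y \<in> E" for y
    using eq[OF that] unfolding left_diff_distrib sum_subtractf \<delta>[OF X(1)] \<delta>[OF X(2)] \<delta>[OF X(3)]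
      \<delta>[OF X(4)] \<delta>[OF X(5)] \<delta>[OF X(6)] by simp
  then have \<gamma>0: "?\<gamma> x = 0" if "x \<in> characters E" for x
    by (rule characters_independent[OF commutative_subfieldD(1)[OF E] fin subset_refl _ that])
  have "a = r" using \<gamma>0[OF X(1)] ne neg by (auto split: if_splits)
  moreover have "b = s" using \<gamma>0[OF X(2)] ne neg by (auto split: if_splits simp: algebra_simps)
  ultimately show False using \<gamma>0[OF X(3)] ne neg by (auto split: if_splits)
qed

text \<open>Linearity is required over the base field only, not over the center, so the classes of
  \<open>same_class\<close> may be permuted.\<close>

definition lie_automorphism :: "('d \<Rightarrow> 'd) \<Rightarrow> bool" where
  "lie_automorphism \<theta> \<longleftrightarrow> bij \<theta> \<and> (\<forall>x y. \<theta> (x + y) = \<theta> x + \<theta> y) \<and>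
     (\<forall>a x. \<theta> (scale a x) = scale a (\<theta> x)) \<and>
     (\<forall>x y. \<theta> (x * y - y * x) = \<theta> x * \<theta> y - \<theta> y * \<theta> x)"

lemma lie_automorphismD:
  assumes "lie_automorphism \<theta>"
  shows "bij \<theta>" "\<theta> (x + y) = \<theta> x + \<theta> y" "\<theta> (scale a x) = scale a (\<theta> x)"
    "\<theta> (x * y - y * x) = \<theta> x * \<theta> y - \<theta> y * \<theta> x" "\<theta> 0 = 0" "\<theta> x = \<theta> y \<longleftrightarrow> x = y"
    "\<theta> (inv_into UNIV \<theta> x) = x" "inv_into UNIV \<theta> (\<theta> x) = x"
proof -
  note \<theta> = assms[unfolded lie_automorphism_def]
  show b: "bij \<theta>" and add: "\<theta> (x + y) = \<theta> x + \<theta> y" and sc: "\<theta> (scale a x) = scale a (\<theta> x)"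
    and "\<theta> (x * y - y * x) = \<theta> x * \<theta> y - \<theta> y * \<theta> x" for x y a using \<theta> by auto
  show "\<theta> 0 = 0" using sc[of 0 0] by simp
  show "\<theta> x = \<theta> y \<longleftrightarrow> x = y" using b by (auto simp: bij_def inj_def)
  show "\<theta> (inv_into UNIV \<theta> x) = x" "inv_into UNIV \<theta> (\<theta> x) = x" using b by (simp_all add: bij_def surj_f_inv_f inv_f_f)
qed

lemma lie_automorphism_inv:
  assumes "lie_automorphism \<theta>"
  shows "lie_automorphism (inv_into UNIV \<theta>)"
proof -
  note \<theta> = lie_automorphismD[OF assms]
  have eqI: "x = y" if "\<theta> x = \<theta> y" for x y using that \<theta>(6) by simp
  show ?thesis
    unfolding lie_automorphism_def
  proof (intro conjI allI)
    show "bij (inv_into UNIV \<theta>)" using \<theta>(1) by (rule bij_imp_bij_inv)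
    show "inv_into UNIV \<theta> (x + y) = inv_into UNIV \<theta> x + inv_into UNIV \<theta> y" for x y by (rule eqI) (simp only: \<theta>(2,7))
    show "inv_into UNIV \<theta> (scale a x) = scale a (inv_into UNIV \<theta> x)" for a x by (rule eqI) (simp only: \<theta>(3,7))
    show "inv_into UNIV \<theta> (x * y - y * x) = inv_into UNIV \<theta> x * inv_into UNIV \<theta> y - inv_into UNIV \<theta> y * inv_into UNIV \<theta> x" for x y
      by (rule eqI) (simp only: \<theta>(4,7))
  qed
qed

lemma lie_automorphism_derived:
  assumes "lie_automorphism \<theta>" "x \<in> derived"
  shows "\<theta> x \<in> derived"
  using assms(2)
proof (induction rule: derived.induct)
  case (add x y z)
  then show ?case using derived.add[OF add.IH] by (simp add: lie_automorphismD(2,4)[OF assms(1)])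
qed (simp add: lie_automorphismD(5)[OF assms(1)] derived.zero)

text \<open>Maximal subfields, described by commutation alone. Unlike closure under products,
  commutation can be read off the Lie bracket, so a Lie automorphism preserves this
  property.\<close>

definition self_centralizing :: "'d set \<Rightarrow> bool" where
  "self_centralizing E \<longleftrightarrow> E = {y. \<forall>x\<in>E. y * x = x * y}"

lemma self_centralizingD:
  assumes "self_centralizing E"
  shows "commutative_subfield E" "center \<subseteq> E"
proof -
  have E: "E = {y. \<forall>x\<in>E. y * x = x * y}" using assms by (simp add: self_centralizing_def)
  show "commutative_subfield E"
    unfolding commutative_subfield_def using division_subring_centralizer[of E] E by auto
  show "center \<subseteq> E" by (subst E) (use center_commute in blast)
qed

text \<open>Zorn is applied to sets of commuting elements that contain \<open>x\<close>; a maximal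
  one contains everything that commutes with it and is thereby a subfield.\<close>

lemma self_centralizing_exists: "\<exists>E. self_centralizing E \<and> x \<in> E"
proof -
  define A where "A = {E. x \<in> E \<and> (\<forall>y\<in>E. \<forall>z\<in>E. y * z = z * y)}"
  have "\<exists>M\<in>A. \<forall>N\<in>A. M \<subseteq> N \<longrightarrow> N = M"
  proof (rule subset_Zorn_nonempty)
    show "A \<noteq> {}" unfolding A_def by (auto intro: exI[of _ "{x}"])
    fix C assume C: "C \<noteq> {}" "subset.chain A C"
    show "\<Union>C \<in> A"
      unfolding A_def
    proof (intro CollectI conjI ballI)
      show "x \<in> \<Union>C" using C unfolding subset_chain_def A_def by blast
      fix y z assume "y \<in> \<Union>C" "z \<in> \<Union>C"
      then obtain Y Z where YZ: "Y \<in> C" "y \<in> Y" "Z \<in> C" "z \<in> Z" by blast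
      then have "Y \<subseteq> Z \<or> Z \<subseteq> Y" using C unfolding subset_chain_def A_def by blast
      then show "y * z = z * y" using YZ C unfolding subset_chain_def A_def by blast
    qed
  qed
  then obtain M where M: "M \<in> A" and max: "\<And>N. N \<in> A \<Longrightarrow> M \<subseteq> N \<Longrightarrow> N = M" by blast
  have "y \<in> M" if "\<forall>x\<in>M. y * x = x * y" for y
  proof -
    have "insert y M \<in> A" using M that unfolding A_def by auto
    then have "insert y M = M" by (rule max) auto
    then show ?thesis by auto
  qed
  then have "self_centralizing M" unfolding self_centralizing_def using M unfolding A_def by blast
  then show ?thesis using M unfolding A_def by auto
qed

lemma self_centralizing_image:
  assumes \<theta>: "lie_automorphism \<theta>" and E: "self_centralizing E"
  shows "self_centralizing (\<theta> ` E)"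
proof -
  note t = lie_automorphismD[OF \<theta>]
  have com: "\<theta> x * \<theta> y = \<theta> y * \<theta> x \<longleftrightarrow> x * y = y * x" for x y
    using t(4)[of x y] t(5) t(6)[of "x * y - y * x" 0] by auto
  have "y \<in> \<theta> ` E \<longleftrightarrow> (\<forall>x\<in>\<theta> ` E. y * x = x * y)" for y
  proof -
    have y: "y = \<theta> (inv_into UNIV \<theta> y)" using t(7) by simp
    have "y \<in> \<theta> ` E \<longleftrightarrow> inv_into UNIV \<theta> y \<in> E" using t(7,8) by (metis image_iff)
    also have "\<dots> \<longleftrightarrow> (\<forall>x\<in>E. inv_into UNIV \<theta> y * x = x * inv_into UNIV \<theta> y)"
      using E unfolding self_centralizing_def by blast
    also have "\<dots> \<longleftrightarrow> (\<forall>x\<in>E. y * \<theta> x = \<theta> x * y)" using com[of "inv_into UNIV \<theta> y"] y by metis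
    finally show ?thesis by blast
  qed
  then show ?thesis unfolding self_centralizing_def by blast
qed

text \<open>A functional that realises \<open>e\<close> on the left and \<open>e'\<close> on the
  right, composed with \<theta>, is a weight vector for commutators with \<open>E\<close>; its
  weight is therefore a difference of characters of \<open>E\<close>.\<close>

lemma root_transfer:
  assumes \<theta>: "lie_automorphism \<theta>" and E: "self_centralizing E"
    and e: "e \<in> characters (\<theta> ` E)" "e' \<in> characters (\<theta> ` E)" "same_class e e'"
  shows "\<exists>a\<in>characters E. \<exists>b\<in>characters E. same_class a b \<and>
    (\<forall>y\<in>E. e (\<theta> y) - e' (\<theta> y) = a y - b y)"
proof -
  note t = lie_automorphismD[OF \<theta>]
  note E1 = self_centralizingD[OF E]
  note E2 = self_centralizingD[OF self_centralizing_image[OF \<theta> E]]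
  obtain f where f: "linear_functional f" "f \<noteq> (\<lambda>_. 0)"
    "\<And>a y. a \<in> \<theta> ` E \<Longrightarrow> f (a * y) = e a * f y" "\<And>a y. a \<in> \<theta> ` E \<Longrightarrow> f (y * a) = e' a * f y"
    using bimodule_weight_exists[OF E2 e(1,2)] e(3) unfolding same_class_def by blast
  let ?g = "\<lambda>y. f (\<theta> y)"
  have "linear_functional ?g"
    using linear_functionalD(1,2)[OF f(1)] by (simp add: linear_functional_def t(2,3))
  moreover obtain y0 where "f y0 \<noteq> 0" using f(2) by blast
  then have "?g (inv_into UNIV \<theta> y0) \<noteq> 0" by (simp add: t(7))
  then have "?g \<noteq> (\<lambda>_. 0)" by (auto dest: fun_cong)
  moreover have "?g (a * y - y * a) = (e (\<theta> a) - e' (\<theta> a)) * ?g y" if "a \<in> E" for a y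
    using f(3,4)[of "\<theta> a" "\<theta> y"] that
    by (simp add: t(4) linear_functionalD(5)[OF f(1)] left_diff_distrib)
  ultimately obtain a b where "a \<in> characters E" "b \<in> characters E" "\<forall>k\<in>center \<inter> E. a k = b k"
    "\<forall>y\<in>E. e (\<theta> y) - e' (\<theta> y) = a y - b y"
    using weight_is_difference[OF E1(1), of ?g "\<lambda>a. e (\<theta> a) - e' (\<theta> a)"] by blast
  moreover have "center \<inter> E = center" using E1(2) by blast
  ultimately show ?thesis unfolding same_class_def by auto
qed

lemma same_class_refl: "same_class c c"
  and same_class_sym: "same_class c d \<Longrightarrow> same_class d c"
  and same_class_trans: "same_class c d \<Longrightarrow> same_class d e \<Longrightarrow> same_class c e"
  by (simp_all add: same_class_def)

lemma root_transfer_back: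
  assumes \<theta>: "lie_automorphism \<theta>" and E: "self_centralizing E"
    and ab: "a \<in> characters E" "b \<in> characters E" "same_class a b"
  shows "\<exists>e\<in>characters (\<theta> ` E). \<exists>e'\<in>characters (\<theta> ` E). same_class e e' \<and>
    (\<forall>y\<in>E. a y - b y = e (\<theta> y) - e' (\<theta> y))"
proof -
  note t = lie_automorphismD[OF \<theta>]
  have im: "inv_into UNIV \<theta> ` \<theta> ` E = E" by (simp add: image_image t(8))
  from root_transfer[OF lie_automorphism_inv[OF \<theta>] self_centralizing_image[OF \<theta> E], unfolded im, OF ab]
  show ?thesis by (simp add: t(8) ball_simps)
qed

text \<open>\<open>S\<close> indexes the star of roots at \<open>e0\<close>, and \<open>s\<close> is
  the sign. The map \<open>p\<close> turns out to be a bijection onto the star at \<open>a\<close>,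
  so the relations can be summed on both sides. All characters of a class add up to zero on
  \<open>derived\<close>; thus the sums are \<open>card S + 1\<close> copies of \<open>e0\<close>
  and of \<open>a\<close>, and this number cancels in characteristic 0.\<close>

lemma star_sum:
  fixes \<theta> :: "'d \<Rightarrow> 'd" and s :: "'f alg_closure"
  assumes \<theta>: "lie_automorphism \<theta>" and E: "self_centralizing E"
    and e0: "e0 \<in> characters (\<theta> ` E)" and a: "a \<in> characters E"
    and s: "s = 1 \<or> s = - 1"
    and S: "S = {e \<in> characters (\<theta> ` E). same_class e0 e} - {e0}" "S \<noteq> {}"
    and p: "\<And>e. e \<in> S \<Longrightarrow> p e \<in> characters E" "\<And>e. e \<in> S \<Longrightarrow> same_class a (p e)"
      "\<And>e y. e \<in> S \<Longrightarrow> y \<in> E \<Longrightarrow> e0 (\<theta> y) - e (\<theta> y) = s * (a y - p e y)"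
    and y: "y \<in> E" "y \<in> derived"
  shows "e0 (\<theta> y) = s * a y"
proof -
  note t = lie_automorphismD[OF \<theta>]
  note E1 = self_centralizingD[OF E]
  note E2 = self_centralizingD[OF self_centralizing_image[OF \<theta> E]]
  have ss: "s * s = 1" using s by auto
  have eqI: "e = e'" if "e \<in> characters (\<theta> ` E)" "e' \<in> characters (\<theta> ` E)"
    "\<And>y. y \<in> E \<Longrightarrow> e (\<theta> y) = e' (\<theta> y)" for e e'
    by (rule characters_eqI[OF that(1,2)]) (use that(3) in auto)
  have SX: "e \<in> characters (\<theta> ` E)" "same_class e0 e" "e \<noteq> e0" if "e \<in> S" for e
    using that S by auto
  have inj: "inj_on p S"
  proof (rule inj_onI)
    fix e e' assume ee: "e \<in> S" "e' \<in> S" "p e = p e'"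
    show "e = e'"
    proof (rule eqI)
      fix y assume "y \<in> E"
      then show "e (\<theta> y) = e' (\<theta> y)" using p(3)[OF ee(1)] p(3)[OF ee(2)] ee(3) by (metis diff_left_imp_eq)
    qed (use SX ee in auto)
  qed
  have pa: "p e \<noteq> a" if e: "e \<in> S" for e
  proof
    assume "p e = a"
    then have "e0 = e" using p(3)[OF e] by (intro eqI) (use e0 SX[OF e] in auto)
    then show False using SX[OF e] by simp
  qed
  have pull: "\<exists>e\<in>characters (\<theta> ` E). \<exists>e'\<in>characters (\<theta> ` E). same_class e e' \<and>
      (\<forall>y\<in>E. s * (c y - d y) = e (\<theta> y) - e' (\<theta> y))"
    if "c \<in> characters E" "d \<in> characters E" "same_class c d" for c d
  proof (cases "s = 1")
    case True
    then show ?thesis using root_transfer_back[OF \<theta> E that] by simp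
  next
    case False
    then show ?thesis
      using root_transfer_back[OF \<theta> E that(2,1) same_class_sym[OF that(3)]] s by simp
  qed
  have surj: "c \<in> p ` S" if c: "c \<in> characters E" "same_class a c" "c \<noteq> a" for c
  proof (rule ccontr)
    assume notin: "c \<notin> p ` S"
    obtain e e' where e: "e \<in> characters (\<theta> ` E)" "e' \<in> characters (\<theta> ` E)" "same_class e e'"
      and ee': "\<And>y. y \<in> E \<Longrightarrow> s * (a y - c y) = e (\<theta> y) - e' (\<theta> y)"
      using pull[OF a c(1,2)] by blast
    have ne: "e \<noteq> e'"
    proof
      assume "e = e'"
      then have "a y = c y" if "y \<in> E" for y using ee'[OF that] s by auto
      then show False using characters_eqI[OF a c(1)] c(3) by blast
    qed
    \<comment> \<open>Here \<open>e0 - x\<close> minus \<open>e - e'\<close> comes from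
      \<open>s\<close> times \<open>c - p x\<close>, so it is again a difference of two characters,
      and \<open>four_characters\<close> applies.\<close>
    have dich: "e0 = e \<or> x = e'" if x: "x \<in> S" for x
    proof -
      obtain r r' where r: "r \<in> characters (\<theta> ` E)" "r' \<in> characters (\<theta> ` E)"
        and rr': "\<And>y. y \<in> E \<Longrightarrow> s * (c y - p x y) = r (\<theta> y) - r' (\<theta> y)"
        using pull[OF c(1) p(1)[OF x] same_class_trans[OF same_class_sym[OF c(2)] p(2)[OF x]]] by blast
      show ?thesis
      proof (rule four_characters[OF E2(1) e0 SX(1)[OF x] e(1,2) r _ SX(3)[OF x, symmetric] ne])
        fix z assume "z \<in> \<theta> ` E"
        then obtain y where y: "y \<in> E" "z = \<theta> y" by blast
        show "e0 z - x z - (e z - e' z) = r z - r' z"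
          unfolding y(2) p(3)[OF x y(1)] ee'[OF y(1), symmetric] rr'[OF y(1), symmetric]
          by (simp add: right_diff_distrib)
      qed
    qed
    have nee: "e0 \<noteq> e"
    proof
      assume "e0 = e"
      then have eS: "e' \<in> S" using e ne S(1) by auto
      have "p e' y = c y" if "y \<in> E" for y
        using p(3)[OF eS that] ee'[OF that] \<open>e0 = e\<close> s by auto
      then have "p e' = c" by (rule characters_eqI[OF p(1)[OF eS] c(1)])
      then show False using notin eS by blast
    qed
    \<comment> \<open>Now every member of \<open>S\<close> equals \<open>e'\<close>. But
      \<open>e\<close> lies in the class of \<open>e0\<close> too, hence in \<open>S\<close>, which
      would make it equal to \<open>e'\<close>.\<close>
    obtain x where x: "x \<in> S" using S(2) by blast
    have "x = e'" using dich[OF x] nee by blast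
    then have eS: "e' \<in> S" using x by simp
    have "same_class e0 e" using same_class_trans[OF SX(2)[OF eS] same_class_sym[OF e(3)]] .
    then have "e \<in> S" using S(1) e nee by auto
    then show False using dich[of e] nee ne by blast
  qed
  have pS: "p ` S = {c \<in> characters E. same_class a c} - {a}"
    using surj p(1,2) pa by blast
  have fin: "finite (characters E)" "finite (characters (\<theta> ` E))"
    using finite_characters E1(1) E2(1) by auto
  have finS: "finite S" using S(1) fin(2) by simp
  have "\<theta> y \<in> \<theta> ` E" "\<theta> y \<in> derived" using y lie_automorphism_derived[OF \<theta>] by auto
  from class_sum_derived[OF E2 e0 this]
  have "e0 (\<theta> y) + (\<Sum>e\<in>S. e (\<theta> y)) = 0"
    using S(1) e0 fin(2) same_class_refl
      sum.remove[of "{e \<in> characters (\<theta> ` E). same_class e0 e}" e0 "\<lambda>e. e (\<theta> y)"] by simp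
  then have sum1: "(\<Sum>e\<in>S. e (\<theta> y)) = - e0 (\<theta> y)" by (simp add: eq_neg_iff_add_eq_0 add.commute)
  have "a y + (\<Sum>c\<in>p ` S. c y) = 0"
    unfolding pS using class_sum_derived[OF E1 a y] a fin(1) same_class_refl
      sum.remove[of "{c \<in> characters E. same_class a c}" a "\<lambda>c. c y"] by simp
  then have sum2: "(\<Sum>e\<in>S. p e y) = - a y"
    by (simp add: sum.reindex[OF inj] eq_neg_iff_add_eq_0 add.commute)
  have "(\<Sum>e\<in>S. e0 (\<theta> y) - e (\<theta> y)) = (\<Sum>e\<in>S. s * (a y - p e y))"
    using p(3)[OF _ y(1)] by simp
  then have "of_nat (card S) * e0 (\<theta> y) + e0 (\<theta> y) = s * (of_nat (card S) * a y + a y)"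
    by (simp add: sum_subtractf sum1 sum2 sum_distrib_left[symmetric])
  then have "of_nat (Suc (card S)) * e0 (\<theta> y) = of_nat (Suc (card S)) * (s * a y)"
    by (simp add: algebra_simps)
  then show ?thesis by (simp only: mult_cancel_left) (simp del: of_nat_Suc)
qed

text \<open>The roots \<open>e0 - e\<close> with fixed \<open>e0\<close> pairwise differ by roots,
  so the pairs \<open>a e\<close>, \<open>b e\<close> that represent them pairwise share an entry. A
  common first entry gives the sign +, a common second entry the sign -.\<close>

lemma character_pullback:
  assumes \<theta>: "lie_automorphism \<theta>" and E: "self_centralizing E"
    and e0: "e0 \<in> characters (\<theta> ` E)" and y: "y \<in> E" "y \<in> derived"
  shows "\<exists>a\<in>characters E. e0 (\<theta> y) = a y \<or> e0 (\<theta> y) = - a y"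
proof -
  note t = lie_automorphismD[OF \<theta>]
  note E1 = self_centralizingD[OF E]
  note E2 = self_centralizingD[OF self_centralizing_image[OF \<theta> E]]
  define S where "S = {e \<in> characters (\<theta> ` E). same_class e0 e} - {e0}"
  show ?thesis
  proof (cases "S = {}")
    \<comment> \<open>The class sum is \<open>e0\<close> alone, so \<open>e0\<close> vanishes at the
      image of \<open>y\<close>, which forces \<open>y = 0\<close>.\<close>
    case True
    then have "{e \<in> characters (\<theta> ` E). same_class e0 e} = {e0}"
      using e0 same_class_refl unfolding S_def by blast
    then have "e0 (\<theta> y) = 0"
      using class_sum_derived[OF E2 e0 _ lie_automorphism_derived[OF \<theta> y(2)]] y(1) by simp
    then have "\<theta> y = 0"
      using character_eq_0_iff[OF commutative_subfieldD(1)[OF E2(1)] e0] y(1) by simp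
    then have "y = 0" using t(5,6) by metis
    moreover obtain a where "a \<in> characters E" using characters_nonempty[OF E1(1)] by blast
    ultimately show ?thesis using charactersD(6) t(5) charactersD(6)[OF e0] by force
  next
    case False
    have "\<forall>e\<in>S. \<exists>ab. fst ab \<in> characters E \<and> snd ab \<in> characters E \<and> same_class (fst ab) (snd ab) \<and>
      (\<forall>y\<in>E. e0 (\<theta> y) - e (\<theta> y) = fst ab y - snd ab y)"
      using root_transfer[OF \<theta> E e0] unfolding S_def by fastforce
    from bchoice[OF this] obtain ab where ab: "\<forall>e\<in>S. fst (ab e) \<in> characters E \<and>
      snd (ab e) \<in> characters E \<and> same_class (fst (ab e)) (snd (ab e)) \<and>
      (\<forall>y\<in>E. e0 (\<theta> y) - e (\<theta> y) = fst (ab e) y - snd (ab e) y)" by blast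
    define a b where "a = (\<lambda>e. fst (ab e))" and "b = (\<lambda>e. snd (ab e))"
    have ab: "a e \<in> characters E" "b e \<in> characters E" "same_class (a e) (b e)"
      "\<And>y. y \<in> E \<Longrightarrow> e0 (\<theta> y) - e (\<theta> y) = a e y - b e y" if "e \<in> S" for e
      using ab that unfolding a_def b_def by blast+
    have SX: "e \<in> characters (\<theta> ` E)" "same_class e0 e" "e \<noteq> e0" if "e \<in> S" for e
      using that S_def by auto
    have ne: "a e \<noteq> b e" if e: "e \<in> S" for e
    proof
      assume "a e = b e"
      then have "e0 x = e x" if "x \<in> \<theta> ` E" for x using ab(4)[OF e] that by force
      then show False using characters_eqI[OF e0 SX(1)[OF e]] SX(3)[OF e] by blast
    qed
    have share: "a e = a e' \<or> b e = b e'" if e: "e \<in> S" "e' \<in> S" for e e'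
    proof -
      have "same_class e' e" using SX(2) e same_class_sym same_class_trans by metis
      then obtain r r' where r: "r \<in> characters E" "r' \<in> characters E"
        "\<And>y. y \<in> E \<Longrightarrow> e' (\<theta> y) - e (\<theta> y) = r y - r' y"
        using root_transfer[OF \<theta> E SX(1)[OF e(2)] SX(1)[OF e(1)]] by blast
      show ?thesis
      proof (rule four_characters[OF E1(1) ab(1,2)[OF e(1)] ab(1,2)[OF e(2)] r(1,2) _ ne[OF e(1)] ne[OF e(2)]])
        fix y assume "y \<in> E"
        then show "a e y - b e y - (a e' y - b e' y) = r y - r' y"
          by (simp flip: ab(4)[OF e(1)] ab(4)[OF e(2)] r(3))
      qed
    qed
    obtain e1 where e1: "e1 \<in> S" using False by blast
    \<comment> \<open>Sharing with \<open>e1\<close> cannot be mixed: if \<open>e\<close> differed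
      from \<open>e1\<close> in the first entry and \<open>e'\<close> in the second, then
      \<open>e\<close> and \<open>e'\<close> would share neither.\<close>
    have "(\<forall>e\<in>S. a e = a e1) \<or> (\<forall>e\<in>S. b e = b e1)" using share e1 by metis
    then show ?thesis
    proof
      assume h: "\<forall>e\<in>S. a e = a e1"
      have "e0 (\<theta> y) = 1 * a e1 y"
      proof (rule star_sum[OF \<theta> E e0 ab(1)[OF e1] _ S_def False, where p = b])
        fix e assume e: "e \<in> S"
        then have ae: "a e1 = a e" using h by simp
        show "b e \<in> characters E" "same_class (a e1) (b e)" unfolding ae using ab[OF e] by auto
        show "e0 (\<theta> y) - e (\<theta> y) = 1 * (a e1 y - b e y)" if "y \<in> E" for y
          unfolding ae using ab(4)[OF e that] by simp
      qed (use y in auto)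
      then show ?thesis using ab(1)[OF e1] by auto
    next
      assume h: "\<forall>e\<in>S. b e = b e1"
      have "e0 (\<theta> y) = - 1 * b e1 y"
      proof (rule star_sum[OF \<theta> E e0 ab(2)[OF e1] _ S_def False, where p = a])
        fix e assume e: "e \<in> S"
        then have be: "b e1 = b e" using h by simp
        show "a e \<in> characters E" "same_class (b e1) (a e)"
          unfolding be using ab[OF e] same_class_sym by auto
        show "e0 (\<theta> y) - e (\<theta> y) = - 1 * (b e1 y - a e y)" if "y \<in> E" for y
          unfolding be using ab(4)[OF e that] by simp
      qed (use y in auto)
      then show ?thesis using ab(2)[OF e1] by auto
    qed
  qed
qed

lemma character_minus:
  assumes "division_subring E" "e \<in> characters E" "x \<in> E"
  shows "e (- x) = - e x"
  using charactersD(1)[OF assms(2,3) division_subringD(7)[OF assms(1,3)]] charactersD(6)[OF assms(2)]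
  by (simp add: eq_neg_iff_add_eq_0 add.commute)

text \<open>One character \<open>e\<close> suffices because characters are injective: it sends
  \<theta> x or its negative to \<open>a x\<close>, a root of \<open>q\<close>, so the value of
  \<open>q\<close> there is killed by \<open>e\<close> and hence zero.\<close>

lemma lie_automorphism_root:
  assumes \<theta>: "lie_automorphism \<theta>" and x: "x \<in> derived" and q: "peval q x = 0"
  shows "peval q (\<theta> x) = 0 \<or> peval q (- \<theta> x) = 0"
proof -
  obtain E where E: "self_centralizing E" "x \<in> E" using self_centralizing_exists by blast
  note E1 = self_centralizingD[OF E(1)] commutative_subfieldD(1)[OF self_centralizingD(1)[OF E(1)]]
  have E2: "commutative_subfield (\<theta> ` E)"
    using self_centralizingD[OF self_centralizing_image[OF \<theta> E(1)]] by blast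
  note E2d = commutative_subfieldD(1)[OF E2]
  obtain e where e: "e \<in> characters (\<theta> ` E)" using characters_nonempty[OF E2] by blast
  obtain a where a: "a \<in> characters E" "e (\<theta> x) = a x \<or> e (\<theta> x) = - a x"
    using character_pullback[OF \<theta> E(1) e E(2) x] by blast
  have t: "\<theta> x \<in> \<theta> ` E" "- \<theta> x \<in> \<theta> ` E" using E(2) division_subringD(7)[OF E2d] by auto
  have "poly (map_poly to_ac q) (a x) = 0"
    using character_peval[OF E1(3) a(1) E(2), of q] q charactersD(6)[OF a(1)] by simp
  moreover have "e (\<theta> x) = a x \<or> e (- \<theta> x) = a x"
    using a(2) character_minus[OF E2d e t(1)] by auto
  ultimately have "e (peval q (\<theta> x)) = 0 \<or> e (peval q (- \<theta> x)) = 0"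
    using character_peval[OF E2d e t(1), of q] character_peval[OF E2d e t(2), of q] by auto
  then show ?thesis using character_eq_0_iff[OF E2d e] peval_in[OF E2d] t by blast
qed

end

subsection \<open>The p-adic integers\<close>

lift_definition residue :: "'p::prime_card padic_int \<Rightarrow> nat \<Rightarrow> int" is "\<lambda>x k. x k" .

lemma residue_bounds: "0 \<le> residue z k" "residue (z :: 'p::prime_card padic_int) k < int CARD('p) ^ k"
  by (transfer, blast)+

lemma residue_coherent: "residue (z :: 'p::prime_card padic_int) (i + j) mod int CARD('p) ^ i = residue z i"
  by transfer (rule padic_coherent)

lemma residue_mod [simp]:
  "i \<le> j \<Longrightarrow> residue (z :: 'p::prime_card padic_int) j mod int CARD('p) ^ i = residue z i"
  using residue_coherent[of z i "j - i"] by simp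

lemma residue_eqI: "(\<And>k. residue x k = residue y k) \<Longrightarrow> x = y"
  by transfer auto

lemma residue_0 [simp]: "residue 0 k = 0"
  by transfer simp

lemma residue_at_0 [simp]: "residue z 0 = 0"
  using residue_bounds[of z 0] by simp

lemma residue_add:
  "residue (x + y :: 'p::prime_card padic_int) k = (residue x k + residue y k) mod int CARD('p) ^ k"
  by transfer simp

lemma residue_diff:
  "residue (x - y :: 'p::prime_card padic_int) k = (residue x k - residue y k) mod int CARD('p) ^ k"
  by transfer simp

lemma residue_mult:
  "residue (x * y :: 'p::prime_card padic_int) k = (residue x k * residue y k) mod int CARD('p) ^ k"
  by transfer simp

lemma residue_1: "residue (1 :: 'p::prime_card padic_int) k = 1 mod int CARD('p) ^ k"
  by transfer simp

lemma residue_of_nat: "residue (of_nat n :: 'p::prime_card padic_int) k = int n mod int CARD('p) ^ k"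
  by (induction n) (auto simp: residue_add residue_1 mod_simps add.commute)

lemma residue_power:
  "residue (of_nat CARD('p) ^ j :: 'p::prime_card padic_int) k = int CARD('p) ^ j mod int CARD('p) ^ k"
  using residue_of_nat[of "CARD('p) ^ j" k, where 'p = 'p] by simp

lemma residue_exists:
  assumes "\<And>k. 0 \<le> f k \<and> f k < int CARD('p::prime_card) ^ k \<and> f (Suc k) mod int CARD('p) ^ k = f k"
  shows "\<exists>z :: 'p padic_int. \<forall>k. residue z k = f k"
  by (intro exI[of _ "Abs_padic_int f"]) (use assms in \<open>simp add: residue.rep_eq Abs_padic_int_inverse\<close>)

lemma card_gt_1: "int CARD('p::prime_card) > 1"
  by (rule prime_gt_1_int[OF prime_card_int])

lemma padic_of_nat_eq_0_iff: "of_nat n = (0 :: 'p::prime_card padic_int) \<longleftrightarrow> n = 0"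
proof
  assume "of_nat n = (0 :: 'p padic_int)"
  then have "int n mod int CARD('p) ^ n = 0" using residue_of_nat[of n n, where 'p = 'p] by simp
  \<comment> \<open>Level \<open>n\<close> is deep enough to see \<open>n\<close> itself.\<close>
  moreover have "int n < int CARD('p) ^ n"
  proof -
    have "CARD('p) > 1" using card_gt_1[where 'p = 'p] by simp
    then have "n < CARD('p) ^ n" by (intro power_gt_expt) simp
    then show ?thesis by (metis of_nat_less_iff of_nat_power)
  qed
  ultimately show "n = 0" by simp
qed simp

text \<open>Characteristic 0 passes from here to the fraction field, as
  \<open>fd_division_algebra_0\<close> demands of its base field.\<close>

instance padic_int :: (prime_card) ring_char_0
proof
  show "inj (of_nat :: nat \<Rightarrow> 'a padic_int)"
  proof (rule injI)
    have "m = n" if "of_nat m = (of_nat n :: 'a padic_int)" "m \<le> n" for m n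
      using that padic_of_nat_eq_0_iff[of "n - m", where 'p = 'a] by (simp add: of_nat_diff)
    then show "m = n" if "of_nat m = (of_nat n :: 'a padic_int)" for m n
      using that by (metis linear)
  qed
qed

instance fract :: ("{idom, ring_char_0}") field_char_0
proof
  show "inj (of_nat :: nat \<Rightarrow> 'a fract)"
    by (rule injI) (simp add: of_nat_fract eq_fract)
qed

text \<open>The quotient takes at level \<open>j\<close> the residue of \<open>z\<close> at level
  \<open>j + k\<close>, divided by the power of the prime; the shift of levels makes up for the lost
  precision.\<close>

lemma residue_eq_0_imp_multiple:
  assumes "residue (z :: 'p::prime_card padic_int) k = 0"
  shows "\<exists>w. z = of_nat CARD('p) ^ k * w"
proof -
  let ?P = "int CARD('p)"
  have P: "?P > 0" by (rule padic_pos)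
  have dvd: "residue z (j + k) mod ?P ^ k = 0" for j using assms by (simp add: residue_mod)
  define f where "f = (\<lambda>j. residue z (j + k) div ?P ^ k)"
  have f_mult: "?P ^ k * f j = residue z (j + k)" for j
    unfolding f_def using dvd[of j] by (metis dvd_eq_mod_eq_0 dvd_mult_div_cancel)
  have "0 \<le> f j \<and> f j < ?P ^ j \<and> f (Suc j) mod ?P ^ j = f j" for j
  proof (intro conjI)
    show "0 \<le> f j" unfolding f_def using P residue_bounds(1) by (intro pos_imp_zdiv_nonneg_iff[THEN iffD2]) auto
    have "?P ^ k * f j < ?P ^ k * ?P ^ j"
      unfolding f_mult using residue_bounds(2)[of z "j + k"] by (simp add: power_add mult.commute)
    then show "f j < ?P ^ j" using P by simp
    have "?P ^ k * (f (Suc j) mod ?P ^ j) = (?P ^ k * f (Suc j)) mod (?P ^ k * ?P ^ j)"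
      by (rule mult_mod_right)
    also have "\<dots> = residue z (Suc j + k) mod ?P ^ (j + k)"
      unfolding f_mult by (simp add: power_add mult.commute)
    also have "\<dots> = ?P ^ k * f j" by (simp add: f_mult)
    finally show "f (Suc j) mod ?P ^ j = f j" using P by simp
  qed
  then obtain w :: "'p padic_int" where w: "\<And>j. residue w j = f j" using residue_exists[of f] by metis
  have "z = of_nat CARD('p) ^ k * w"
  proof (rule residue_eqI)
    fix j
    have "residue (of_nat CARD('p) ^ k * w) j = ?P ^ k * f j mod ?P ^ j"
      by (simp only: residue_mult residue_power w mod_mult_left_eq)
    then show "residue z j = residue (of_nat CARD('p) ^ k * w) j" by (simp add: f_mult)
  qed
  then show ?thesis by blast
qed

lemma residue_multiple: "residue (of_nat CARD('p::prime_card) ^ k * w :: 'p padic_int) k = 0"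
proof -
  have "residue (of_nat CARD('p) ^ k * w) k = (int CARD('p) ^ k * residue w k) mod int CARD('p) ^ k"
    by (simp only: residue_mult residue_power mod_mult_left_eq)
  then show ?thesis by simp
qed

text \<open>Inverses modulo each power of the prime are found separately; they are coherent because
  an inverse modulo a fixed power is unique.\<close>

lemma residue_unit:
  assumes "residue (z :: 'p::prime_card padic_int) 1 \<noteq> 0"
  shows "\<exists>w. z * w = 1"
proof -
  let ?P = "int CARD('p)"
  have P: "?P > 0" by (rule padic_pos)
  have cop: "coprime (residue z j) (?P ^ j)" for j
  proof (cases "j = 0")
    case False
    have "\<not> ?P dvd residue z j"
      using residue_mod[of 1 j z] False assms by (auto simp: dvd_eq_mod_eq_0)
    then have "coprime ?P (residue z j)" by (rule prime_imp_coprime[OF prime_card_int])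
    then show ?thesis by (simp add: coprime_commute)
  qed simp
  have "\<exists>x. [residue z j * x = 1] (mod ?P ^ j)" for j by (rule cong_solve_coprime_int[OF cop])
  then obtain g where g: "\<And>j. [residue z j * g j = 1] (mod ?P ^ j)" by metis
  define f where "f = (\<lambda>j. g j mod ?P ^ j)"
  have f: "[residue z j * f j = 1] (mod ?P ^ j)" for j
    using g[of j] by (simp add: f_def cong_def mod_simps)
  have "0 \<le> f j \<and> f j < ?P ^ j \<and> f (Suc j) mod ?P ^ j = f j" for j
  proof -
    have "[residue z (Suc j) * f (Suc j) = 1] (mod ?P ^ j)"
      using f[of "Suc j"] by (rule cong_dvd_modulus) simp
    moreover have "[residue z (Suc j) = residue z j] (mod ?P ^ j)"
      using residue_mod[of j "Suc j" z] residue_mod[of j j z] by (simp add: cong_def)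
    ultimately have "[residue z j * f (Suc j) = residue z j * f j] (mod ?P ^ j)"
      using f[of j] by (metis cong_scalar_right cong_sym cong_trans)
    then have "[f (Suc j) = f j] (mod ?P ^ j)" using cong_mult_lcancel[OF cop] by blast
    then show ?thesis using P by (simp add: f_def cong_def)
  qed
  then obtain w :: "'p padic_int" where w: "\<And>j. residue w j = f j" using residue_exists[of f] by metis
  have "z * w = 1"
    by (rule residue_eqI) (use f in \<open>simp add: residue_mult residue_1 w cong_def\<close>)
  then show ?thesis by blast
qed

lemma padic_factorization:
  assumes "(z :: 'p::prime_card padic_int) \<noteq> 0"
  shows "\<exists>k u v. z = of_nat CARD('p) ^ k * u \<and> u * v = 1"
proof -
  obtain j where "residue z j \<noteq> 0" using assms residue_eqI[of z 0] by auto
  then have ex: "\<exists>j. residue z (Suc j) \<noteq> 0" by (cases j) auto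
  \<comment> \<open>Residues at level 0 are always 0, so the search starts at level 1.\<close>
  define k where "k = (LEAST j. residue z (Suc j) \<noteq> 0)"
  have k: "residue z (Suc k) \<noteq> 0" unfolding k_def by (rule LeastI_ex[OF ex])
  have "residue z k = 0"
  proof (cases k)
    case (Suc i)
    then show ?thesis using not_less_Least[of i "\<lambda>j. residue z (Suc j) \<noteq> 0"] k_def by auto
  qed simp
  then obtain u where u: "z = of_nat CARD('p) ^ k * u" using residue_eq_0_imp_multiple by blast
  have "residue u 1 \<noteq> 0"
  proof
    assume "residue u 1 = 0"
    then obtain w where "u = of_nat CARD('p) ^ 1 * w" using residue_eq_0_imp_multiple by blast
    then have "z = of_nat CARD('p) ^ Suc k * w" using u by (simp add: mult.assoc mult.left_commute)
    then show False using k residue_multiple by metis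
  qed
  then show ?thesis using residue_unit u by blast
qed

lemma padic_of_int_hom [simp]:
  "padic_of_int 0 = 0" "padic_of_int 1 = 1" "padic_of_int (x + y) = padic_of_int x + padic_of_int y"
  "padic_of_int (x * y) = padic_of_int x * padic_of_int y"
  "padic_of_int (x - y) = padic_of_int x - padic_of_int y" "padic_of_int (- x) = - padic_of_int x"
  by (simp_all add: padic_of_int_def Zero_fract_def One_fract_def)

lemma padic_of_int_eq_iff [simp]: "padic_of_int x = padic_of_int y \<longleftrightarrow> x = y"
  by (simp add: padic_of_int_def eq_fract)

lemma padic_of_int_eq_0_iff [simp]: "padic_of_int x = 0 \<longleftrightarrow> x = 0"
  using padic_of_int_eq_iff[of x 0] by simp

lemma padic_of_int_of_nat [simp]: "padic_of_int (of_nat n) = of_nat n"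
  by (induction n) auto

lemma padic_of_int_power [simp]: "padic_of_int (x ^ n) = padic_of_int x ^ n"
  by (induction n) auto

definition padic_integers :: "'p::prime_card padic set" where
  "padic_integers = range padic_of_int"

lemma padic_integersI [simp]: "padic_of_int z \<in> padic_integers"
  by (simp add: padic_integers_def)

lemma padic_integersE: "a \<in> padic_integers \<Longrightarrow> (\<And>z. a = padic_of_int z \<Longrightarrow> P) \<Longrightarrow> P"
  unfolding padic_integers_def by blast

lemma padic_integers_closed:
  assumes "a \<in> padic_integers" "b \<in> padic_integers"
  shows "a + b \<in> padic_integers" "a * b \<in> padic_integers" "a - b \<in> padic_integers"
  using assms unfolding padic_integers_def
  by (auto simp flip: padic_of_int_hom)

lemma of_nat_in_padic_integers [simp]: "of_nat n \<in> padic_integers"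
  using padic_integersI[of "of_nat n"] by simp

lemma padic_integers_power: "a \<in> padic_integers \<Longrightarrow> a ^ k \<in> padic_integers"
  by (elim padic_integersE) (simp flip: padic_of_int_power)

lemma card_padic_nonzero: "(of_nat CARD('p) :: 'p::prime_card padic) \<noteq> 0"
  using card_gt_1[where 'p = 'p] by simp

text \<open>Numerator and denominator are units times powers of the prime, so failure of integrality
  means that the power in the denominator is strictly larger.\<close>

lemma padic_dichotomy:
  fixes a :: "'p::prime_card padic"
  assumes "a \<notin> padic_integers"
  shows "\<exists>z. inverse a = of_nat CARD('p) * padic_of_int z"
proof -
  obtain x y where xy: "y \<noteq> 0" "a = Fract x y" by (cases a) auto
  have a: "a = padic_of_int x / padic_of_int y"
    using xy by (simp add: padic_of_int_def)
  have "x \<noteq> 0" using a assms padic_integersI[of 0] by auto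
  then obtain i u u' where u: "x = of_nat CARD('p) ^ i * u" "u * u' = 1"
    using padic_factorization by blast
  obtain j v v' where v: "y = of_nat CARD('p) ^ j * v" "v * v' = 1"
    using padic_factorization[OF xy(1)] by blast
  have uv: "padic_of_int u * padic_of_int u' = 1" "padic_of_int v * padic_of_int v' = 1"
    using u(2) v(2) by (simp_all flip: padic_of_int_hom)
  then have inv: "inverse (padic_of_int u) = padic_of_int u'" "inverse (padic_of_int v) = padic_of_int v'"
    by (simp_all add: inverse_unique)
  have "inverse (padic_of_int v') = padic_of_int v"
    using uv(2) by (intro inverse_unique) (simp add: mult.commute)
  note inv = inv this
  let ?p = "of_nat CARD('p) :: 'p padic"
  have "i < j"
  proof (rule ccontr)
    assume "\<not> i < j"
    then have "a = ?p ^ (i - j) * padic_of_int (u * v')"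
      using card_padic_nonzero[where 'p = 'p]
      by (simp add: a u(1) v(1) divide_inverse inv power_diff)
    then have "a = padic_of_int (of_nat CARD('p) ^ (i - j) * (u * v'))" by simp
    then have "a \<in> padic_integers" by (simp only: padic_integersI)
    then show False using assms by blast
  qed
  then have "inverse a = ?p ^ (j - i) * padic_of_int (v * u')"
    using card_padic_nonzero[where 'p = 'p]
    by (simp add: a u(1) v(1) divide_inverse inv power_diff)
  also have "j - i = Suc (j - i - 1)" using \<open>i < j\<close> by simp
  finally have "inverse a = ?p * padic_of_int (of_nat CARD('p) ^ (j - i - 1) * (v * u'))"
    by (simp only: power_Suc padic_of_int_hom padic_of_int_power padic_of_int_of_nat mult.assoc)
  then show ?thesis by blast
qed

lemma padic_denominator:
  fixes a :: "'p::prime_card padic"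
  shows "\<exists>k. of_nat CARD('p) ^ k * a \<in> padic_integers"
proof -
  obtain x y where xy: "y \<noteq> 0" "a = Fract x y" by (cases a) auto
  have a: "a = padic_of_int x / padic_of_int y"
    using xy by (simp add: padic_of_int_def)
  obtain j v v' where v: "y = of_nat CARD('p) ^ j * v" "v * v' = 1"
    using padic_factorization[OF xy(1)] by blast
  have "padic_of_int v * padic_of_int v' = 1"
    using v(2) by (simp flip: padic_of_int_hom)
  then have "inverse (padic_of_int v) = padic_of_int v'" by (simp add: inverse_unique)
  then have "of_nat CARD('p) ^ j * a = padic_of_int (x * v')"
    using card_padic_nonzero[where 'p = 'p] by (simp add: a v(1) divide_inverse)
  then show ?thesis by (metis padic_integersI)
qed

lemma padic_integers_mono:
  fixes a :: "'p::prime_card padic"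
  assumes "of_nat CARD('p) ^ k * a \<in> padic_integers" "k \<le> l"
  shows "of_nat CARD('p) ^ l * a \<in> padic_integers"
proof -
  have "of_nat CARD('p) ^ l * a = of_nat (CARD('p) ^ (l - k)) * (of_nat CARD('p) ^ k * a)"
    using assms(2) by (simp add: mult.assoc[symmetric] power_add[symmetric])
  then show ?thesis using padic_integers_closed(2)[OF of_nat_in_padic_integers assms(1)] by metis
qed

text \<open>Comparison of valuations in the form in which the later arguments about norms
  end.\<close>

lemma not_divisible_padic:
  assumes "of_nat CARD('p::prime_card) ^ k = (of_nat CARD('p) ^ l * padic_of_int z :: 'p padic)"
  shows "l \<le> k"
proof (rule ccontr)
  assume "\<not> l \<le> k"
  have "padic_of_int (of_nat CARD('p) ^ k) = (padic_of_int (of_nat CARD('p) ^ l * z) :: 'p padic)"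
    using assms by simp
  then have "(of_nat CARD('p) ^ k :: 'p padic_int) = of_nat CARD('p) ^ l * z"
    by (simp only: padic_of_int_eq_iff)
  then have "residue (of_nat CARD('p) ^ k :: 'p padic_int) l = 0"
    using residue_multiple[of l z] by simp
  moreover have "int CARD('p) ^ k < int CARD('p) ^ l"
    using \<open>\<not> l \<le> k\<close> card_gt_1[where 'p = 'p] by (intro power_strict_increasing) auto
  ultimately show False using padic_pos[where 'p = 'p] by (simp add: residue_power)
qed

text \<open>Sequential compactness by a diagonal argument: each level admits only finitely many
  residue vectors, so a subsequence is constant there. Coherence of the limit is checked on members
  of the diagonal sequence that lie in the tails of two consecutive levels.\<close>

lemma padic_compact:
  fixes f :: "nat \<Rightarrow> 'i \<Rightarrow> 'p::prime_card padic_int"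
  assumes I: "finite I"
  shows "\<exists>r (L :: 'i \<Rightarrow> 'p padic_int). strict_mono (r :: nat \<Rightarrow> nat) \<and>
    (\<forall>k. \<exists>n0. \<forall>n\<ge>n0. \<forall>i\<in>I. residue (f (r n) i) k = residue (L i) k)"
proof -
  let ?P = "\<lambda>k s. \<exists>c. \<forall>n. \<forall>i\<in>I. residue (f (s n) i) k = c i"
  interpret subseqs ?P
  proof
    fix k and s :: "nat \<Rightarrow> nat" assume "strict_mono s"
    let ?g = "\<lambda>n. restrict (\<lambda>i. residue (f (s n) i) k) I"
    have "range ?g \<subseteq> PiE I (\<lambda>_. {0..<int CARD('p) ^ k})"
      using residue_bounds by auto
    moreover have "finite (PiE I (\<lambda>_. {0..<int CARD('p) ^ k}))" using I by (intro finite_PiE) auto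
    ultimately have "finite (range ?g)" by (rule finite_subset)
    then obtain n0 where inf: "infinite {n. ?g n = ?g n0}"
      using pigeonhole_infinite[of UNIV ?g] by auto
    from infinite_enumerate[OF inf] obtain r :: "nat \<Rightarrow> nat" where
      r: "strict_mono r" "\<forall>n. r n \<in> {n. ?g n = ?g n0}" by blast
    have "residue (f (s (r n)) i) k = residue (f (s n0) i) k" if "i \<in> I" for n i
    proof -
      have "?g (r n) = ?g n0" using r(2) by blast
      from fun_cong[OF this, of i] show ?thesis using that by simp
    qed
    then have "?P k (s \<circ> r)" by (intro exI[of _ "\<lambda>i. residue (f (s n0) i) k"]) auto
    then show "\<exists>r' :: nat \<Rightarrow> nat. strict_mono r' \<and> ?P k (s \<circ> r')" using r(1) by (intro exI[of _ r] conjI)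
  qed
  \<comment> \<open>Level \<open>k\<close> is settled for the diagonal sequence from index
    \<open>Suc k\<close> on.\<close>
  have "?P k (diagseq \<circ> (+) (Suc k))" for k
    by (rule diagseq_holds) auto
  then have "\<forall>k. \<exists>c. \<forall>n. \<forall>i\<in>I. residue (f (diagseq (Suc k + n)) i) k = c i"
    unfolding o_def by (intro allI)
  from choice[OF this] obtain c
    where c: "\<And>k n i. i \<in> I \<Longrightarrow> residue (f (diagseq (Suc k + n)) i) k = c k i" by blast
  have "\<exists>z :: 'p padic_int. \<forall>k. residue z k = c k i" if i: "i \<in> I" for i
  proof (rule residue_exists)
    fix k
    let ?z = "f (diagseq (Suc (Suc k))) i"
    have "c (Suc k) i = residue ?z (Suc k)" "c k i = residue ?z k"
      using c[OF i, of "Suc k" 0] c[OF i, of k 1] by simp_all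
    then show "0 \<le> c k i \<and> c k i < int CARD('p) ^ k \<and> c (Suc k) i mod int CARD('p) ^ k = c k i"
      using residue_bounds[of ?z k] residue_mod[of k "Suc k" ?z] by simp
  qed
  then have "\<forall>i\<in>I. \<exists>z :: 'p padic_int. \<forall>k. residue z k = c k i" by blast
  from bchoice[OF this] obtain L :: "'i \<Rightarrow> 'p padic_int"
    where L: "\<And>i k. i \<in> I \<Longrightarrow> residue (L i) k = c k i" by blast
  have "\<exists>n0. \<forall>n\<ge>n0. \<forall>i\<in>I. residue (f (diagseq n) i) k = residue (L i) k" for k
  proof (intro exI allI impI ballI)
    fix n i assume "n \<ge> Suc k" "i \<in> I"
    then show "residue (f (diagseq n) i) k = residue (L i) k"
      using c[of i k "n - Suc k"] L by simp
  qed
  then show ?thesis using subseq_diagseq by (intro exI[of _ diagseq] exI[of _ L] conjI allI)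
qed

subsection \<open>Lattices in division algebras over the p-adic numbers\<close>

lemma common_denominator:
  fixes A :: "'p::prime_card padic set"
  assumes "finite A"
  shows "\<exists>k. \<forall>a\<in>A. of_nat CARD('p) ^ k * a \<in> padic_integers"
  using assms
proof (induction A rule: finite_induct)
  case (insert a A)
  then obtain k where k: "\<forall>a\<in>A. of_nat CARD('p) ^ k * a \<in> padic_integers" by blast
  obtain l where l: "of_nat CARD('p) ^ l * a \<in> padic_integers" using padic_denominator by blast
  have "\<forall>b\<in>insert a A. of_nat CARD('p) ^ (max k l) * b \<in> padic_integers"
    using k padic_integers_mono[OF l max.cobounded2] padic_integers_mono[OF _ max.cobounded1] by blast
  then show ?case by blast
qed simp

lemma zero_in_padic_integers [simp]: "(0 :: 'p::prime_card padic) \<in> padic_integers"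
  using padic_integersI[of "0 :: 'p padic_int"] by simp

lemma padic_integers_sum: "(\<And>i. i \<in> I \<Longrightarrow> f i \<in> padic_integers) \<Longrightarrow> sum f I \<in> padic_integers"
  by (induction I rule: infinite_finite_induct)
     (auto simp: padic_integers_closed(1))

locale padic_division_algebra = fd_division_algebra_0 scale
  for scale :: "'p::prime_card padic \<Rightarrow> 'd::division_ring \<Rightarrow> 'd"
begin

definition prm :: 'd where "prm = of_nat CARD('p)"

lemma scale_of_nat: "scale (of_nat n) x = of_nat n * x"
proof -
  have "scale (of_nat n) 1 = (of_nat n :: 'd)" by (induction n) (auto simp: scale_left_distrib)
  then show ?thesis using scale_eq_mult by metis
qed

lemma prm_power_mult: "prm ^ k * x = scale (of_nat CARD('p) ^ k) x"
  using scale_of_nat[of "CARD('p) ^ k" x] by (simp add: prm_def)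

lemma prm_commute: "prm ^ k * x = x * prm ^ k"
  by (simp add: prm_def mult_of_nat_commute flip: of_nat_power)

lemma prm_power_nonzero: "prm ^ k \<noteq> 0"
  using prm_power_mult[of k 1] card_padic_nonzero[where 'p = 'p] by simp

end

text \<open>\<open>\<kappa> b\<close> is the coordinate at the basis vector \<open>v b\<close>.
  Integral structure constants make \<open>lattice\<close> closed under products, but 1 need not
  belong to it; hence the exponents below that bring a multiple of 1 into
  \<open>lattice\<close>.\<close>

locale padic_lattice = padic_division_algebra scale
  for scale :: "'p::prime_card padic \<Rightarrow> 'd::division_ring \<Rightarrow> 'd" +
  fixes B :: "'d set" and v :: "'d \<Rightarrow> 'd" and \<kappa> :: "'d \<Rightarrow> 'd \<Rightarrow> 'p padic"
  assumes finite_B: "finite B"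
    and \<kappa>_add: "\<kappa> b (x + y) = \<kappa> b x + \<kappa> b y"
    and \<kappa>_scale: "\<kappa> b (scale a x) = a * \<kappa> b x"
    and \<kappa>_expand: "x = (\<Sum>b\<in>B. scale (\<kappa> b x) (v b))"
    and \<kappa>_v: "b \<in> B \<Longrightarrow> c \<in> B \<Longrightarrow> \<kappa> b (v c) = (if b = c then 1 else 0)"
    and v_mult: "b \<in> B \<Longrightarrow> c \<in> B \<Longrightarrow> d \<in> B \<Longrightarrow> \<kappa> b (v c * v d) \<in> padic_integers"
begin

definition lattice :: "'d set" where
  "lattice = {x. \<forall>b\<in>B. \<kappa> b x \<in> padic_integers}"

lemma \<kappa>_0: "\<kappa> b 0 = 0"
  using \<kappa>_scale[of b 0 "0 :: 'd"] by simp

lemma \<kappa>_sum: "\<kappa> b (sum f I) = (\<Sum>i\<in>I. \<kappa> b (f i))"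
  by (induction I rule: infinite_finite_induct) (auto simp: \<kappa>_0 \<kappa>_add)

lemma \<kappa>_mult: "\<kappa> a (x * y) = (\<Sum>b\<in>B. \<Sum>c\<in>B. \<kappa> b x * \<kappa> c y * \<kappa> a (v b * v c))"
proof -
  have "x * y = (\<Sum>b\<in>B. scale (\<kappa> b x) (v b)) * (\<Sum>c\<in>B. scale (\<kappa> c y) (v c))"
    by (simp only: \<kappa>_expand[of x, symmetric] \<kappa>_expand[of y, symmetric])
  also have "\<dots> = (\<Sum>b\<in>B. \<Sum>c\<in>B. scale (\<kappa> b x * \<kappa> c y) (v b * v c))"
    by (simp add: sum_product scale_mult_left mult_scale_right mult.commute)
  finally show ?thesis by (simp add: \<kappa>_sum \<kappa>_scale)
qed

lemma lattice_0: "0 \<in> lattice"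
  by (simp add: lattice_def \<kappa>_0)

lemma lattice_add: "x \<in> lattice \<Longrightarrow> y \<in> lattice \<Longrightarrow> x + y \<in> lattice"
  by (simp add: lattice_def \<kappa>_add padic_integers_closed)

lemma lattice_scale: "x \<in> lattice \<Longrightarrow> a \<in> padic_integers \<Longrightarrow> scale a x \<in> lattice"
  by (simp add: lattice_def \<kappa>_scale padic_integers_closed)

lemma lattice_minus: "x \<in> lattice \<Longrightarrow> - x \<in> lattice"
  using lattice_scale[of x "- 1"] padic_integers_closed(3)[OF of_nat_in_padic_integers of_nat_in_padic_integers, of 0 1]
  by simp

lemma lattice_mult:
  assumes x: "x \<in> lattice" and y: "y \<in> lattice"
  shows "x * y \<in> lattice"
proof -
  have "\<kappa> a (x * y) \<in> padic_integers" if a: "a \<in> B" for a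
    by (subst \<kappa>_mult) (use x y v_mult[OF a] in
      \<open>auto simp: lattice_def intro!: padic_integers_sum padic_integers_closed(2)\<close>)
  then show ?thesis by (simp add: lattice_def)
qed

lemma lattice_sum: "(\<And>i. i \<in> I \<Longrightarrow> f i \<in> lattice) \<Longrightarrow> sum f I \<in> lattice"
  by (induction I rule: infinite_finite_induct) (auto simp: lattice_0 lattice_add)

lemma lattice_of_nat: "x \<in> lattice \<Longrightarrow> of_nat n * x \<in> lattice"
  using lattice_scale[of x "of_nat n"] by (simp add: scale_of_nat)

lemma lattice_prm: "x \<in> lattice \<Longrightarrow> prm ^ k * x \<in> lattice"
  using lattice_of_nat[of x "CARD('p) ^ k"] by (simp add: prm_def)

lemma lattice_prm_mono:
  assumes "prm ^ k * x \<in> lattice" "k \<le> l"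
  shows "prm ^ l * x \<in> lattice"
proof -
  have "prm ^ l * x = prm ^ (l - k) * (prm ^ k * x)"
    using assms(2) by (simp add: mult.assoc[symmetric] power_add[symmetric])
  then show ?thesis using lattice_prm[OF assms(1), of "l - k"] by (simp only:)
qed

lemma lattice_absorbs: "\<exists>k. prm ^ k * x \<in> lattice"
proof -
  obtain k where "\<forall>a\<in>(\<lambda>b. \<kappa> b x) ` B. of_nat CARD('p) ^ k * a \<in> padic_integers"
    using common_denominator[OF finite_imageI[OF finite_B]] by blast
  then have "prm ^ k * x \<in> lattice" by (simp add: lattice_def prm_power_mult \<kappa>_scale)
  then show ?thesis by blast
qed

lemma lattice_absorbs_finite:
  assumes "finite A"
  shows "\<exists>k. \<forall>x\<in>A. prm ^ k * x \<in> lattice"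
  using assms
proof (induction A rule: finite_induct)
  case (insert a A)
  then obtain k where k: "\<forall>x\<in>A. prm ^ k * x \<in> lattice" by blast
  obtain l where l: "prm ^ l * a \<in> lattice" using lattice_absorbs by blast
  have "\<forall>b\<in>insert a A. prm ^ (max k l) * b \<in> lattice"
    using k lattice_prm_mono[OF l max.cobounded2] lattice_prm_mono[OF _ max.cobounded1] by blast
  then show ?case by blast
qed simp

lemma \<kappa>_eqI:
  assumes "\<And>b. b \<in> B \<Longrightarrow> \<kappa> b x = \<kappa> b y"
  shows "x = y"
proof -
  have "x = (\<Sum>b\<in>B. scale (\<kappa> b x) (v b))" by (rule \<kappa>_expand)
  also have "\<dots> = (\<Sum>b\<in>B. scale (\<kappa> b y) (v b))" using assms by (intro sum.cong) simp_all
  also have "\<dots> = y" by (rule \<kappa>_expand[symmetric])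
  finally show ?thesis .
qed

lemma \<kappa>_combination: "b \<in> B \<Longrightarrow> \<kappa> b (\<Sum>c\<in>B. scale (a c) (v c)) = a b"
proof -
  assume b: "b \<in> B"
  have "\<kappa> b (\<Sum>c\<in>B. scale (a c) (v c)) = (\<Sum>c\<in>B. if b = c then a c else 0)"
    unfolding \<kappa>_sum by (intro sum.cong) (auto simp: \<kappa>_scale \<kappa>_v b)
  then show ?thesis using b finite_B by simp
qed

definition coords :: "'d \<Rightarrow> 'd \<Rightarrow> 'p padic_int" where
  "coords x b = (SOME z. \<kappa> b x = padic_of_int z)"

lemma coords: "x \<in> lattice \<Longrightarrow> b \<in> B \<Longrightarrow> \<kappa> b x = padic_of_int (coords x b)"
  unfolding coords_def lattice_def by (rule someI_ex) (auto elim: padic_integersE)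

lemma residue_coords_eq:
  assumes "x \<in> lattice" "y \<in> lattice" "\<And>b. b \<in> B \<Longrightarrow> residue (coords x b) k = residue (coords y b) k"
  shows "\<exists>z\<in>lattice. x = y + prm ^ k * z"
proof -
  have "\<exists>w. coords x b = coords y b + of_nat CARD('p) ^ k * w" if "b \<in> B" for b
  proof -
    have "residue (coords x b - coords y b) k = 0" using assms(3)[OF that] by (simp add: residue_diff)
    then obtain w where "coords x b - coords y b = of_nat CARD('p) ^ k * w"
      using residue_eq_0_imp_multiple by blast
    then have "coords x b = coords y b + of_nat CARD('p) ^ k * w" by (simp add: algebra_simps)
    then show ?thesis by blast
  qed
  then have "\<forall>b\<in>B. \<exists>w. coords x b = coords y b + of_nat CARD('p) ^ k * w" by blast
  from bchoice[OF this] obtain w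
    where w: "\<And>b. b \<in> B \<Longrightarrow> coords x b = coords y b + of_nat CARD('p) ^ k * w b" by blast
  let ?z = "\<Sum>b\<in>B. scale (padic_of_int (w b)) (v b)"
  have z: "?z \<in> lattice" by (simp add: lattice_def \<kappa>_combination)
  have "x = y + prm ^ k * ?z"
    by (rule \<kappa>_eqI)
       (simp add: \<kappa>_add prm_power_mult \<kappa>_scale \<kappa>_combination coords assms w)
  then show ?thesis using z by blast
qed

lemma residue_coords_prm:
  assumes "x \<in> lattice" "b \<in> B"
  shows "residue (coords (prm ^ k * x) b) k = 0"
proof -
  have "padic_of_int (coords (prm ^ k * x) b) = padic_of_int (of_nat CARD('p) ^ k * coords x b)"
    using coords[OF assms] coords[OF lattice_prm[OF assms(1)] assms(2), of k]
    by (simp add: prm_power_mult \<kappa>_scale)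
  then have "coords (prm ^ k * x) b = of_nat CARD('p) ^ k * coords x b"
    by (simp only: padic_of_int_eq_iff)
  then show ?thesis by (simp add: residue_multiple)
qed

lemma lattice_separated:
  assumes "\<And>k. \<exists>y\<in>lattice. x = prm ^ k * y"
  shows "x = 0"
proof -
  have x: "x \<in> lattice" using assms[of 0] by auto
  have "coords x b = 0" if "b \<in> B" for b
  proof (rule residue_eqI)
    fix k
    obtain y where "y \<in> lattice" "x = prm ^ k * y" using assms by blast
    then show "residue (coords x b) k = residue 0 k" using residue_coords_prm[OF _ that] by simp
  qed
  then show ?thesis using coords[OF x] by (intro \<kappa>_eqI) (simp add: \<kappa>_0)
qed

text \<open>With the least exponent, one factor of the prime less would leave the lattice. For
  \<open>k = 0\<close> divisibility is not excluded, since \<open>x\<close> may already be a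
  multiple of the prime.\<close>

lemma primitive_multiple:
  "\<exists>k. prm ^ k * x \<in> lattice \<and> (k \<noteq> 0 \<longrightarrow> (\<forall>y\<in>lattice. prm ^ k * x \<noteq> prm * y))"
proof -
  define k where "k = (LEAST k. prm ^ k * x \<in> lattice)"
  have "prm ^ k * x \<in> lattice" unfolding k_def using lattice_absorbs by (rule LeastI_ex)
  moreover have "prm ^ k * x \<noteq> prm * y" if "k \<noteq> 0" "y \<in> lattice" for y
  proof
    assume eq: "prm ^ k * x = prm * y"
    obtain i where i: "k = Suc i" using \<open>k \<noteq> 0\<close> by (cases k) auto
    have "prm * (prm ^ i * x) = prm * y" using eq by (simp add: i mult.assoc)
    then have "prm ^ i * x = y" using prm_power_nonzero[of 1] by simp
    then show False using not_less_Least[of i "\<lambda>k. prm ^ k * x \<in> lattice"] that(2) i by (simp add: k_def)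
  qed
  ultimately show ?thesis by blast
qed

text \<open>If inverses of primitive vectors were unbounded, a limit argument would produce
  zero divisors.\<close>

lemma inverse_bounded:
  "\<exists>c. \<forall>x\<in>lattice. (\<forall>y\<in>lattice. x \<noteq> prm * y) \<longrightarrow> prm ^ c * inverse x \<in> lattice"
proof (rule ccontr)
  assume "\<not> ?thesis"
  then have "\<forall>c. \<exists>x. x \<in> lattice \<and> (\<forall>y\<in>lattice. x \<noteq> prm * y) \<and> prm ^ c * inverse x \<notin> lattice"
    by blast
  from choice[OF this] obtain x where x: "\<And>c. x c \<in> lattice" "\<And>c y. y \<in> lattice \<Longrightarrow> x c \<noteq> prm * y"
    "\<And>c. prm ^ c * inverse (x c) \<notin> lattice" by blast
  have "\<forall>c. \<exists>j. prm ^ j * inverse (x c) \<in> lattice \<and>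
      (j \<noteq> 0 \<longrightarrow> (\<forall>z\<in>lattice. prm ^ j * inverse (x c) \<noteq> prm * z))"
    using primitive_multiple by blast
  from choice[OF this] obtain j where j: "\<And>c. prm ^ j c * inverse (x c) \<in> lattice"
    "\<And>c z. j c \<noteq> 0 \<Longrightarrow> z \<in> lattice \<Longrightarrow> prm ^ j c * inverse (x c) \<noteq> prm * z" by blast
  \<comment> \<open>Rescaled inverses that are primitive again. Their exponents \<open>j c\<close>
    exceed \<open>c\<close>, so the products \<open>x c * y c\<close> are powers of the prime that
    tend to zero.\<close>
  define y where "y = (\<lambda>c. prm ^ j c * inverse (x c))"
  have y: "y c \<in> lattice" for c unfolding y_def by (rule j(1))
  have jc: "j c > c" for c
    using lattice_prm_mono[OF j(1), of c c] x(3)[of c] by (meson not_le)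
  have y': "y c \<noteq> prm * z" if "z \<in> lattice" for c z
    unfolding y_def using jc[of c] that by (intro j(2)) auto
  have x0: "x c \<noteq> 0" for c using x(2)[OF lattice_0, of c] by simp
  have xy: "x c * y c = prm ^ j c" for c
    unfolding y_def using x0[of c] prm_commute[of "j c" "inverse (x c)"]
    by (simp add: mult.assoc[symmetric])
  \<comment> \<open>The boolean tag lets one subsequence serve both sequences.\<close>
  define f where "f = (\<lambda>c i. if snd i then coords (x c) (fst i) else coords (y c) (fst i))"
  obtain r :: "nat \<Rightarrow> nat" and L where r: "strict_mono r"
    and L: "\<And>k. \<exists>n0. \<forall>n\<ge>n0. \<forall>i\<in>B \<times> UNIV. residue (f (r n) i) k = residue (L i :: 'p padic_int) k"
    using padic_compact[of "B \<times> (UNIV :: bool set)" f] finite_B by auto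
  define lm where "lm = (\<lambda>t. \<Sum>b\<in>B. scale (padic_of_int (L (b, t))) (v b))"
  have lm: "lm t \<in> lattice" for t by (simp add: lm_def lattice_def \<kappa>_combination)
  have clm: "coords (lm t) b = L (b, t)" if "b \<in> B" for b t
    using coords[OF lm that, of t] that by (simp add: lm_def \<kappa>_combination)
  have conv: "\<exists>n0. \<forall>n\<ge>n0. (\<exists>z\<in>lattice. x (r n) = lm True + prm ^ k * z) \<and>
      (\<exists>z\<in>lattice. y (r n) = lm False + prm ^ k * z)" for k
  proof -
    obtain n0 where n0: "\<And>n i. n \<ge> n0 \<Longrightarrow> i \<in> B \<times> UNIV \<Longrightarrow> residue (f (r n) i) k = residue (L i) k"
      using L[of k] by blast
    show ?thesis
    proof (intro exI[of _ n0] allI impI conjI)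
      fix n assume n: "n \<ge> n0"
      show "\<exists>z\<in>lattice. x (r n) = lm True + prm ^ k * z"
        using n0[OF n, of "(_, True)"] by (intro residue_coords_eq x lm) (simp add: clm f_def)
      show "\<exists>z\<in>lattice. y (r n) = lm False + prm ^ k * z"
        using n0[OF n, of "(_, False)"] by (intro residue_coords_eq y lm) (simp add: clm f_def)
    qed
  qed
  obtain n1 where n1: "\<And>n. n \<ge> n1 \<Longrightarrow> (\<exists>z\<in>lattice. x (r n) = lm True + prm ^ 1 * z) \<and>
      (\<exists>z\<in>lattice. y (r n) = lm False + prm ^ 1 * z)" using conv[of 1] by blast
  obtain z z' where z: "z \<in> lattice" "x (r n1) = lm True + prm ^ 1 * z"
    "z' \<in> lattice" "y (r n1) = lm False + prm ^ 1 * z'" using n1[of n1] by blast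
  \<comment> \<open>Modulo the prime the limits agree with primitive vectors, so they cannot
    vanish.\<close>
  have "lm True \<noteq> 0"
  proof
    assume "lm True = 0"
    then have "x (r n1) = prm * z" using z(2) by simp
    then show False using x(2)[OF z(1)] by blast
  qed
  moreover have "lm False \<noteq> 0"
  proof
    assume "lm False = 0"
    then have "y (r n1) = prm * z'" using z(4) by simp
    then show False using y'[OF z(3)] by blast
  qed
  moreover have "lm True * lm False = 0"
  proof (rule lattice_separated)
    fix k
    obtain s where s: "prm ^ s * 1 \<in> lattice" using lattice_absorbs by blast
    obtain n0 where n0: "\<And>n. n \<ge> n0 \<Longrightarrow> (\<exists>z\<in>lattice. x (r n) = lm True + prm ^ k * z) \<and>
      (\<exists>z\<in>lattice. y (r n) = lm False + prm ^ k * z)" using conv[of k] by blast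
    \<comment> \<open>With this choice \<open>j (r n) - k\<close> is at least \<open>s\<close>, so
      the corresponding power of the prime, as an element of \<open>D\<close>, lies in the
      lattice.\<close>
    define n where "n = max n0 (k + s)"
    obtain z z' where z: "z \<in> lattice" "x (r n) = lm True + prm ^ k * z"
      "z' \<in> lattice" "y (r n) = lm False + prm ^ k * z'" using n0[of n] unfolding n_def by (meson max.cobounded1)
    have "j (r n) \<ge> k + s" using jc[of "r n"] seq_suble[OF r, of n] by (simp add: n_def)
    then have jA: "prm ^ j (r n) = prm ^ k * (prm ^ (j (r n) - k) * 1)"
      by (simp add: power_add[symmetric])
    have l: "prm ^ (j (r n) - k) * 1 \<in> lattice"
      using \<open>j (r n) \<ge> k + s\<close> by (intro lattice_prm_mono[OF s]) simp
    define A where "A = prm ^ (j (r n) - k) * 1"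
    define C where "C = lm True * z' + z * lm False + prm ^ k * (z * z')"
    have "lm True * lm False + prm ^ k * C = x (r n) * y (r n)"
      using prm_commute[of k "lm True"] prm_commute[of k z] unfolding z(2,4) C_def
      by (simp add: distrib_left distrib_right mult.assoc[symmetric] add.assoc)
    also have "\<dots> = prm ^ k * A" unfolding xy A_def by (rule jA)
    finally have "lm True * lm False = prm ^ k * A - prm ^ k * C" by (simp only: eq_diff_eq)
    then have "lm True * lm False = prm ^ k * (A + - C)" by (simp add: right_diff_distrib)
    moreover have "A \<in> lattice" unfolding A_def by (rule l)
    moreover have "C \<in> lattice"
      unfolding C_def by (intro lattice_add lattice_mult lattice_prm z(1,3) lm)
    ultimately show "\<exists>w\<in>lattice. lm True * lm False = prm ^ k * w"
      using lattice_add[OF _ lattice_minus] by blast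
  qed
  ultimately show False by simp
qed

end

subsection \<open>Integral elements\<close>

context fd_division_algebra_0
begin

lemma peval_altdef: "peval q a = (\<Sum>i\<le>degree q. scale (coeff q i) (a ^ i))"
proof -
  have "peval q a = peval (\<Sum>i\<le>degree q. monom (coeff q i) i) a"
    by (simp add: poly_as_sum_of_monoms)
  then show ?thesis by (simp add: peval_sum peval_monom)
qed

lemma peval_bounded_degree: "degree q < n \<Longrightarrow> peval q a = (\<Sum>i<n. scale (coeff q i) (a ^ i))"
  unfolding peval_altdef by (intro sum.mono_neutral_left) (auto simp: coeff_eq_0)

lemma peval_1 [simp]: "peval 1 a = 1"
  by (simp add: one_pCons)

lemma peval_diff: "peval (p - q) a = peval p a - peval q a"
  using peval_add[of "p - q" q a] by (simp add: algebra_simps)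

end

context padic_division_algebra
begin

definition zeval :: "'p padic_int poly \<Rightarrow> 'd \<Rightarrow> 'd" where
  "zeval q x = peval (map_poly padic_of_int q) x"

lemma map_poly_padic_of_int:
  "map_poly padic_of_int (p * q) = map_poly padic_of_int p * map_poly padic_of_int q"
  "map_poly padic_of_int (p + q) = map_poly padic_of_int p + map_poly padic_of_int q"
  "map_poly padic_of_int (p - q) = map_poly padic_of_int p - map_poly padic_of_int q"
proof -
  interpret map_poly_comm_ring_hom "padic_of_int :: 'a padic_int \<Rightarrow> _" by unfold_locales auto
  show "map_poly padic_of_int (p * q) = map_poly padic_of_int p * map_poly padic_of_int q"
    "map_poly padic_of_int (p + q) = map_poly padic_of_int p + map_poly padic_of_int q"
    "map_poly padic_of_int (p - q) = map_poly padic_of_int p - map_poly padic_of_int q"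
    by (simp_all only: hom_mult hom_add hom_minus)
qed

lemma zeval_simps:
  "zeval 0 x = 0" "zeval 1 x = 1" "zeval (p + q) x = zeval p x + zeval q x"
  "zeval (p - q) x = zeval p x - zeval q x" "zeval (p * q) x = zeval p x * zeval q x"
  "zeval (monom a n) x = scale (padic_of_int a) (x ^ n)"
  "zeval (pCons a q) x = scale (padic_of_int a) 1 + x * zeval q x"
  by (simp_all add: zeval_def map_poly_padic_of_int peval_add peval_diff peval_mult map_poly_monom
      peval_monom map_poly_1') (cases "pCons a q = 0"; simp add: map_poly_pCons)

lemma zeval_power: "zeval (q ^ k) x = zeval q x ^ k"
  by (induction k) (auto simp: zeval_simps)

lemma zeval_sum: "zeval (sum f I) x = (\<Sum>i\<in>I. zeval (f i) x)"
  by (induction I rule: infinite_finite_induct) (auto simp: zeval_simps)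

lemma zeval_altdef: "zeval q x = (\<Sum>i\<le>degree q. scale (padic_of_int (coeff q i)) (x ^ i))"
proof -
  have "zeval q x = zeval (\<Sum>i\<le>degree q. monom (coeff q i) i) x"
    by (simp add: poly_as_sum_of_monoms)
  then show ?thesis by (simp add: zeval_sum zeval_simps)
qed

definition integral :: "'d \<Rightarrow> bool" where
  "integral x \<longleftrightarrow> (\<exists>q. lead_coeff q = 1 \<and> zeval q x = 0)"

end

section \<open>The regular norm as a criterion for integrality\<close>

context padic_lattice
begin

lemma B_nonempty: "B \<noteq> {}"
proof
  assume "B = {}"
  then have "(1 :: 'd) = 0" using \<kappa>_expand[of 1] by simp
  then show False by simp
qed

definition basis_list :: "'d list" where
  "basis_list = (SOME l. set l = B \<and> distinct l)"

lemma basis_list: "set basis_list = B" "distinct basis_list"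
proof -
  have "\<exists>l. set l = B \<and> distinct l" using finite_distinct_list[OF finite_B] .
  from someI_ex[OF this] show "set basis_list = B" "distinct basis_list"
    unfolding basis_list_def by auto
qed

lemma length_basis_list: "length basis_list = card B"
  using basis_list distinct_card by metis

lemma sum_basis_list: "(\<Sum>b\<in>B. f b) = (\<Sum>k<card B. f (basis_list ! k))"
  using sum.reindex_bij_betw[OF bij_betw_nth[OF basis_list(2) refl basis_list(1)[symmetric]], of f]
  by (simp add: length_basis_list)

definition mult_matrix :: "'d \<Rightarrow> 'p padic mat" where
  "mult_matrix x = mat (card B) (card B) (\<lambda>(i, j). \<kappa> (basis_list ! i) (x * v (basis_list ! j)))"

lemma mult_matrix_carrier: "mult_matrix x \<in> carrier_mat (card B) (card B)"
  by (simp add: mult_matrix_def)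

lemma mult_matrix_mult: "mult_matrix (x * y) = mult_matrix x * mult_matrix y"
proof (rule eq_matI)
  fix i j assume "i < dim_row (mult_matrix x * mult_matrix y)" "j < dim_col (mult_matrix x * mult_matrix y)"
  then have ij: "i < card B" "j < card B" by (simp_all add: mult_matrix_def)
  let ?b = "\<lambda>i. basis_list ! i"
  have "x * y * v (?b j) = x * (\<Sum>b\<in>B. scale (\<kappa> b (y * v (?b j))) (v b))"
    by (simp only: \<kappa>_expand[of "y * v (?b j)", symmetric] mult.assoc)
  also have "\<dots> = (\<Sum>b\<in>B. scale (\<kappa> b (y * v (?b j))) (x * v b))"
    by (simp add: sum_distrib_left mult_scale_right)
  finally have "\<kappa> (?b i) (x * y * v (?b j)) = (\<Sum>b\<in>B. \<kappa> b (y * v (?b j)) * \<kappa> (?b i) (x * v b))"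
    by (simp add: \<kappa>_sum \<kappa>_scale)
  also have "\<dots> = (\<Sum>k<card B. \<kappa> (?b i) (x * v (?b k)) * \<kappa> (?b k) (y * v (?b j)))"
    by (subst sum_basis_list) (simp add: mult.commute)
  finally show "mult_matrix (x * y) $$ (i, j) = (mult_matrix x * mult_matrix y) $$ (i, j)"
    using ij by (simp add: mult_matrix_def scalar_prod_def atLeast0LessThan)
qed (simp_all add: mult_matrix_def)

text \<open>The norm of the regular representation over the p-adic numbers. It stands in for a
  valuation on \<open>D\<close>: it is multiplicative and, by \<open>integral_iff_nrm\<close>,
  decides integrality.\<close>

definition nrm :: "'d \<Rightarrow> 'p padic" where
  "nrm x = det (mult_matrix x)"

lemma nrm_mult: "nrm (x * y) = nrm x * nrm y"
  unfolding nrm_def mult_matrix_mult by (rule det_mult[OF mult_matrix_carrier mult_matrix_carrier])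

lemma nrm_scale_1: "nrm (scale a 1) = a ^ card B"
proof -
  have "mult_matrix (scale a 1) = a \<cdot>\<^sub>m 1\<^sub>m (card B)"
  proof (rule eq_matI)
    fix i j assume "i < dim_row (a \<cdot>\<^sub>m 1\<^sub>m (card B))" "j < dim_col (a \<cdot>\<^sub>m 1\<^sub>m (card B))"
    then have ij: "i < card B" "j < card B" by simp_all
    then have "basis_list ! i \<in> B" "basis_list ! j \<in> B" "basis_list ! i = basis_list ! j \<longleftrightarrow> i = j"
      using basis_list length_basis_list nth_eq_iff_index_eq by (metis nth_mem)+
    then show "mult_matrix (scale a 1) $$ (i, j) = (a \<cdot>\<^sub>m 1\<^sub>m (card B)) $$ (i, j)"
      using ij by (simp add: mult_matrix_def scale_mult_left \<kappa>_scale \<kappa>_v)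
  qed (simp_all add: mult_matrix_def)
  then show ?thesis by (simp add: nrm_def det_smult)
qed

lemma nrm_1: "nrm 1 = 1"
  using nrm_scale_1[of 1] by simp

lemma nrm_prm: "nrm (prm ^ k * x) = of_nat CARD('p) ^ (k * card B) * nrm x"
  using prm_power_mult[of k 1] nrm_scale_1 by (simp add: nrm_mult power_mult)

lemma nrm_power: "nrm (x ^ k) = nrm x ^ k"
  by (induction k) (auto simp: nrm_1 nrm_mult)

lemma v_lattice: "b \<in> B \<Longrightarrow> v b \<in> lattice"
  using of_nat_in_padic_integers[of 1] by (auto simp: lattice_def \<kappa>_v)

lemma nrm_lattice:
  assumes "x \<in> lattice"
  shows "nrm x \<in> padic_integers"
proof -
  interpret comm_ring_hom "padic_of_int :: 'p padic_int \<Rightarrow> _" by unfold_locales auto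
  let ?A = "mat (card B) (card B) (\<lambda>(i, j). coords (x * v (basis_list ! j)) (basis_list ! i))"
  have "mult_matrix x = map_mat padic_of_int ?A"
  proof (rule eq_matI)
    fix i j assume "i < dim_row (map_mat padic_of_int ?A)" "j < dim_col (map_mat padic_of_int ?A)"
    then have ij: "i < card B" "j < card B" by simp_all
    then have "basis_list ! i \<in> B" "basis_list ! j \<in> B"
      using basis_list(1) length_basis_list by (metis nth_mem)+
    then show "mult_matrix x $$ (i, j) = map_mat padic_of_int ?A $$ (i, j)"
      using ij coords[OF lattice_mult[OF assms v_lattice]] by (simp add: mult_matrix_def)
  qed (simp_all add: mult_matrix_def)
  then have "nrm x = padic_of_int (det ?A)" by (simp add: nrm_def hom_det)
  then show ?thesis by simp
qed

text \<open>Let \<open>k\<close> be the exponent that makes \<open>x\<close> primitive,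
  \<open>c\<close> the bound of \<open>inverse_bounded\<close> and \<open>d = card B\<close>. If
  \<open>k > c\<close>, then \<open>x\<close> and \<open>prm ^ c * inverse (prm ^ k * x)\<close>
  both have integral norm, but the product of the norms is p^((c - k) d), which is not
  integral.\<close>

lemma nrm_integral_bounded: "\<exists>c. \<forall>x. nrm x \<in> padic_integers \<longrightarrow> prm ^ c * x \<in> lattice"
proof -
  obtain c where c: "\<And>x. x \<in> lattice \<Longrightarrow> (\<And>y. y \<in> lattice \<Longrightarrow> x \<noteq> prm * y) \<Longrightarrow> prm ^ c * inverse x \<in> lattice"
    using inverse_bounded by blast
  have "prm ^ c * x \<in> lattice" if x: "nrm x \<in> padic_integers" for x
  proof (rule ccontr)
    assume notin: "prm ^ c * x \<notin> lattice"
    obtain k where k: "prm ^ k * x \<in> lattice"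
      "\<And>y. k \<noteq> 0 \<Longrightarrow> y \<in> lattice \<Longrightarrow> prm ^ k * x \<noteq> prm * y" using primitive_multiple by blast
    have "k > c" using lattice_prm_mono[OF k(1), of c] notin by (meson not_le)
    have x0: "x \<noteq> 0" using notin lattice_0 by auto
    have "prm ^ c * inverse (prm ^ k * x) \<in> lattice" using \<open>k > c\<close> by (intro c k) auto
    then have "nrm x * nrm (prm ^ c * inverse (prm ^ k * x)) \<in> padic_integers"
      using padic_integers_closed(2)[OF x nrm_lattice] by blast
    then obtain z where z: "nrm x * nrm (prm ^ c * inverse (prm ^ k * x)) = padic_of_int z"
      by (rule padic_integersE)
    let ?p = "of_nat CARD('p) :: 'p padic"
    have "prm ^ k * x * inverse (prm ^ k * x) = 1"
      using x0 prm_power_nonzero[of k] by simp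
    then have "?p ^ (k * card B) * (nrm x * nrm (inverse (prm ^ k * x))) = 1"
      using nrm_mult[of "prm ^ k * x" "inverse (prm ^ k * x)"] by (simp add: nrm_prm nrm_1 mult.assoc)
    then have "?p ^ (c * card B) = ?p ^ (k * card B) * padic_of_int z"
      by (simp add: z[symmetric] nrm_prm[of c] algebra_simps)
    then have "k * card B \<le> c * card B" by (rule not_divisible_padic)
    then show False using \<open>k > c\<close> B_nonempty finite_B by simp
  qed
  then show ?thesis by blast
qed

lemma power_bounded_imp_nrm:
  assumes "\<And>k. prm ^ N * x ^ k \<in> lattice"
  shows "nrm x \<in> padic_integers"
proof (rule ccontr)
  assume "nrm x \<notin> padic_integers"
  then obtain z where z: "inverse (nrm x) = of_nat CARD('p) * padic_of_int z" using padic_dichotomy by blast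
  let ?p = "of_nat CARD('p) :: 'p padic"
  \<comment> \<open>One more than the exponent of the prime that the norm of the factor
    \<open>prm ^ N\<close> contributes.\<close>
  let ?k = "Suc (N * card B)"
  have nz: "nrm x \<noteq> 0" using \<open>nrm x \<notin> padic_integers\<close> by auto
  obtain w where w: "nrm (prm ^ N * x ^ ?k) = padic_of_int w"
    using nrm_lattice[OF assms] by (rule padic_integersE)
  have "?p ^ (N * card B) = ?p ^ (N * card B) * nrm x ^ ?k * inverse (nrm x) ^ ?k"
    using nz by (simp add: power_inverse field_simps)
  also have "\<dots> = padic_of_int w * (?p * padic_of_int z) ^ ?k"
    by (simp only: w[symmetric] nrm_prm nrm_power z)
  also have "\<dots> = ?p ^ ?k * padic_of_int (w * z ^ ?k)"
    by (simp only: power_mult_distrib padic_of_int_hom padic_of_int_power ac_simps)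
  finally have "?k \<le> N * card B" by (rule not_divisible_padic)
  then show False by simp
qed

lemma zeval_lattice:
  assumes "\<And>i. i \<le> degree q \<Longrightarrow> prm ^ N * x ^ i \<in> lattice"
  shows "prm ^ N * zeval q x \<in> lattice"
proof -
  have "prm ^ N * zeval q x = (\<Sum>i\<le>degree q. scale (padic_of_int (coeff q i)) (prm ^ N * x ^ i))"
    by (simp add: zeval_altdef sum_distrib_left mult_scale_right)
  then show ?thesis using assms by (auto intro!: lattice_sum lattice_scale)
qed

text \<open>For a monic \<open>q\<close>, pseudo-division is division over the p-adic integers. So
  every power of \<open>x\<close> is an integral combination of the first \<open>degree q\<close>
  powers, and all powers are bounded together.\<close>

lemma integral_imp_nrm:
  assumes "integral x"
  shows "nrm x \<in> padic_integers"
proof -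
  obtain q where q: "lead_coeff q = 1" "zeval q x = 0" using assms unfolding integral_def by blast
  have deg: "degree q \<noteq> 0"
  proof
    assume "degree q = 0"
    then obtain a where "q = [:a:]" by (rule degree_eq_zeroE)
    then show False using q by (simp add: zeval_simps)
  qed
  obtain N where N: "\<forall>y\<in>(\<lambda>i. x ^ i) ` {..<degree q}. prm ^ N * y \<in> lattice"
    using lattice_absorbs_finite[of "(\<lambda>i. x ^ i) ` {..<degree q}"] by blast
  have "prm ^ N * x ^ k \<in> lattice" for k
  proof -
    obtain s r where sr: "pseudo_divmod (monom 1 k) q = (s, r)" by (cases "pseudo_divmod (monom 1 k) q")
    have q0: "q \<noteq> 0" using deg by auto
    from pseudo_divmod[OF q0 sr] q(1) have "monom 1 k = q * s + r" "r = 0 \<or> degree r < degree q" by auto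
    then have "x ^ k = zeval r x" "degree r < degree q"
      using q(2) deg zeval_simps(6)[of 1 k x] by (auto simp: zeval_simps)
    then show ?thesis using zeval_lattice[of r N x] N by simp
  qed
  then show ?thesis by (rule power_bounded_imp_nrm)
qed

lemma nrm_imp_power_bounded:
  "\<exists>c. \<forall>x. nrm x \<in> padic_integers \<longrightarrow> (\<forall>k. prm ^ c * x ^ k \<in> lattice)"
proof -
  obtain c where "\<And>x. nrm x \<in> padic_integers \<Longrightarrow> prm ^ c * x \<in> lattice"
    using nrm_integral_bounded by blast
  then show ?thesis using nrm_power padic_integers_power by metis
qed

text \<open>Dividing by \<open>x\<close> or \<open>y\<close> reduces the claim to \<open>1 + z\<close>, whose powers are integral combinations of
  the bounded powers of \<open>z\<close>.\<close>

lemma nrm_add: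
  assumes x: "nrm x \<in> padic_integers" and y: "nrm y \<in> padic_integers"
  shows "nrm (x + y) \<in> padic_integers"
proof -
  obtain c where c: "\<And>x k. nrm x \<in> padic_integers \<Longrightarrow> prm ^ c * x ^ k \<in> lattice"
    using nrm_imp_power_bounded by blast
  have one: "nrm (1 + z) \<in> padic_integers" if z: "nrm z \<in> padic_integers" for z
  proof (rule power_bounded_imp_nrm)
    fix k
    have "(1 + z) ^ k = zeval ([:1, 1:] ^ k) z" by (simp add: zeval_power zeval_simps)
    then show "prm ^ c * (1 + z) ^ k \<in> lattice" using zeval_lattice c[OF z] by simp
  qed
  have main: "nrm (x + y) \<in> padic_integers"
    if "x \<noteq> 0" "nrm x \<in> padic_integers" "nrm (inverse x * y) \<in> padic_integers" for x y
  proof -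
    have "x + y = x * (1 + inverse x * y)" using that(1) by (simp add: distrib_left mult.assoc[symmetric])
    then show ?thesis using padic_integers_closed(2)[OF that(2) one[OF that(3)]] by (simp add: nrm_mult)
  qed
  show ?thesis
  proof (cases "x = 0 \<or> y = 0")
    case True
    then show ?thesis using x y by auto
  next
    case False
    show ?thesis
    proof (cases "nrm (inverse x * y) \<in> padic_integers")
      case True
      then show ?thesis using main False x by blast
    next
      case F: False
      \<comment> \<open>The dichotomy decides which quotient to use: if the norm of one is not
        integral, the norm of the other is a multiple of the prime.\<close>
      obtain z where z: "inverse (nrm (inverse x * y)) = of_nat CARD('p) * padic_of_int z"
        using padic_dichotomy[OF F] by blast
      have "inverse x * y * (inverse y * x) = 1"
        using False by (simp add: mult.assoc[symmetric]) (simp add: mult.assoc)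
      then have "nrm (inverse x * y) * nrm (inverse y * x) = 1"
        using nrm_mult[of "inverse x * y" "inverse y * x"] by (simp add: nrm_1)
      then have "nrm (inverse y * x) = of_nat CARD('p) * padic_of_int z"
        using inverse_unique z by metis
      then have "nrm (inverse y * x) \<in> padic_integers"
        using padic_integers_closed(2)[OF of_nat_in_padic_integers padic_integersI] by metis
      then show ?thesis using main[of y x] False y by (simp add: add.commute)
    qed
  qed
qed

text \<open>Pigeonhole: modulo a power of \<open>p\<close>, the coordinates of the bounded powers of \<open>x\<close> take finitely
  many values, so some \<open>x\<^sup>l - x\<^sup>k\<close> is an integral combination of lower powers.\<close>

lemma nrm_imp_integral:
  assumes "nrm x \<in> padic_integers"
  shows "integral x"
proof -
  obtain N where N: "\<And>k. prm ^ N * x ^ k \<in> lattice"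
    using nrm_imp_power_bounded assms by blast
  obtain q where q: "q \<noteq> 0" "peval q x = 0"
    and min: "\<And>s. s \<noteq> 0 \<Longrightarrow> peval s x = 0 \<Longrightarrow> degree q \<le> degree s"
    using minimal_annihilator by blast
  define d where "d = degree q"
  have small: "s = 0" if "peval s x = 0" "degree s < d" for s
    using min[of s] that by (auto simp: d_def)
  have d0: "d > 0"
  proof (rule ccontr)
    assume "\<not> d > 0"
    then obtain a where "q = [:a:]" using degree_eq_zeroE[of q] unfolding d_def by auto
    then show False using q by simp
  qed
  have rem: "\<exists>f. x ^ k = (\<Sum>i<d. scale (f i) (x ^ i))" for k
  proof -
    let ?r = "monom 1 k mod q"
    have "degree ?r < d" using degree_mod_less[OF q(1), of "monom 1 k"] d0 by (auto simp: d_def)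
    moreover have "x ^ k = peval (monom 1 k div q * q + ?r) x" by (simp add: peval_monom)
    then have "x ^ k = peval ?r x" using q(2) by (simp only: peval_add peval_mult) simp
    ultimately show ?thesis using peval_bounded_degree by metis
  qed
  have comb: "u = (\<lambda>_. 0)" if "(\<Sum>i<d. scale (u i) (x ^ i)) = 0" "\<forall>i\<ge>d. u i = 0" for u
  proof -
    let ?s = "\<Sum>i<d. monom (u i) i"
    have cf: "coeff ?s i = u i" for i using that(2) by (auto simp: coeff_sum)
    have "degree ?s < d"
      using d0 by (intro degree_lessI) (use cf that(2) in auto)
    moreover have "peval ?s x = 0" using that(1) by (simp add: peval_sum peval_monom)
    ultimately have "?s = 0" using small by blast
    then show ?thesis using cf by (metis coeff_0 ext)
  qed
  let ?S = "(\<lambda>i. x ^ i) ` {..<d}"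
  have inj: "inj_on (\<lambda>i. x ^ i) {..<d}"
  proof (rule inj_onI, rule ccontr)
    fix i j assume ij: "i \<in> {..<d}" "j \<in> {..<d}" "x ^ i = x ^ j" "i \<noteq> j"
    let ?u = "\<lambda>m. (if m = i then 1 else 0) - (if m = j then 1 else (0 :: 'p padic))"
    have "(\<Sum>m<d. scale (?u m) (x ^ m)) = (\<Sum>m<d. if m = i then x ^ i else 0) - (\<Sum>m<d. if m = j then x ^ j else 0)"
      unfolding sum_subtractf[symmetric] by (intro sum.cong) (auto simp: scale_left_diff_distrib)
    then have "(\<Sum>m<d. scale (?u m) (x ^ m)) = 0" using ij by simp
    then have "?u = (\<lambda>_. 0)" using ij by (intro comb) auto
    from fun_cong[OF this, of i] have "?u i = 0" .
    then show False using ij(4) by simp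
  qed
  have ind: "independent ?S"
  proof (rule independent_if_scalars_zero)
    fix u y assume u: "(\<Sum>y\<in>?S. scale (u y) y) = 0" "y \<in> ?S"
    obtain i where i: "i < d" "y = x ^ i" using u(2) by auto
    let ?u = "\<lambda>i. if i < d then u (x ^ i) else 0"
    have "(\<Sum>i<d. scale (?u i) (x ^ i)) = 0" using u(1) by (simp add: sum.reindex[OF inj])
    then have "?u = (\<lambda>_. 0)" by (rule comb) simp
    from fun_cong[OF this, of i] have "?u i = 0" .
    then show "u y = 0" using i by simp
  qed simp
  \<comment> \<open>The independent powers below \<open>d\<close> are completed to a basis of
    \<open>D\<close>, so that the coordinates \<rho> are defined on the whole lattice and have
    bounded denominators there.\<close>
  let ?T = "extend_basis ?S"
  have T: "independent ?T" "span ?T = UNIV" "?S \<subseteq> ?T"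
    using independent_extend_basis[OF ind] span_extend_basis[OF ind] extend_basis_superset[OF ind] by auto
  define \<rho> where "\<rho> = (\<lambda>i y. representation ?T y (x ^ i))"
  have \<rho>_scale: "\<rho> i (scale a y) = a * \<rho> i y" for i a y
    using representation_scale[OF T(1)] T(2) by (simp add: \<rho>_def)
  have \<rho>_sum: "\<rho> i (sum f I) = (\<Sum>k\<in>I. \<rho> i (f k))" for i and f :: "'e \<Rightarrow> 'd" and I
    using representation_zero[of ?T] representation_add[OF T(1)] T(2)
    by (induction I rule: infinite_finite_induct) (simp_all add: \<rho>_def)
  have \<rho>_power: "\<rho> i (x ^ j) = (if i = j then 1 else 0)" if "i < d" "j < d" for i j
  proof -
    have "x ^ j \<in> ?T" using T(3) that by blast
    moreover have "x ^ i = x ^ j \<longleftrightarrow> i = j" using inj_onD[OF inj, of i j] that by auto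
    ultimately show ?thesis using representation_basis[OF T(1), of "x ^ j"] by (simp add: \<rho>_def)
  qed
  obtain R where R: "\<forall>a\<in>(\<lambda>(i, b). \<rho> i (v b)) ` ({..<d} \<times> B). of_nat CARD('p) ^ R * a \<in> padic_integers"
    using common_denominator[of "(\<lambda>(i, b). \<rho> i (v b)) ` ({..<d} \<times> B)"] finite_B by auto
  let ?p = "of_nat CARD('p) :: 'p padic"
  have \<rho>_lattice: "?p ^ R * \<rho> i y \<in> padic_integers" if "y \<in> lattice" "i < d" for i y
  proof -
    have "\<rho> i y = \<rho> i (\<Sum>b\<in>B. scale (\<kappa> b y) (v b))" by (simp only: \<kappa>_expand[of y, symmetric])
    then have "?p ^ R * \<rho> i y = (\<Sum>b\<in>B. \<kappa> b y * (?p ^ R * \<rho> i (v b)))"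
      by (simp add: \<rho>_sum \<rho>_scale sum_distrib_left mult_ac)
    also have "\<dots> \<in> padic_integers"
    proof (rule padic_integers_sum)
      fix b assume b: "b \<in> B"
      have "\<kappa> b y \<in> padic_integers" "?p ^ R * \<rho> i (v b) \<in> padic_integers"
        using that b R by (auto simp: lattice_def)
      then show "\<kappa> b y * (?p ^ R * \<rho> i (v b)) \<in> padic_integers" by (rule padic_integers_closed(2))
    qed
    finally show ?thesis .
  qed
  have "\<exists>z. \<forall>i\<in>{..<d}. ?p ^ (R + N) * \<rho> i (x ^ k) = padic_of_int (z i)" for k
  proof (intro bchoice ballI)
    fix i assume "i \<in> {..<d}"
    then have "?p ^ R * \<rho> i (prm ^ N * x ^ k) \<in> padic_integers" by (intro \<rho>_lattice N) auto
    moreover have "?p ^ R * \<rho> i (prm ^ N * x ^ k) = ?p ^ (R + N) * \<rho> i (x ^ k)"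
      by (simp add: prm_power_mult \<rho>_scale power_add)
    ultimately show "\<exists>z. ?p ^ (R + N) * \<rho> i (x ^ k) = padic_of_int z"
      by (auto elim: padic_integersE)
  qed
  then have "\<forall>k. \<exists>z. \<forall>i\<in>{..<d}. ?p ^ (R + N) * \<rho> i (x ^ k) = padic_of_int (z i)" ..
  from choice[OF this] obtain z
    where z: "\<And>k i. i < d \<Longrightarrow> ?p ^ (R + N) * \<rho> i (x ^ k) = padic_of_int (z k i)" by auto
  \<comment> \<open>The coordinates of all powers of \<open>x\<close> become integral after
    multiplication by the power \<open>R + N\<close> of the prime, so equal residues at that level
    make the difference of the coordinates integral. Exponents from \<open>d\<close> on keep
    \<open>X^l\<close> above the lower terms, so the polynomial is monic.\<close>
  let ?g = "\<lambda>k. restrict (\<lambda>i. residue (z k i) (R + N)) {..<d}"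
  have "?g ` {d..} \<subseteq> PiE {..<d} (\<lambda>_. {0..<int CARD('p) ^ (R + N)})"
    by (rule image_subsetI) (auto simp: restrict_PiE_iff residue_bounds)
  then have "finite (?g ` {d..})" by (rule finite_subset) (intro finite_PiE; simp)
  then have "\<not> inj_on ?g {d..}" using finite_imageD infinite_Ici by blast
  then obtain i j where ij: "i \<ge> d" "j \<ge> d" "i \<noteq> j" "?g i = ?g j"
    unfolding inj_on_def by auto
  have "\<exists>k l. k \<ge> d \<and> k < l \<and> ?g k = ?g l"
  proof (cases "i < j")
    case True
    then show ?thesis using ij by (intro exI[of _ i] exI[of _ j] conjI)
  next
    case False
    then show ?thesis using ij by (intro exI[of _ j] exI[of _ i] conjI) auto
  qed
  then obtain k l where kl: "k \<ge> d" "k < l" "?g k = ?g l" by blast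
  have "\<forall>i\<in>{..<d}. \<exists>w. \<rho> i (x ^ l) - \<rho> i (x ^ k) = padic_of_int w"
  proof
    fix i assume i: "i \<in> {..<d}"
    have "residue (z l i - z k i) (R + N) = 0"
      using fun_cong[OF kl(3), of i] i by (simp add: residue_diff)
    then obtain w where "z l i - z k i = of_nat CARD('p) ^ (R + N) * w"
      using residue_eq_0_imp_multiple by blast
    then have "padic_of_int (z l i - z k i) = ?p ^ (R + N) * padic_of_int w" by simp
    then have "?p ^ (R + N) * (\<rho> i (x ^ l) - \<rho> i (x ^ k)) = ?p ^ (R + N) * padic_of_int w"
      using z i by (simp add: right_diff_distrib)
    then have "\<rho> i (x ^ l) - \<rho> i (x ^ k) = padic_of_int w"
      using card_padic_nonzero[where 'p = 'p] by simp
    then show "\<exists>w. \<rho> i (x ^ l) - \<rho> i (x ^ k) = padic_of_int w" by blast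
  qed
  from bchoice[OF this] obtain w where w: "\<And>i. i < d \<Longrightarrow> \<rho> i (x ^ l) - \<rho> i (x ^ k) = padic_of_int (w i)"
    by auto
  have expand: "x ^ k = (\<Sum>i<d. scale (\<rho> i (x ^ k)) (x ^ i))" for k
  proof -
    obtain f where f: "x ^ k = (\<Sum>i<d. scale (f i) (x ^ i))" using rem by blast
    have "\<rho> i (x ^ k) = f i" if "i < d" for i
    proof -
      have "\<rho> i (x ^ k) = (\<Sum>j<d. if i = j then f j else 0)"
        unfolding f \<rho>_sum by (intro sum.cong) (use that in \<open>auto simp: \<rho>_scale \<rho>_power\<close>)
      then show ?thesis using that by simp
    qed
    then show ?thesis using f by simp
  qed
  let ?q = "monom 1 l - (monom 1 k + (\<Sum>i<d. monom (w i) i)) :: 'p padic_int poly"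
  have cf: "coeff ?q i = 0" if "i > l" for i using that kl by (simp add: coeff_sum)
  have cl: "coeff ?q l = 1" using kl by (simp add: coeff_sum)
  have "degree ?q = l"
    using cf cl by (intro antisym degree_le le_degree) auto
  then have "lead_coeff ?q = 1" using cl by simp
  moreover have "x ^ l - x ^ k = (\<Sum>i<d. scale (padic_of_int (w i)) (x ^ i))"
    by (subst expand[of l], subst expand[of k])
       (simp add: sum_subtractf[symmetric] scale_left_diff_distrib[symmetric] w)
  then have "zeval ?q x = 0" by (simp add: zeval_simps zeval_sum algebra_simps)
  ultimately show ?thesis unfolding integral_def by blast
qed

lemma integral_iff_nrm: "integral x \<longleftrightarrow> nrm x \<in> padic_integers"
  using nrm_imp_integral integral_imp_nrm by blast

end

context padic_division_algebra
begin

text \<open>Multiplying a basis by \<open>prm ^ s\<close> multiplies its structure constants by the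
  same power, so a common denominator of theirs makes them integral.\<close>

lemma lattice_exists: "\<exists>B v \<kappa>. padic_lattice scale B v \<kappa>"
proof -
  obtain S where S: "finite S" "span S = UNIV" by (rule obtain_spanning)
  obtain B where B: "independent B" "UNIV \<subseteq> span B"
    using maximal_independent_subset[of UNIV] by blast
  have fin: "finite B" using independent_span_bound[OF S(1) B(1)] S(2) by simp
  have span: "x \<in> span B" for x using B(2) by blast
  let ?R = "representation B"
  obtain s where s: "\<forall>a\<in>(\<lambda>(b, c, d). ?R (c * d) b) ` (B \<times> B \<times> B). of_nat CARD('p) ^ s * a \<in> padic_integers"
    using common_denominator[OF finite_imageI[OF finite_cartesian_product[OF fin finite_cartesian_product[OF fin fin]]]]
    by blast
  let ?p = "of_nat CARD('p) :: 'p padic"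
  define v where "v = (\<lambda>b. prm ^ s * b)"
  define \<kappa> where "\<kappa> = (\<lambda>b x. ?R x b / ?p ^ s)"
  have v: "v b = scale (?p ^ s) b" for b by (simp add: v_def prm_power_mult)
  note p0 = card_padic_nonzero[where 'p = 'p]
  have "padic_lattice scale B v \<kappa>"
  proof
    show "finite B" by (rule fin)
    show "\<kappa> b (x + y) = \<kappa> b x + \<kappa> b y" for b x y
      using representation_add[OF B(1) span span] by (simp add: \<kappa>_def add_divide_distrib)
    show \<kappa>_scale: "\<kappa> b (scale a x) = a * \<kappa> b x" for a b x
      using representation_scale[OF B(1) span] by (simp add: \<kappa>_def)
    show "x = (\<Sum>b\<in>B. scale (\<kappa> b x) (v b))" for x
    proof -
      have "x = (\<Sum>b\<in>B. scale (?R x b) b)"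
        using sum_representation_eq[OF B(1) span fin subset_refl] by simp
      also have "\<dots> = (\<Sum>b\<in>B. scale (\<kappa> b x) (v b))"
        using p0 by (intro sum.cong) (simp_all add: v \<kappa>_def)
      finally show ?thesis .
    qed
    show "\<kappa> b (v c) = (if b = c then 1 else 0)" if "b \<in> B" "c \<in> B" for b c
      unfolding v \<kappa>_scale using p0 representation_basis[OF B(1) that(2)] by (simp add: \<kappa>_def)
    show "\<kappa> b (v c * v d) \<in> padic_integers" if "b \<in> B" "c \<in> B" "d \<in> B" for b c d
    proof -
      have "\<kappa> b (v c * v d) = ?p ^ s * ?R (c * d) b"
        unfolding v scale_mult_left mult_scale_right \<kappa>_scale using p0 by (simp add: \<kappa>_def)
      then show ?thesis using s that by auto
    qed
  qed
  then show ?thesis by blast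
qed

end

section \<open>Closure properties and boundedness of the integral elements\<close>

context padic_lattice
begin

lemma nrm_minus: "nrm (- x) \<in> padic_integers \<longleftrightarrow> nrm x \<in> padic_integers"
proof -
  have "nrm (- x) \<in> padic_integers" if "nrm x \<in> padic_integers" for x
  proof -
    have "nrm (scale (- 1) 1) \<in> padic_integers"
      unfolding nrm_scale_1 using padic_integersI[of "- 1 :: 'p padic_int"]
      by (intro padic_integers_power) simp
    then show ?thesis using padic_integers_closed(2)[OF _ that] nrm_mult[of "- 1" x] by fastforce
  qed
  from this[of x] this[of "- x"] show ?thesis by auto
qed

text \<open>\<open>x\<close> and \<open>y\<close> need not commute, so they cannot be placed in a
  common commutative ring. The norm is multiplicative, which settles products, and
  \<open>nrm_add\<close> covers sums.\<close>

lemma integral_closed: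
  assumes "integral x" "integral y"
  shows "integral (x + y)" "integral (x * y)" "integral (x - y)" "integral (- x)"
  using assms nrm_add[of x y] nrm_add[of x "- y"] nrm_minus padic_integers_closed(2)
  by (auto simp: integral_iff_nrm nrm_mult)

lemma integral_minus_iff: "integral (- x) \<longleftrightarrow> integral x"
  by (simp add: integral_iff_nrm nrm_minus)

lemma integral_scale: "a \<in> padic_integers \<Longrightarrow> integral x \<Longrightarrow> integral (scale a x)"
  using nrm_mult[of "scale a 1" x] padic_integers_closed(2)[OF padic_integers_power]
  by (simp add: integral_iff_nrm scale_eq_mult[symmetric] nrm_scale_1)

lemma bounded_powers_integral:
  assumes "\<And>k. prm ^ N * x ^ k \<in> lattice"
  shows "integral x"
  using power_bounded_imp_nrm[OF assms] by (simp add: integral_iff_nrm)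

lemma lattice_integral:
  assumes "x \<in> lattice"
  shows "integral x"
proof -
  obtain N where N: "prm ^ N * 1 \<in> lattice" using lattice_absorbs by blast
  have "prm ^ N * x ^ k \<in> lattice" for k
  proof (induction k)
    case (Suc k)
    then show ?case using lattice_mult[OF Suc assms] by (simp add: mult.assoc power_commutes)
  qed (use N in simp)
  then show ?thesis by (rule bounded_powers_integral)
qed

lemma integral_absorbs: "\<exists>k. integral (prm ^ k * x)"
  using lattice_absorbs lattice_integral by blast

lemma integral_bounded: "\<exists>c. \<forall>x. integral x \<longrightarrow> prm ^ c * x \<in> lattice"
  using nrm_integral_bounded by (simp add: integral_iff_nrm)

lemma integral_lie_automorphism:
  assumes \<theta>: "lie_automorphism \<theta>" and x: "x \<in> derived" "integral x"
  shows "integral (\<theta> x)"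
proof -
  obtain q where q: "lead_coeff q = 1" "zeval q x = 0" using x(2) unfolding integral_def by blast
  have "zeval q (\<theta> x) = 0 \<or> zeval q (- \<theta> x) = 0"
    using lie_automorphism_root[OF \<theta> x(1)] q(2) unfolding zeval_def by blast
  then show ?thesis using q(1) integral_minus_iff unfolding integral_def by blast
qed

end

subsection \<open>Orders\<close>

locale padic_order =
  fixes sK :: "'p::prime_card padic \<Rightarrow> 'k::field \<Rightarrow> 'k"
    and sD :: "'k \<Rightarrow> 'd::division_ring \<Rightarrow> 'd"
    and \<Delta> :: "'d set"
  assumes K: "padic_field_extension sK"
    and algebra_D: "unital_algebra sD"
    and finite_D: "finite_dim sD"
    and central_D: "Defs.central sD"
    and order: "is_order (integer_ring sK) sD \<Delta>"
begin

sublocale K: unital_algebra sK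
  using K by (simp add: padic_field_extension_def)

sublocale D: unital_algebra sD
  by (rule algebra_D)

text \<open>Restriction of scalars from \<open>K\<close> to the p-adic numbers; the earlier results
  are applied to \<open>D\<close> as an algebra over these.\<close>

definition sF :: "'p padic \<Rightarrow> 'd \<Rightarrow> 'd" where
  "sF a x = sD (sK a 1) x"

lemma sK_one_mult: "sK a 1 * sK b 1 = sK (a * b) 1"
  by (simp add: K.scale_mult_left)

lemma sD_one_mult: "sD a 1 * sD b 1 = sD (a * b) 1"
  by (simp add: D.scale_mult_left)

lemma sD_one_mult_left: "sD a 1 * x = sD a x"
  by (simp add: D.scale_mult_left)

lemma vector_space_sF: "vector_space sF"
  by unfold_locales
     (simp_all add: sF_def D.scale_right_distrib D.scale_left_distrib K.scale_left_distrib sK_one_mult)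

lemma finite_dim_sF: "finite_dim sF"
proof -
  interpret F: vector_space sF by (rule vector_space_sF)
  obtain A where A: "finite A" "K.span A = UNIV"
    using K unfolding padic_field_extension_def finite_dim_def by blast
  obtain B where B: "finite B" "D.span B = UNIV" using finite_D unfolding finite_dim_def by blast
  let ?P = "(\<lambda>(a, b). sD a b) ` (A \<times> B)"
  have KB: "sD k b \<in> F.span ?P" if b: "b \<in> B" for k b
  proof -
    have "k \<in> K.span A" using A(2) by simp
    then show ?thesis
    proof (induction rule: K.span_induct_alt)
      case base
      then show ?case using F.span_zero by simp
    next
      case (step c x y)
      have eq: "sD (sK c x + y) b = sF c (sD x b) + sD y b"
        using K.scale_mult_left[of c 1 x] by (simp add: sF_def D.scale_left_distrib)
      have "sD x b \<in> ?P" using step(1) b by force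
      then show ?case unfolding eq by (intro F.span_add F.span_scale step(2)) (rule F.span_base)
    qed
  qed
  have "y \<in> F.span ?P" for y
  proof -
    have "y \<in> D.span B" using B(2) by simp
    then show ?thesis
      by (induction rule: D.span_induct_alt) (auto intro: F.span_zero F.span_add KB)
  qed
  then have "F.span ?P = UNIV" by blast
  moreover have "finite ?P" using A(1) B(1) by simp
  ultimately show ?thesis unfolding finite_dim_def by (intro exI[of _ ?P] conjI)
qed

sublocale padic_division_algebra sF
proof -
  interpret F: vector_space sF by (rule vector_space_sF)
  show "padic_division_algebra sF"
  proof unfold_locales
    show "sF c x * y = sF c (x * y)" "x * sF c y = sF c (x * y)" for c x y
      unfolding sF_def by (rule D.scale_mult_left D.mult_scale_right)+
  qed (rule finite_dim_sF)
qed

lemma sF_zp_embed: "sD (zp_embed sK z) x = sF (padic_of_int z) x"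
  by (simp add: sF_def zp_embed_def)

lemma module_zp: "Modules.module (\<lambda>z. sD (zp_embed sK z))"
  unfolding sF_zp_embed[abs_def]
  by unfold_locales (simp_all add: scale_right_distrib scale_left_distrib)

lemma center_eq: "center = range (\<lambda>c. sD c 1)"
  using central_D by (simp add: center_def Defs.central_def)

lemma zeval_sD: "zeval q (sD k 1) = sD (poly (map_poly (zp_embed sK) q) k) 1"
proof (induction q)
  case (pCons a q)
  have "zp_embed sK 0 = 0" by (simp add: zp_embed_def)
  then have "poly (map_poly (zp_embed sK) (pCons a q)) k
      = zp_embed sK a + k * poly (map_poly (zp_embed sK) q) k"
    using pCons.hyps by (simp add: map_poly_pCons)
  then show ?case
    by (simp add: zeval_simps pCons.IH D.scale_left_distrib sD_one_mult sF_zp_embed)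
qed (simp add: zeval_simps)

text \<open>Translates the ring of integers of \<open>K\<close> into integrality inside
  \<open>D\<close>, so that bounds proved in \<open>D\<close> apply to the coefficients of an
  order.\<close>

lemma integer_ring_iff: "k \<in> integer_ring sK \<longleftrightarrow> integral (sD k 1)"
  by (simp add: integer_ring_def integral_def zeval_sD)

lemma order_closed:
  "1 \<in> \<Delta>" "0 \<in> \<Delta>" "x \<in> \<Delta> \<Longrightarrow> y \<in> \<Delta> \<Longrightarrow> x - y \<in> \<Delta>" "x \<in> \<Delta> \<Longrightarrow> y \<in> \<Delta> \<Longrightarrow> x * y \<in> \<Delta>"
  "x \<in> \<Delta> \<Longrightarrow> y \<in> \<Delta> \<Longrightarrow> x + y \<in> \<Delta>"
proof -
  show one: "1 \<in> \<Delta>" and diff: "x \<in> \<Delta> \<Longrightarrow> y \<in> \<Delta> \<Longrightarrow> x - y \<in> \<Delta>"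
    and "x \<in> \<Delta> \<Longrightarrow> y \<in> \<Delta> \<Longrightarrow> x * y \<in> \<Delta>" for x y
    using order unfolding is_order_def by blast+
  show zero: "0 \<in> \<Delta>" using diff[OF one one] by simp
  show "x \<in> \<Delta> \<Longrightarrow> y \<in> \<Delta> \<Longrightarrow> x + y \<in> \<Delta>" using diff[OF _ diff[OF zero], of x y] by simp
qed

lemma order_power: "x \<in> \<Delta> \<Longrightarrow> x ^ k \<in> \<Delta>"
  by (induction k) (auto simp: order_closed)

lemma order_of_nat: "x \<in> \<Delta> \<Longrightarrow> of_nat j * x \<in> \<Delta>"
  by (induction j) (auto simp: order_closed distrib_right)

lemma order_prm: "x \<in> \<Delta> \<Longrightarrow> prm ^ k * x \<in> \<Delta>"
  using order_of_nat[of x "CARD('p) ^ k"] by (simp add: prm_def)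

lemma order_sum: "(\<And>i. i \<in> I \<Longrightarrow> f i \<in> \<Delta>) \<Longrightarrow> sum f I \<in> \<Delta>"
  by (induction I rule: infinite_finite_induct) (auto simp: order_closed)

end

locale padic_order_lattice = padic_order sK sD \<Delta> + padic_lattice sF B v \<kappa>
  for sK :: "'p::prime_card padic \<Rightarrow> 'k::field \<Rightarrow> 'k"
    and sD :: "'k \<Rightarrow> 'd::division_ring \<Rightarrow> 'd" and \<Delta> B v \<kappa>
begin

text \<open>An order is bounded: its coefficients are integral, hence bounded by the exponent
  \<open>c\<close>, and its finitely many generators by \<open>t\<close>. Since it is closed under
  products, the powers of each element stay bounded.\<close>

lemma order_integral:
  assumes "x \<in> \<Delta>"
  shows "integral x"
proof -
  obtain S where S: "finite S" "\<Delta> = {\<Sum>s\<in>S. sD (c s) s | c. \<forall>s\<in>S. c s \<in> integer_ring sK}"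
    using order unfolding is_order_def by blast
  obtain c where c: "\<And>x. integral x \<Longrightarrow> prm ^ c * x \<in> lattice" using integral_bounded by blast
  obtain t where t: "\<And>s. s \<in> S \<Longrightarrow> prm ^ t * s \<in> lattice" using lattice_absorbs_finite[OF S(1)] by blast
  have bounded: "prm ^ (c + t) * y \<in> lattice" if y: "y \<in> \<Delta>" for y
  proof -
    obtain a where a: "y = (\<Sum>s\<in>S. sD (a s) s)" "\<And>s. s \<in> S \<Longrightarrow> a s \<in> integer_ring sK"
      using y unfolding S(2) by blast
    have "prm ^ (c + t) * sD (a s) s = (prm ^ c * sD (a s) 1) * (prm ^ t * s)" if "s \<in> S" for s
    proof -
      have "prm ^ (c + t) * sD (a s) s = prm ^ c * (prm ^ t * sD (a s) 1) * s"
        by (simp add: power_add mult.assoc sD_one_mult_left)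
      also have "prm ^ t * sD (a s) 1 = sD (a s) 1 * prm ^ t" by (rule prm_commute)
      finally show ?thesis by (simp add: mult.assoc)
    qed
    then have "prm ^ (c + t) * y = (\<Sum>s\<in>S. (prm ^ c * sD (a s) 1) * (prm ^ t * s))"
      by (simp add: a(1) sum_distrib_left)
    moreover have "(prm ^ c * sD (a s) 1) * (prm ^ t * s) \<in> lattice" if "s \<in> S" for s
      using a(2)[OF that] by (intro lattice_mult c t that) (simp add: integer_ring_iff)
    ultimately show ?thesis by (simp add: lattice_sum)
  qed
  show ?thesis using bounded[OF order_power[OF assms]] by (rule bounded_powers_integral)
qed

text \<open>Each of the finitely many \<open>v b\<close> is a \<open>K\<close>-combination of the
  generators, and \<open>prm ^ M\<close> makes all coefficients integral. So \<open>prm ^ M\<close>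
  carries the lattice into the order, and \<open>prm ^ c\<close> carries integral elements into the
  lattice.\<close>

lemma integral_in_order: "\<exists>N. \<forall>x. integral x \<longrightarrow> prm ^ N * x \<in> \<Delta>"
proof -
  obtain S where S: "finite S" "\<Delta> = {\<Sum>s\<in>S. sD (c s) s | c. \<forall>s\<in>S. c s \<in> integer_ring sK}"
    using order unfolding is_order_def by blast
  have "\<Delta> \<subseteq> D.span S"
  proof
    fix x assume "x \<in> \<Delta>"
    then obtain a where "x = (\<Sum>s\<in>S. sD (a s) s)" unfolding S(2) by blast
    then show "x \<in> D.span S" by (simp add: D.span_sum D.span_scale D.span_base)
  qed
  moreover have "D.span \<Delta> = UNIV" using order unfolding is_order_def by blast
  ultimately have spanS: "D.span S = UNIV" using D.span_minimal[OF _ D.subspace_span] by blast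
  have "\<exists>k. x = (\<Sum>s\<in>S. sD (k s) s)" for x
    using spanS unfolding D.span_finite[OF S(1)] by blast
  then obtain k where k: "\<And>x. x = (\<Sum>s\<in>S. sD (k x s) s)" by metis
  have "\<exists>M. \<forall>y\<in>A. integral (prm ^ M * y)" if "finite A" for A
    using lattice_absorbs_finite[OF that] lattice_integral by blast
  moreover have "finite ((\<lambda>(b, s). sD (k (v b) s) 1) ` (B \<times> S))" using finite_B S(1) by blast
  ultimately obtain M where "\<forall>y\<in>(\<lambda>(b, s). sD (k (v b) s) 1) ` (B \<times> S). integral (prm ^ M * y)"
    by meson
  then have M: "\<And>b s. b \<in> B \<Longrightarrow> s \<in> S \<Longrightarrow> integral (prm ^ M * sD (k (v b) s) 1)" by auto
  let ?p = "of_nat CARD('p) :: 'p padic"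
  have v\<Delta>: "sF a (prm ^ M * v b) \<in> \<Delta>" if a: "a \<in> padic_integers" and b: "b \<in> B" for a b
  proof -
    let ?c = "\<lambda>s. sK (a * ?p ^ M) 1 * k (v b) s"
    have "sF a (prm ^ M * v b) = sD (sK (a * ?p ^ M) 1) (v b)"
      by (simp add: prm_power_mult sF_def sK_one_mult)
    also have "\<dots> = (\<Sum>s\<in>S. sD (?c s) s)"
      by (subst k[of "v b"]) (simp add: D.scale_sum_right)
    finally have eq: "sF a (prm ^ M * v b) = (\<Sum>s\<in>S. sD (?c s) s)" .
    have "?c s \<in> integer_ring sK" if "s \<in> S" for s
    proof -
      have "sD (?c s) 1 = sF a (prm ^ M * sD (k (v b) s) 1)"
        by (simp add: prm_power_mult sF_def sK_one_mult flip: mult.assoc)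
      then show ?thesis using integral_scale[OF a M[OF b that]] by (simp add: integer_ring_iff)
    qed
    then show ?thesis unfolding S(2) by (intro CollectI exI[of _ ?c] conjI ballI eq)
  qed
  have lat: "prm ^ M * x \<in> \<Delta>" if x: "x \<in> lattice" for x
  proof -
    have "prm ^ M * x = prm ^ M * (\<Sum>b\<in>B. sF (\<kappa> b x) (v b))" by (simp only: \<kappa>_expand[of x, symmetric])
    also have "\<dots> = (\<Sum>b\<in>B. sF (\<kappa> b x) (prm ^ M * v b))"
      by (simp add: sum_distrib_left mult_scale_right)
    also have "\<dots> \<in> \<Delta>" using x by (intro order_sum v\<Delta>) (auto simp: lattice_def)
    finally show ?thesis .
  qed
  obtain c where c: "\<And>x. integral x \<Longrightarrow> prm ^ c * x \<in> lattice" using integral_bounded by blast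
  have "prm ^ (M + c) * x \<in> \<Delta>" if "integral x" for x
    using lat[OF c[OF that]] by (simp add: power_add mult.assoc)
  then show ?thesis by blast
qed

end

subsection \<open>Virtual endomorphisms\<close>

context fd_division_algebra_0
begin

lemma linear_injective_bij:
  assumes add: "\<And>x y. f (x + y) = f x + f y" and sc: "\<And>a x. f (scale a x) = scale a (f x)"
    and inj: "\<And>x. f x = 0 \<Longrightarrow> x = 0"
  shows "bij f"
proof -
  obtain S where S: "finite S" "span S = UNIV" by (rule obtain_spanning)
  obtain B where B: "independent B" "UNIV \<subseteq> span B"
    using maximal_independent_subset[of UNIV] by blast
  have fin: "finite B" using independent_span_bound[OF S(1) B(1)] S(2) by simp
  interpret fdim: finite_dimensional_vector_space scale B
    by unfold_locales (use fin B in auto)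
  have lin: "Vector_Spaces.linear scale scale f"
    by unfold_locales (simp_all add: add sc)
  have "f (x - y) = f x - f y" for x y using add[of "x - y" y] by (simp add: algebra_simps)
  then have "inj f" using inj by (intro injI) (metis right_minus_eq)
  then show ?thesis using fdim.linear_inj_imp_surj[OF lin] by (simp add: bij_def)
qed

text \<open>\<phi> is extended by the identity on the center. Brackets depend only on the components
  in \<open>derived\<close>, so they are respected. Bijectivity follows from injectivity in finite
  dimension, and \<open>der\<close> keeps the images of the two summands apart.\<close>

lemma extend_to_lie_automorphism:
  assumes add: "\<And>x y. x \<in> derived \<Longrightarrow> y \<in> derived \<Longrightarrow> \<phi> (x + y) = \<phi> x + \<phi> y"
    and sc: "\<And>a x. x \<in> derived \<Longrightarrow> \<phi> (scale a x) = scale a (\<phi> x)"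
    and br: "\<And>x y. x \<in> derived \<Longrightarrow> y \<in> derived \<Longrightarrow> \<phi> (x * y - y * x) = \<phi> x * \<phi> y - \<phi> y * \<phi> x"
    and der: "\<And>x. x \<in> derived \<Longrightarrow> \<phi> x \<in> derived"
    and inj: "\<And>x. x \<in> derived \<Longrightarrow> \<phi> x = 0 \<Longrightarrow> x = 0"
  shows "\<exists>\<theta>. lie_automorphism \<theta> \<and> (\<forall>x\<in>derived. \<theta> x = \<phi> x)"
proof -
  have "\<forall>x. \<exists>d. d \<in> derived \<and> x - d \<in> center"
  proof
    fix x
    obtain k d where "k \<in> center" "d \<in> derived" "x = k + d" using center_plus_derived by blast
    then show "\<exists>d. d \<in> derived \<and> x - d \<in> center" by (intro exI[of _ d]) simp
  qed
  from choice[OF this] obtain \<pi> where \<pi>: "\<And>x. \<pi> x \<in> derived" "\<And>x. x - \<pi> x \<in> center" by blast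
  note Z = division_subringD[OF division_subring_center]
  have uniq: "\<pi> x = d" if "d \<in> derived" "x - d \<in> center" for x d
  proof -
    have "(x - d) - (x - \<pi> x) \<in> center" using that \<pi> Z(8) by blast
    then have "\<pi> x - d \<in> center" by simp
    then show ?thesis using center_inter_derived[of "\<pi> x - d"] derived_diff[OF \<pi>(1) that(1)] by simp
  qed
  have \<pi>d: "\<pi> x = x" if "x \<in> derived" for x using uniq[OF that] Z(1) by simp
  have \<pi>_add: "\<pi> (x + y) = \<pi> x + \<pi> y" for x y
  proof (rule uniq)
    have "(x - \<pi> x) + (y - \<pi> y) \<in> center" using \<pi>(2) Z(4) by blast
    then show "x + y - (\<pi> x + \<pi> y) \<in> center" by (simp add: algebra_simps)
  qed (intro derived_add \<pi>)
  have \<pi>_sc: "\<pi> (scale a x) = scale a (\<pi> x)" for a x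
  proof (rule uniq)
    show "scale a x - scale a (\<pi> x) \<in> center"
      using Z(9)[OF \<pi>(2)[of x], of a] by (simp add: scale_right_diff_distrib)
  qed (intro derived_scale \<pi>)
  have com: "x * y - y * x = x' * y' - y' * x'" if "x - x' \<in> center" "y - y' \<in> center" for x y x' y'
  proof -
    have "(x - x') * y = y * (x - x')" "(y - y') * x' = x' * (y - y')"
      using center_commute that by blast+
    then have "x * y - y * x = x' * y - y * x'" "x' * y - y * x' = x' * y' - y' * x'"
      by (simp_all add: algebra_simps)
    then show ?thesis by simp
  qed
  define \<theta> where "\<theta> = (\<lambda>x. (x - \<pi> x) + \<phi> (\<pi> x))"
  have \<theta>c: "\<theta> x - \<phi> (\<pi> x) \<in> center" for x using \<pi>(2) by (simp add: \<theta>_def)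
  have \<theta>d: "\<theta> x = \<phi> x" if "x \<in> derived" for x using \<pi>d[OF that] by (simp add: \<theta>_def)
  have \<theta>_add: "\<theta> (x + y) = \<theta> x + \<theta> y" for x y
    by (simp add: \<theta>_def \<pi>_add add[OF \<pi>(1) \<pi>(1)])
  have \<theta>_sc: "\<theta> (scale a x) = scale a (\<theta> x)" for a x
    by (simp add: \<theta>_def \<pi>_sc sc[OF \<pi>(1)] scale_right_distrib scale_right_diff_distrib)
  have "\<theta> (x * y - y * x) = \<theta> x * \<theta> y - \<theta> y * \<theta> x" for x y
  proof -
    have "\<theta> (x * y - y * x) = \<phi> (\<pi> x * \<pi> y - \<pi> y * \<pi> x)"
      using \<theta>d[OF derived_commutator[of x y]] com[OF \<pi>(2) \<pi>(2), of x y] by simp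
    also have "\<dots> = \<phi> (\<pi> x) * \<phi> (\<pi> y) - \<phi> (\<pi> y) * \<phi> (\<pi> x)" by (intro br \<pi>)
    also have "\<dots> = \<theta> x * \<theta> y - \<theta> y * \<theta> x" by (rule com[symmetric]) (rule \<theta>c)+
    finally show ?thesis .
  qed
  moreover have "bij \<theta>"
  proof (rule linear_injective_bij[OF \<theta>_add \<theta>_sc])
    fix x assume 0: "\<theta> x = 0"
    then have "\<phi> (\<pi> x) \<in> center" using \<theta>c[of x] Z(7)[of "- \<phi> (\<pi> x)"] by simp
    then have 1: "\<phi> (\<pi> x) = 0" using center_inter_derived der[OF \<pi>(1)] by blast
    have 2: "\<pi> x = 0" by (rule inj[OF \<pi>(1) 1])
    show "x = 0" using 0 unfolding \<theta>_def 1 unfolding 2 by simp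
  qed
  ultimately have "lie_automorphism \<theta>" using \<theta>_add \<theta>_sc by (simp add: lie_automorphism_def)
  then show ?thesis using \<theta>d by blast
qed

end

context padic_order_lattice
begin

lemma prm_power_scale: "prm ^ k * x = sF (padic_of_int (of_nat CARD('p) ^ k)) x"
  by (simp add: prm_power_mult)

text \<open>Among the \<open>CARD('p) + 1\<close> elements \<open>prm ^ i * y\<close> two lie in the
  same coset. Their difference is \<open>prm ^ i * y\<close> times p^(j - i) - 1, a p-adic unit, so
  \<open>prm ^ i * y\<close> itself lies in \<open>M\<close> for some \<open>i\<close> at most
  \<open>CARD('p)\<close>.\<close>

lemma finite_index_absorbs:
  assumes M: "0 \<in> M" "\<And>x y. x \<in> M \<Longrightarrow> y \<in> M \<Longrightarrow> x + y \<in> M" "\<And>a x. x \<in> M \<Longrightarrow> sF (padic_of_int a) x \<in> M"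
    and index: "add_index A M = CARD('p)" and A: "\<And>i. prm ^ i * y \<in> A"
  shows "prm ^ CARD('p) * y \<in> M"
proof -
  let ?f = "\<lambda>i. (\<lambda>z. prm ^ i * y + z) ` M"
  let ?C = "(\<lambda>x. (\<lambda>z. x + z) ` M) ` A"
  have C: "card ?C = CARD('p)" using index by (simp add: add_index_def)
  \<comment> \<open>\<open>add_index\<close> is 0 for infinitely many cosets, so a positive index
    includes finiteness.\<close>
  have "CARD('p) > 0" using card_gt_1[where 'p = 'p] by simp
  then have "finite ?C" using C by (intro card_ge_0_finite) simp
  moreover have "?f ` {..CARD('p)} \<subseteq> ?C" using A by blast
  ultimately have "card (?f ` {..CARD('p)}) \<le> CARD('p)" using C card_mono by metis
  then have "\<not> inj_on ?f {..CARD('p)}" using card_image[of ?f "{..CARD('p)}"] by auto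
  then obtain i' j' where ij': "i' \<le> CARD('p)" "j' \<le> CARD('p)" "i' \<noteq> j'" "?f i' = ?f j'"
    unfolding inj_on_def by auto
  have "\<exists>i j. i < j \<and> i \<le> CARD('p) \<and> ?f i = ?f j"
  proof (cases "i' < j'")
    case True
    then show ?thesis using ij' by (intro exI[of _ i'] exI[of _ j'] conjI)
  next
    case False
    then show ?thesis using ij' by (intro exI[of _ j'] exI[of _ i'] conjI) auto
  qed
  then obtain i j where ij: "i < j" "i \<le> CARD('p)" "?f i = ?f j" by blast
  have "prm ^ j * y + 0 \<in> ?f j" using M(1) by (rule imageI)
  then obtain w where w: "w \<in> M" "prm ^ j * y = prm ^ i * y + w" unfolding ij(3)[symmetric] by auto
  let ?u = "of_nat CARD('p) ^ (j - i) - 1 :: 'p padic_int"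
  obtain e where e: "j - i = Suc e" using ij(1) by (cases "j - i") auto
  have "residue ?u 1 = (- 1) mod int CARD('p)"
    by (simp del: power_Suc add: residue_diff residue_power residue_1 e mod_simps)
  then have "residue ?u 1 \<noteq> 0" using card_gt_1[where 'p = 'p] by (simp add: zmod_minus1)
  then obtain u' where u': "?u * u' = 1" using residue_unit by blast
  have "prm ^ j * y = prm ^ (j - i) * (prm ^ i * y)"
    using ij(1) by (simp add: mult.assoc[symmetric] power_add[symmetric])
  then have "prm ^ j * y = sF (of_nat CARD('p) ^ (j - i)) (prm ^ i * y)" by (simp only: prm_power_mult[of "j - i"])
  moreover have "w = prm ^ j * y - prm ^ i * y" using w(2) by simp
  ultimately have "w = sF (padic_of_int ?u) (prm ^ i * y)" by (simp add: scale_left_diff_distrib)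
  then have "sF (padic_of_int u') w = sF (padic_of_int (?u * u')) (prm ^ i * y)"
    by (simp add: mult.commute)
  then have "prm ^ i * y \<in> M" using M(3)[OF w(1), of u'] by (simp only: u') simp
  then have "prm ^ (CARD('p) - i) * (prm ^ i * y) \<in> M" unfolding prm_power_scale[of "CARD('p) - i"] by (rule M(3))
  then show ?thesis using ij(2) by (simp add: mult.assoc[symmetric] power_add[symmetric])
qed

text \<open>The two inclusions for \<open>L\<close> summarise what the reduced trace contributes:
  the commutators in the order are caught, and every element is integral.\<close>

lemma not_self_similar:
  assumes nz: "derived \<noteq> {0}" and L: "derived \<inter> \<Delta> \<subseteq> L" "L \<subseteq> \<Delta>"
  shows "\<not> self_similar (\<lambda>z. sD (zp_embed sK z)) commutator
    ((\<lambda>x. of_nat (CARD('p) ^ m) * x) ` L) CARD('p)"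
proof
  let ?L = "(\<lambda>x. of_nat (CARD('p) ^ m) * x) ` L"
  let ?z = "\<lambda>z. sD (zp_embed sK z)"
  assume "self_similar ?z commutator ?L CARD('p)"
  then obtain M \<phi> where v: "virtual_endomorphism ?z commutator ?L CARD('p) M \<phi>"
    and simple: "\<not> (\<exists>I. lie_ideal ?z commutator ?L I \<and> I \<noteq> {0} \<and> I \<subseteq> M \<and> \<phi> ` I \<subseteq> I)"
    unfolding self_similar_def simple_virtual_endomorphism_def by blast
  have sub: "lie_subalgebra ?z commutator ?L M" and index: "add_index ?L M = CARD('p)"
    using v unfolding virtual_endomorphism_def by blast+
  have Msub: "M \<subseteq> ?L" and "module.subspace ?z M"
    and Mc: "\<And>x y. x \<in> M \<Longrightarrow> y \<in> M \<Longrightarrow> x * y - y * x \<in> M"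
    using sub unfolding lie_subalgebra_def commutator_def by blast+
  then have M0: "0 \<in> M" and Ma: "\<And>x y. x \<in> M \<Longrightarrow> y \<in> M \<Longrightarrow> x + y \<in> M"
    and Mz: "\<And>a x. x \<in> M \<Longrightarrow> sF (padic_of_int a) x \<in> M"
    unfolding module.subspace_def[OF module_zp] sF_zp_embed by blast+
  have \<phi>L: "\<And>x. x \<in> M \<Longrightarrow> \<phi> x \<in> ?L" and \<phi>a: "\<And>x y. x \<in> M \<Longrightarrow> y \<in> M \<Longrightarrow> \<phi> (x + y) = \<phi> x + \<phi> y"
    and \<phi>z: "\<And>a x. x \<in> M \<Longrightarrow> \<phi> (sF (padic_of_int a) x) = sF (padic_of_int a) (\<phi> x)"
    and \<phi>c: "\<And>x y. x \<in> M \<Longrightarrow> y \<in> M \<Longrightarrow> \<phi> (x * y - y * x) = \<phi> x * \<phi> y - \<phi> y * \<phi> x"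
    using v unfolding virtual_endomorphism_def commutator_def sF_zp_embed by blast+
  have Mp: "prm ^ k * x \<in> M" and \<phi>p: "\<phi> (prm ^ k * x) = prm ^ k * \<phi> x" if "x \<in> M" for k x
    unfolding prm_power_scale by (rule Mz[OF that], rule \<phi>z[OF that])
  have Mmono: "prm ^ l * x \<in> M" if "prm ^ k * x \<in> M" "k \<le> l" for k l x
  proof -
    have "prm ^ l * x = prm ^ (l - k) * (prm ^ k * x)"
      using that(2) by (simp add: mult.assoc[symmetric] power_add[symmetric])
    then show ?thesis using Mp[OF that(1), of "l - k"] by simp
  qed
  have cancel: "x = y" if "prm ^ k * x = prm ^ k * y" for k x y
    using that prm_power_nonzero[of k] by (simp only: mult_cancel_left) blast
  have dp: "prm ^ k * x \<in> derived" if "x \<in> derived" for k x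
    unfolding prm_power_mult by (rule derived_scale[OF that])
  have pm: "of_nat (CARD('p) ^ m) * x = prm ^ m * x" for x by (simp add: prm_def)
  have absorb_\<Delta>: "prm ^ (CARD('p) + m) * x \<in> M" if "x \<in> derived" "x \<in> \<Delta>" for x
  proof -
    have "prm ^ CARD('p) * (prm ^ m * x) \<in> M"
    proof (rule finite_index_absorbs[OF M0 Ma Mz index])
      fix i
      have "prm ^ i * x \<in> L" using L(1) dp[OF that(1)] order_prm[OF that(2)] by blast
      moreover have "prm ^ i * (prm ^ m * x) = prm ^ m * (prm ^ i * x)"
        by (simp add: mult.assoc[symmetric] power_add[symmetric] add.commute)
      ultimately show "prm ^ i * (prm ^ m * x) \<in> ?L" by (simp only: pm) blast
    qed
    then show ?thesis by (simp add: power_add mult.assoc)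
  qed
  obtain N0 where N0: "\<And>x. integral x \<Longrightarrow> prm ^ N0 * x \<in> \<Delta>" using integral_in_order by blast
  \<comment> \<open>\<open>N0\<close> brings integral elements into the order, \<open>m\<close>
    accounts for the factor in the lattice and \<open>CARD('p)\<close> for the index.\<close>
  define N where "N = CARD('p) + m + N0"
  have absorb: "prm ^ N * x \<in> M" if "x \<in> derived" "integral x" for x
    using absorb_\<Delta>[OF dp[OF that(1)] N0[OF that(2)]] by (simp add: N_def power_add mult.assoc)
  have ex: "\<exists>k. prm ^ k * x \<in> M" if x: "x \<in> derived" for x
  proof -
    obtain k where "integral (prm ^ k * x)" using integral_absorbs by blast
    then have "prm ^ N * (prm ^ k * x) \<in> M" using absorb dp[OF x] by blast
    then have "prm ^ (N + k) * x \<in> M" by (simp add: power_add mult.assoc)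
    then show ?thesis by blast
  qed
  \<comment> \<open>The linear extension of \<phi> to \<open>derived\<close>: some
    \<open>prm ^ k * x\<close> lies in \<open>M\<close>, and its image divided by
    \<open>prm ^ k\<close> does not depend on \<open>k\<close>. Where no such multiple lies in
    \<open>M\<close>, the value is arbitrary.\<close>
  have "\<forall>x. \<exists>y. \<forall>k. prm ^ k * x \<in> M \<longrightarrow> prm ^ k * y = \<phi> (prm ^ k * x)"
  proof
    fix x
    show "\<exists>y. \<forall>k. prm ^ k * x \<in> M \<longrightarrow> prm ^ k * y = \<phi> (prm ^ k * x)"
    proof (cases "\<exists>l. prm ^ l * x \<in> M")
      case True
      then obtain l where l: "prm ^ l * x \<in> M" by blast
      let ?y = "inverse (prm ^ l) * \<phi> (prm ^ l * x)"
      have y: "prm ^ l * ?y = \<phi> (prm ^ l * x)"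
        using prm_power_nonzero[of l] by (simp add: mult.assoc[symmetric])
      have "prm ^ k * ?y = \<phi> (prm ^ k * x)" if k: "prm ^ k * x \<in> M" for k
      proof (rule cancel[of l])
        have "prm ^ l * (prm ^ k * ?y) = prm ^ k * (prm ^ l * ?y)"
          by (simp add: mult.assoc[symmetric] power_add[symmetric] add.commute)
        also have "\<dots> = \<phi> (prm ^ k * (prm ^ l * x))" unfolding y by (rule \<phi>p[OF l, symmetric])
        also have "prm ^ k * (prm ^ l * x) = prm ^ l * (prm ^ k * x)"
          by (simp add: mult.assoc[symmetric] power_add[symmetric] add.commute)
        also have "\<phi> \<dots> = prm ^ l * \<phi> (prm ^ k * x)" by (rule \<phi>p[OF k])
        finally show "prm ^ l * (prm ^ k * ?y) = prm ^ l * \<phi> (prm ^ k * x)" .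
      qed
      then show ?thesis by blast
    qed blast
  qed
  from choice[OF this] obtain \<psi>
    where \<psi>: "\<And>x k. prm ^ k * x \<in> M \<Longrightarrow> prm ^ k * \<psi> x = \<phi> (prm ^ k * x)" by blast
  have \<psi>_add: "\<psi> (x + y) = \<psi> x + \<psi> y" if xy: "x \<in> derived" "y \<in> derived" for x y
  proof -
    obtain k l where "prm ^ k * x \<in> M" "prm ^ l * y \<in> M" using ex xy by blast
    then have k: "prm ^ (k + l) * x \<in> M" "prm ^ (k + l) * y \<in> M" using Mmono by simp_all
    have "prm ^ (k + l) * (x + y) \<in> M" unfolding distrib_left by (rule Ma[OF k])
    then have "prm ^ (k + l) * \<psi> (x + y) = \<phi> (prm ^ (k + l) * (x + y))" by (rule \<psi>)
    also have "\<dots> = prm ^ (k + l) * (\<psi> x + \<psi> y)"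
      unfolding distrib_left \<phi>a[OF k] \<psi>[OF k(1)] \<psi>[OF k(2)] ..
    finally show ?thesis by (rule cancel)
  qed
  have \<psi>_scale: "\<psi> (sF a x) = sF a (\<psi> x)" if x: "x \<in> derived" for a x
  proof -
    obtain k where k: "prm ^ k * x \<in> M" using ex x by blast
    obtain j where "of_nat CARD('p) ^ j * a \<in> padic_integers" using padic_denominator by blast
    then obtain z where z: "of_nat CARD('p) ^ j * a = padic_of_int z" by (rule padic_integersE)
    have eq: "prm ^ (j + k) * sF a y = sF (padic_of_int z) (prm ^ k * y)" for y
      unfolding prm_power_mult by (simp add: power_add z[symmetric] mult_ac)
    have "prm ^ (j + k) * sF a x \<in> M" unfolding eq by (rule Mz[OF k])
    then have "prm ^ (j + k) * \<psi> (sF a x) = \<phi> (prm ^ (j + k) * sF a x)" by (rule \<psi>)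
    also have "\<dots> = prm ^ (j + k) * sF a (\<psi> x)" unfolding eq \<phi>z[OF k] \<psi>[OF k] ..
    finally show ?thesis by (rule cancel)
  qed
  have \<psi>_br: "\<psi> (x * y - y * x) = \<psi> x * \<psi> y - \<psi> y * \<psi> x" if xy: "x \<in> derived" "y \<in> derived" for x y
  proof -
    obtain k l where k: "prm ^ k * x \<in> M" "prm ^ l * y \<in> M" using ex xy by blast
    have eq: "prm ^ (k + l) * (u * w - w * u) = (prm ^ k * u) * (prm ^ l * w) - (prm ^ l * w) * (prm ^ k * u)" for u w
    proof -
      have *: "(prm ^ k * u) * (prm ^ l * w) = prm ^ (k + l) * (u * w)" for k l u w
      proof -
        have "(prm ^ k * u) * (prm ^ l * w) = prm ^ k * (u * prm ^ l) * w" by (simp only: mult.assoc)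
        also have "u * prm ^ l = prm ^ l * u" by (rule prm_commute[symmetric])
        also have "prm ^ k * (prm ^ l * u) * w = prm ^ (k + l) * (u * w)"
          by (simp only: power_add mult.assoc)
        finally show ?thesis .
      qed
      show ?thesis by (simp only: * right_diff_distrib add.commute[of l k])
    qed
    have "prm ^ (k + l) * (x * y - y * x) \<in> M" unfolding eq by (rule Mc[OF k])
    then have "prm ^ (k + l) * \<psi> (x * y - y * x) = \<phi> (prm ^ (k + l) * (x * y - y * x))" by (rule \<psi>)
    also have "\<dots> = prm ^ (k + l) * (\<psi> x * \<psi> y - \<psi> y * \<psi> x)"
      unfolding eq \<phi>c[OF k] \<psi>[OF k(1)] \<psi>[OF k(2)] ..
    finally show ?thesis by (rule cancel)
  qed
  have \<psi>_der: "\<psi> x \<in> derived" if "x \<in> derived" for x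
    using that
  proof (induction rule: derived.induct)
    case zero
    then show ?case using \<psi>_scale[OF derived.zero, of 0] derived.zero by simp
  next
    case (add x y z)
    \<comment> \<open>Central parts drop out of brackets, so \<open>derived\<close> is spanned by
      brackets of its own elements, to which \<open>\<psi>_br\<close> applies.\<close>
    obtain k u k' u' where ku: "k \<in> center" "u \<in> derived" "y = k + u" "k' \<in> center" "u' \<in> derived" "z = k' + u'"
      using center_plus_derived by meson
    have "y * z - z * y = u * u' - u' * u"
      using center_commute[OF ku(1), of k'] center_commute[OF ku(1), of u'] center_commute[OF ku(4), of u]
      by (simp add: ku(3,6) algebra_simps)
    then have "\<psi> (x + (y * z - z * y)) = \<psi> x + (\<psi> u * \<psi> u' - \<psi> u' * \<psi> u)"
      using \<psi>_add[OF add.hyps derived_commutator] \<psi>_br[OF ku(2,5)] by simp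
    then show ?case using derived.add[OF add.IH] by simp
  qed
  have Lint: "integral x" if "x \<in> ?L" for x
  proof -
    obtain y where "y \<in> \<Delta>" "x = of_nat (CARD('p) ^ m) * y" using \<open>x \<in> ?L\<close> L(2) by blast
    then show ?thesis using order_integral order_of_nat by blast
  qed
  \<comment> \<open>A nonzero \<psi>-stable \<open>J\<close> closed under brackets with integral
    elements would, multiplied by \<open>prm ^ N\<close>, lie in \<open>M\<close> and be the ideal
    that simplicity forbids. Each case below supplies such a \<open>J\<close>.\<close>
  have ideal: "\<not> (\<forall>y\<in>J. \<psi> y \<in> J)" if J: "J \<subseteq> derived" "J \<noteq> {0}" "0 \<in> J" "\<And>y. y \<in> J \<Longrightarrow> integral y"
    "\<And>x y. x \<in> J \<Longrightarrow> y \<in> J \<Longrightarrow> x + y \<in> J" "\<And>a x. x \<in> J \<Longrightarrow> sF (padic_of_int a) x \<in> J"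
    "\<And>x y. integral x \<Longrightarrow> y \<in> J \<Longrightarrow> x * y - y * x \<in> J" for J
  proof
    assume inv: "\<forall>y\<in>J. \<psi> y \<in> J"
    let ?I = "(\<lambda>y. prm ^ N * y) ` J"
    have IM: "?I \<subseteq> M" using absorb J(1,4) by blast
    have "lie_ideal ?z commutator ?L ?I"
      unfolding lie_ideal_def module.subspace_def[OF module_zp] sF_zp_embed commutator_def
    proof (intro conjI ballI allI)
      show "?I \<subseteq> ?L" using IM Msub by blast
      show "0 \<in> ?I" using imageI[OF J(3), of "\<lambda>y. prm ^ N * y"] by simp
      show "x + y \<in> ?I" if "x \<in> ?I" "y \<in> ?I" for x y
      proof -
        obtain u w where "u \<in> J" "w \<in> J" "x = prm ^ N * u" "y = prm ^ N * w" using \<open>x \<in> ?I\<close> \<open>y \<in> ?I\<close> by blast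
        then show ?thesis using J(5)[of u w] by (intro image_eqI[of _ _ "u + w"]) (simp_all add: distrib_left)
      qed
      show "sF (padic_of_int c) x \<in> ?I" if "x \<in> ?I" for c x
      proof -
        obtain u where "u \<in> J" "x = prm ^ N * u" using \<open>x \<in> ?I\<close> by blast
        then show ?thesis using J(6)[of u c]
          by (intro image_eqI[of _ _ "sF (padic_of_int c) u"]) (simp_all add: mult_scale_right)
      qed
      show "x * y - y * x \<in> ?I" if "x \<in> ?L" "y \<in> ?I" for x y
      proof -
        obtain u where u: "u \<in> J" "y = prm ^ N * u" using \<open>y \<in> ?I\<close> by blast
        have "x * (prm ^ N * u) = prm ^ N * (x * u)" by (metis mult.assoc prm_commute)
        then have "x * y - y * x = prm ^ N * (x * u - u * x)"
          by (simp add: u(2) right_diff_distrib mult.assoc)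
        then show ?thesis using J(7)[OF Lint[OF \<open>x \<in> ?L\<close>] u(1)] by blast
      qed
    qed
    moreover have "?I \<noteq> {0}"
    proof -
      obtain y where "y \<in> J" "y \<noteq> 0" using J(2,3) by blast
      then have "prm ^ N * y \<in> ?I" "prm ^ N * y \<noteq> 0" using prm_power_nonzero[of N] by auto
      then show ?thesis by blast
    qed
    moreover have "\<phi> ` ?I \<subseteq> ?I"
    proof (intro image_subsetI)
      fix x assume "x \<in> ?I"
      then obtain u where u: "u \<in> J" "x = prm ^ N * u" by blast
      then have "\<phi> x = prm ^ N * \<psi> u" using \<psi>[of N u] IM by auto
      then show "\<phi> x \<in> ?I" using inv u(1) by blast
    qed
    ultimately show False using simple IM by blast
  qed
  show False
  proof (cases "\<exists>x\<in>derived. x \<noteq> 0 \<and> \<psi> x = 0")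
    case True
    then obtain x where x: "x \<in> derived" "x \<noteq> 0" "\<psi> x = 0" by blast
    let ?J = "{y \<in> derived. integral y \<and> \<psi> y = 0}"
    have \<psi>0: "\<psi> 0 = 0" using \<psi>_scale[OF derived.zero, of 0] by simp
    have "\<not> (\<forall>y\<in>?J. \<psi> y \<in> ?J)"
    proof (rule ideal)
      show "?J \<subseteq> derived" by blast
      obtain k where k: "integral (prm ^ k * x)" using integral_absorbs by blast
      have "\<psi> (prm ^ k * x) = 0" using \<psi>_scale[OF x(1)] x(3) by (simp add: prm_power_mult)
      then have "prm ^ k * x \<in> ?J" using k dp[OF x(1)] by blast
      moreover have "prm ^ k * x \<noteq> 0" using x(2) prm_power_nonzero[of k] by simp
      ultimately show "?J \<noteq> {0}" by blast
      show "0 \<in> ?J" using \<psi>0 derived.zero lattice_integral[OF lattice_0] by simp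
    next
      fix x y assume xy: "integral x" "y \<in> ?J"
      \<comment> \<open>\<open>\<psi>_br\<close> speaks about \<open>derived\<close> only, but the
        central part of \<open>x\<close> drops out of the bracket.\<close>
      obtain k u where ku: "k \<in> center" "u \<in> derived" "x = k + u" using center_plus_derived by blast
      have "x * y - y * x = u * y - y * u"
        using center_commute[OF ku(1), of y] by (simp add: ku(3) algebra_simps)
      then have "\<psi> (x * y - y * x) = 0" using \<psi>_br[OF ku(2), of y] xy(2) by simp
      then show "x * y - y * x \<in> ?J" using xy by (simp add: derived_commutator integral_closed)
    qed (auto simp: \<psi>_add \<psi>_scale derived_add derived_scale integral_closed integral_scale)
    then show False using \<psi>0 derived.zero lattice_integral[OF lattice_0] by simp
  next
    case False
    then have "\<exists>\<theta>. lie_automorphism \<theta> \<and> (\<forall>x\<in>derived. \<theta> x = \<psi> x)"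
      by (intro extend_to_lie_automorphism[OF \<psi>_add \<psi>_scale \<psi>_br \<psi>_der]) blast+
    then obtain \<theta> where \<theta>: "lie_automorphism \<theta>" "\<And>x. x \<in> derived \<Longrightarrow> \<theta> x = \<psi> x" by blast
    let ?J = "{y \<in> derived. integral y}"
    have "\<not> (\<forall>y\<in>?J. \<psi> y \<in> ?J)"
    proof (rule ideal)
      obtain x where x: "x \<in> derived" "x \<noteq> 0" using nz derived.zero by blast
      obtain k where k: "integral (prm ^ k * x)" using integral_absorbs by blast
      then have "prm ^ k * x \<in> ?J" using dp[OF x(1)] by blast
      moreover have "prm ^ k * x \<noteq> 0" using x(2) prm_power_nonzero[of k] by simp
      ultimately show "?J \<noteq> {0}" by blast
      show "0 \<in> ?J" using derived.zero lattice_integral[OF lattice_0] by simp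
    next
      fix x y assume "integral x" "y \<in> ?J"
      then show "x * y - y * x \<in> ?J" by (simp add: derived_commutator integral_closed)
    qed (auto simp: derived_add derived_scale integral_closed integral_scale)
    moreover have "\<psi> y \<in> ?J" if "y \<in> ?J" for y
      using that \<psi>_der integral_lie_automorphism[OF \<theta>(1)] \<theta>(2) by fastforce
    ultimately show False by blast
  qed
qed

end

subsection \<open>The reduced trace\<close>

lemma splitting_trace:
  assumes "splitting sD n \<rho>"
  shows "(\<Sum>i<n. \<rho> (x + y) $$ (i, i)) = (\<Sum>i<n. \<rho> x $$ (i, i)) + (\<Sum>i<n. \<rho> y $$ (i, i))"
    and "(\<Sum>i<n. \<rho> (x * y) $$ (i, i)) = (\<Sum>i<n. \<rho> (y * x) $$ (i, i))"
proof -
  have c: "\<rho> u \<in> carrier_mat n n" and a: "\<rho> (u + w) = \<rho> u + \<rho> w"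
    and m: "\<rho> (u * w) = \<rho> u * \<rho> w" for u w
    using assms by (auto simp: splitting_def)
  have dim: "dim_row (\<rho> u) = n" "dim_col (\<rho> u) = n" for u using c[of u] by auto
  show "(\<Sum>i<n. \<rho> (x + y) $$ (i, i)) = (\<Sum>i<n. \<rho> x $$ (i, i)) + (\<Sum>i<n. \<rho> y $$ (i, i))"
    by (simp add: a dim sum.distrib[symmetric])
  have mult: "(\<Sum>i<n. \<rho> (u * w) $$ (i, i)) = (\<Sum>i<n. \<Sum>j<n. \<rho> u $$ (i, j) * \<rho> w $$ (j, i))" for u w
    by (simp add: m dim scalar_prod_def lessThan_atLeast0)
  show "(\<Sum>i<n. \<rho> (x * y) $$ (i, i)) = (\<Sum>i<n. \<rho> (y * x) $$ (i, i))"
    unfolding mult by (subst sum.swap) (simp add: mult.commute)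
qed

text \<open>The definite description asks that all splittings give the same trace; demanding the
  value for every splitting provides this uniqueness.\<close>

lemma reduced_trace_eqI:
  assumes "splitting sD n \<rho>" and "\<And>\<rho>. splitting sD n \<rho> \<Longrightarrow> (\<Sum>i<n. \<rho> x $$ (i, i)) = to_ac t"
  shows "reduced_trace sD n x = t"
  unfolding reduced_trace_def
  using assms by (intro the_equality) auto

lemma self_similar_zero_mem:
  assumes "Modules.module smul" and "self_similar smul br L k"
  shows "0 \<in> L"
proof -
  obtain M where "M \<subseteq> L" "module.subspace smul M"
    using assms(2) unfolding self_similar_def simple_virtual_endomorphism_def
      virtual_endomorphism_def lie_subalgebra_def by blast
  then show ?thesis using module.subspace_0[OF assms(1)] by blast
qed

text \<open>The zero lattice has only itself as a subalgebra, and that has index 1, whereas the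
  index at stake is prime.\<close>

lemma self_similar_zero_index:
  assumes "Modules.module smul" and "self_similar smul br {0} k"
  shows "k = 1"
proof -
  obtain M where "M \<subseteq> {0}" "module.subspace smul M" "add_index {0} M = k"
    using assms(2) unfolding self_similar_def simple_virtual_endomorphism_def
      virtual_endomorphism_def lie_subalgebra_def by blast
  then have "M = {0}" using module.subspace_0[OF assms(1)] by blast
  then show ?thesis using \<open>add_index {0} M = k\<close> by (simp add: add_index_def)
qed

section \<open>The noncommutative and the commutative case\<close>

context padic_order
begin

text \<open>The existence of a splitting is left open. With one, every splitting has trace 0 on
  commutators; without one the reduced trace is constant, so \<open>sl_one\<close> is empty or all
  of \<open>\<Delta>\<close>. The empty set is excluded because a subalgebra contains 0.\<close>

lemma not_self_similar_noncommutative: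
  assumes "derived \<noteq> {0}"
  shows "\<not> self_similar (\<lambda>z. sD (zp_embed sK z)) commutator
    ((\<lambda>x. of_nat (CARD('p) ^ m) * x) ` sl_one sD n \<Delta>) CARD('p)"
proof (cases "sl_one sD n \<Delta> = {}")
  case True
  then show ?thesis using self_similar_zero_mem[OF module_zp] by fastforce
next
  case False
  have "derived \<inter> \<Delta> \<subseteq> sl_one sD n \<Delta>"
  proof (cases "\<exists>\<rho>. splitting sD n \<rho>")
    case True
    then obtain \<rho> where \<rho>: "splitting sD n \<rho>" by blast
    have "reduced_trace sD n x = 0" if "x \<in> derived" for x
    proof (rule reduced_trace_eqI[OF \<rho>])
      fix \<rho> assume \<rho>: "splitting sD n \<rho>"
      have "(\<Sum>i<n. \<rho> x $$ (i, i)) = 0" by (rule trace_derived[OF splitting_trace[OF \<rho>] that])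
      then show "(\<Sum>i<n. \<rho> x $$ (i, i)) = to_ac 0" by simp
    qed
    then show ?thesis by (auto simp: sl_one_def)
  next
    case no: False
    \<comment> \<open>then \<^const>\<open>reduced_trace\<close> has the same unspecified value everywhere\<close>
    then have "reduced_trace sD n x = (THE t. False)" for x by (simp add: reduced_trace_def)
    then show ?thesis using False by (auto simp: sl_one_def)
  qed
  moreover have "sl_one sD n \<Delta> \<subseteq> \<Delta>" by (auto simp: sl_one_def)
  moreover obtain B v \<kappa> where "padic_lattice sF B v \<kappa>" using lattice_exists by blast
  then interpret padic_lattice sF B v \<kappa> .
  interpret padic_order_lattice sK sD \<Delta> B v \<kappa> by unfold_locales
  show ?thesis using not_self_similar[OF assms] calculation by blast
qed

text \<open>Here \<open>D\<close> is \<open>K\<close> and \<open>n = 1\<close>. Any splitting sends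
  \<open>x\<close>, a multiple of 1, to a scalar 1 by 1 matrix, so the reduced trace is the
  identification \<open>c\<close> of \<open>D\<close> with \<open>K\<close> and vanishes only at 0.
  The explicit splitting shows that one exists.\<close>

lemma sl_one_commutative:
  assumes "derived = {0}" and dim: "vector_space.dim sD UNIV = n ^ 2"
  shows "sl_one sD n \<Delta> = {0}"
proof -
  have "x * y - y * x = 0" for x y :: 'd using derived_commutator[of x y] unfolding assms(1) by blast
  then have "center = UNIV" by (simp add: center_def)
  then have "\<forall>x. \<exists>c. sD c 1 = x" using center_eq by (metis rangeE UNIV_I)
  from choice[OF this] obtain c where c: "\<And>x. sD (c x) 1 = x" by blast
  have c': "c (sD a 1) = a" for a using c[of "sD a 1"] by simp
  have c_add: "c (x + y) = c x + c y" for x y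
    using c'[of "c x + c y"] by (simp only: D.scale_left_distrib c)
  have c_scale: "c (sD a x) = a * c x" for a x
    using c'[of "a * c x"] by (simp only: D.scale_scale[symmetric] c)
  have c_mult: "c (x * y) = c x * c y" for x y
    using c_scale[of "c x" y] sD_one_mult_left[of "c x" y] by (simp only: c)
  have c_1: "c 1 = 1" using c'[of 1] by simp
  have span: "D.span {1} = UNIV" unfolding D.span_singleton by (rule surjI[of _ c]) (rule c)
  have indep: "D.independent {1}" by simp
  have "D.dim (UNIV::'d set) = 1" using D.dim_eq_card[of "{1}" UNIV] span indep by simp
  then have n: "n = 1" using dim by simp
  let ?\<rho> = "\<lambda>x. mat 1 1 (\<lambda>_. to_ac (c x))"
  have spl: "splitting sD n ?\<rho>"
    unfolding splitting_def n
  proof (intro conjI allI exI[of _ "{1}"])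
    show "bij_betw (\<lambda>k. mat 1 1 (\<lambda>(i, j). \<Sum>b\<in>{1}. k b * ?\<rho> b $$ (i, j)))
      ({1} \<rightarrow>\<^sub>E UNIV) (carrier_mat 1 1)"
      by (rule bij_betw_byWitness[where f' = "\<lambda>A. \<lambda>b\<in>{1}. A $$ (0, 0)"])
        (auto simp: c_1 intro!: eq_matI ext simp: PiE_def extensional_def)
  qed (use span indep in \<open>auto simp: c_add c_mult c_scale c_1 scalar_prod_def intro!: eq_matI\<close>)
  have "reduced_trace sD n x = c x" for x
  proof (rule reduced_trace_eqI[OF spl])
    fix \<rho> assume \<rho>: "splitting sD n \<rho>"
    have "\<rho> (sD (c x) 1) = to_ac (c x) \<cdot>\<^sub>m 1\<^sub>m 1" using \<rho> by (simp add: splitting_def n)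
    then show "(\<Sum>i<n. \<rho> x $$ (i, i)) = to_ac (c x)" by (simp add: c n)
  qed
  moreover have "0 \<in> \<Delta>" using order_closed by blast
  moreover have "x = 0" if "c x = 0" for x using c[of x] that by simp
  moreover have "c 0 = 0" using c'[of 0] by simp
  ultimately show ?thesis by (auto simp: sl_one_def)
qed

end

theorem theorem3p2:
  fixes sK :: "'p::prime_card padic \<Rightarrow> 'k::field \<Rightarrow> 'k"
    and sD :: "'k \<Rightarrow> 'd::division_ring \<Rightarrow> 'd"
    and \<Delta> :: "'d set"
    and p f n m :: nat
  assumes "p = CARD('p)"
    and "padic_field_extension sK"
    and "f = inertia_degree sK"
    and "unital_algebra sD"
    and "finite_dim sD"
    and "central sD"
    and "vector_space.dim sD UNIV = n ^ 2"
    and "is_maximal_order (integer_ring sK) sD \<Delta>"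
    and "f \<ge> 2 \<or> (p, n) \<notin> {(2, 2), (3, 3)}"
  shows "\<not> self_similar (\<lambda>z. sD (zp_embed sK z)) commutator
           ((\<lambda>x. of_nat (p ^ m) * x) ` sl_one sD n \<Delta>) p"
proof -
  interpret padic_order sK sD \<Delta>
    using assms(2,4-6,8) by (intro padic_order.intro) (simp_all add: is_maximal_order_def)
  show ?thesis
  proof (cases "derived = {0}")
    case True
    have "CARD('p) \<noteq> 1" using card_gt_1[where 'p = 'p] by simp
    then show ?thesis
      using self_similar_zero_index[OF module_zp] sl_one_commutative[OF True assms(7)] assms(1)
      by auto
  next
    case False
    then show ?thesis unfolding assms(1) by (rule not_self_similar_noncommutative)
  qed
qed

end
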